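(* For any $\epsilon>0$ and $M>1$ there exist $\eta>0$ and $\delta>0$ such that, whenever $\hbar\in\mathbb{R}\setminus\{0\}$ satisfies $|\hbar|<\delta$, the angular momentum operators $L_x,L_y,L_z$ on $L^2(\mathbb{R}^3)$ satisfy: (i) $S\mathrm{Sp}_M^{\eta}((L_x,L_y,L_z))\neq\emptyset$; (ii) for each $\lambda=(\lambda_x,\lambda_y,\lambda_z)\in S\mathrm{Sp}_M^{\eta}((L_x,L_y,L_z))$ there exists $v\in L^2(\mathbb{R}^3)$ with $\|v\|=1$ such that $$\|L_jv-\lambda_jv\|<\epsilon,\qquad j=x,y,z.$$
   Context: The angular momentum operators are the (unbounded, densely defined) self-adjoint operators on $L^2(\mathbb{R}^3)$ given by $$L_x=-i\hbar\left(y\tfrac{\partial}{\partial z}-z\tfrac{\partial}{\partial y}\right),\quad L_y=-i\hbar\left(z\tfrac{\partial}{\partial x}-x\tfrac{\partial}{\partial z}\right),\quad L_z=-i\hbar\left(x\tfrac{\partial}{\partial y}-y\tfrac{\partial}{\partial x}\right).$$ Spherical synthetic spectrum. For a triple $(h_1,h_2,h_3)$ of densely defined self-adjoint operators (here $(L_x,L_y,L_z)$), let $d=h_1^2+h_2^2+h_3^2$, regarded as a positive self-adjoint operator, and let $\bar h_j=(1+d)^{-1/2}h_j(1+d)^{-1/2}$ (a bounded operator, after extension from a dense subspace). Let $S^3=\{(r,\xi)\in\mathbb{R}\times\mathbb{R}^3:r^2+\|\xi\|_2^2=1\}$ with the Euclidean metric of $\mathbb{R}^4$, $\zeta^{np}=(1,0,0,0)$,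 and let $\Phi_{S^3}:\mathbb{R}^3\to S^3\setminus\{\zeta^{np}\}$ be the homeomorphism $$\Phi_{S^3}(t)=\left(\frac{\|t\|_2^2-1}{\|t\|_2^2+1},\frac{2t_1}{\|t\|_2^2+1},\frac{2t_2}{\|t\|_2^2+1},\frac{2t_3}{\|t\|_2^2+1}\right).$$ For $\lambda\in\mathbb{R}$, $\eta>0$ let $\theta_{\lambda,\eta}\in C(\mathbb{R})$ be the function with $0\le\theta_{\lambda,\eta}\le1$, $\theta_{\lambda,\eta}(t)=1$ if $|t-\lambda|\le3\eta/4$, $\theta_{\lambda,\eta}(t)=0$ if $|t-\lambda|\ge\eta$, and linear on $[\lambda-\eta,\lambda-3\eta/4]$ and $[\lambda+3\eta/4,\lambda+\eta]$. For $x=(t_0,t_1,t_2,t_3)\in S^3$ put $$\Theta^S_{x,\eta}(h_1,h_2,h_3)=\theta_{t_0,\eta}\big((-1+d)(1+d)^{-1}\big)\,\theta_{t_1,\eta}(2\bar h_1)\,\theta_{t_2,\eta}(2\bar h_2)\,\theta_{t_3,\eta}(2\bar h_3).$$ Let $k=\inf\{l\in\mathbb{N}:(M+1)/l<\eta/(2\sqrt3)\}$, $\mathbb{P}_k^M=\bigcup_{l=1}^k\{(m_1/l,m_2/l,m_3/l):m_j\in\mathbb{Z},|m_j|\le Ml\}$, $D_M^\eta=\mathbb{P}_k^M\cap\{\zeta\in\mathbb{R}^3:\|\zeta\|_2\le M\}$, and $\Sigma_M=\Phi_{S^3}(D_M^\eta)$. With $D(x,\eta)=\{\xi\in S^3\setminus\{\zeta^{np}\}:\|\xi-x\|_2<\eta\}$,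 $$S\mathrm{Sp}_M^\eta((h_1,h_2,h_3))=\Phi_{S^3}^{-1}\left(\bigcup\left\{\overline{D(x,\eta)}:x\in\Sigma_M,\ \|\Theta^S_{x,\eta}(h_1,h_2,h_3)\|\ge1-\eta\right\}\right)\subset\mathbb{R}^3$$ (preimage under $\Phi_{S^3}$). *)

theory Defs
  imports "HOL-Analysis.Analysis" "HOL-Computational_Algebra.Polynomial"
begin

section \<open>The Hilbert space of square integrable functions on three-space\<close>

definition square_integrable :: "(real^3 \<Rightarrow> complex) \<Rightarrow> bool" where
  "square_integrable f \<longleftrightarrow>
     f \<in> borel_measurable lborel \<and> integrable lborel (\<lambda>x. (norm (f x))\<^sup>2)"

definition l2_rel :: "(real^3 \<Rightarrow> complex) \<Rightarrow> (real^3 \<Rightarrow> complex) \<Rightarrow> bool" where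
  "l2_rel f g \<longleftrightarrow> square_integrable f \<and> square_integrable g \<and> (AE x in lborel. f x = g x)"

quotient_type l2 = "real^3 \<Rightarrow> complex" / partial: l2_rel
proof (rule part_equivpI)
  have "square_integrable (\<lambda>_. 0)"
    by (simp add: square_integrable_def)
  then show "\<exists>f. l2_rel f f"
    by (auto simp: l2_rel_def)
  show "symp l2_rel"
    unfolding symp_def l2_rel_def by (auto elim: eventually_mono)
  show "transp l2_rel"
    unfolding transp_def l2_rel_def by (auto elim: eventually_elim2)
qed

lemma square_integrable_zero: "square_integrable (\<lambda>_. 0)"
  by (simp add: square_integrable_def)

lemma square_integrable_add:
  assumes "square_integrable f" "square_integrable g"
  shows "square_integrable (\<lambda>x. f x + g x)"
proof -
  have m: "f \<in> borel_measurable lborel" "g \<in> borel_measurable lborel"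
    and i: "integrable lborel (\<lambda>x. (norm (f x))\<^sup>2)" "integrable lborel (\<lambda>x. (norm (g x))\<^sup>2)"
    using assms by (auto simp: square_integrable_def)
  have bound: "(norm (a + b))\<^sup>2 \<le> 2 * (norm a)\<^sup>2 + 2 * (norm b)\<^sup>2" for a b :: complex
  proof -
    have "(norm (a + b))\<^sup>2 \<le> (norm a + norm b)\<^sup>2"
      by (intro power_mono norm_triangle_ineq) auto
    also have "\<dots> \<le> 2 * (norm a)\<^sup>2 + 2 * (norm b)\<^sup>2"
      using zero_le_power2[of "norm a - norm b"] by (simp add: power2_eq_square algebra_simps)
    finally show ?thesis .
  qed
  have "integrable lborel (\<lambda>x. (norm (f x + g x))\<^sup>2)"
  proof (rule Bochner_Integration.integrable_bound)
    show "integrable lborel (\<lambda>x. 2 * (norm (f x))\<^sup>2 + 2 * (norm (g x))\<^sup>2)"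
      using i by simp
    show "(\<lambda>x. (norm (f x + g x))\<^sup>2) \<in> borel_measurable lborel"
      using m by measurable
    show "AE x in lborel. norm ((norm (f x + g x))\<^sup>2)
        \<le> norm (2 * (norm (f x))\<^sup>2 + 2 * (norm (g x))\<^sup>2)"
      using bound by auto
  qed
  then show ?thesis
    using m by (auto simp: square_integrable_def)
qed

lemma square_integrable_scaleR:
  assumes "square_integrable f"
  shows "square_integrable (\<lambda>x. r *\<^sub>R f x)"
  using assms by (auto simp: square_integrable_def power_mult_distrib)

lemma square_integrable_uminus:
  assumes "square_integrable f"
  shows "square_integrable (\<lambda>x. - f x)"
  using assms by (auto simp: square_integrable_def)

lemma square_integrable_diff:
  assumes "square_integrable f" "square_integrable g"
  shows "square_integrable (\<lambda>x. f x - g x)"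
  using square_integrable_add[OF assms(1) square_integrable_uminus[OF assms(2)]] by simp

lemma integrable_inner_l2:
  assumes "square_integrable f" "square_integrable g"
  shows "integrable lborel (\<lambda>x. f x \<bullet> g x)"
proof (rule Bochner_Integration.integrable_bound)
  show "integrable lborel (\<lambda>x. (norm (f x))\<^sup>2 + (norm (g x))\<^sup>2)"
    using assms by (simp add: square_integrable_def)
  show "(\<lambda>x. f x \<bullet> g x) \<in> borel_measurable lborel"
    using assms by (auto simp: square_integrable_def)
  have "\<bar>a \<bullet> b\<bar> \<le> (norm a)\<^sup>2 + (norm b)\<^sup>2" for a b :: complex
  proof -
    have "\<bar>a \<bullet> b\<bar> \<le> norm a * norm b"
      by (rule Cauchy_Schwarz_ineq2)
    also have "\<dots> \<le> (norm a)\<^sup>2 + (norm b)\<^sup>2"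
      using sum_squares_bound[of "norm a" "norm b"] mult_nonneg_nonneg[of "norm a" "norm b"] norm_ge_zero[of a] norm_ge_zero[of b]
      by linarith
    finally show ?thesis .
  qed
  then show "AE x in lborel. norm (f x \<bullet> g x) \<le> norm ((norm (f x))\<^sup>2 + (norm (g x))\<^sup>2)"
    by auto
qed

text \<open>
  \<open>l2\<close> carries the real inner product \<open>Re \<langle>f, g\<rangle>\<close>, whose norm is the usual norm of the complex
  Hilbert space.
\<close>

instantiation l2 :: real_inner
begin

lift_definition zero_l2 :: l2 is "\<lambda>_. 0"
  by (simp add: l2_rel_def square_integrable_zero)

lift_definition plus_l2 :: "l2 \<Rightarrow> l2 \<Rightarrow> l2" is "\<lambda>f g x. f x + g x"
  by (auto simp: l2_rel_def square_integrable_add elim: eventually_elim2)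

lift_definition minus_l2 :: "l2 \<Rightarrow> l2 \<Rightarrow> l2" is "\<lambda>f g x. f x - g x"
  by (auto simp: l2_rel_def square_integrable_diff elim: eventually_elim2)

lift_definition uminus_l2 :: "l2 \<Rightarrow> l2" is "\<lambda>f x. - f x"
  by (auto simp: l2_rel_def square_integrable_uminus)

lift_definition scaleR_l2 :: "real \<Rightarrow> l2 \<Rightarrow> l2" is "\<lambda>r f x. r *\<^sub>R f x"
  by (auto simp: l2_rel_def square_integrable_scaleR elim: eventually_mono)

lift_definition inner_l2 :: "l2 \<Rightarrow> l2 \<Rightarrow> real" is "\<lambda>f g. \<integral>x. f x \<bullet> g x \<partial>lborel"
proof -
  fix f f' g g' :: "real^3 \<Rightarrow> complex"
  assume *: "l2_rel f f'" "l2_rel g g'"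
  have "AE x in lborel. f x = f' x" "AE x in lborel. g x = g' x"
    using * by (auto simp: l2_rel_def)
  then have "AE x in lborel. f x \<bullet> g x = f' x \<bullet> g' x"
    by eventually_elim simp
  moreover have "integrable lborel (\<lambda>x. f x \<bullet> g x)" "integrable lborel (\<lambda>x. f' x \<bullet> g' x)"
    using * by (auto simp: l2_rel_def intro: integrable_inner_l2)
  ultimately show "(\<integral>x. f x \<bullet> g x \<partial>lborel) = (\<integral>x. f' x \<bullet> g' x \<partial>lborel)"
    by (intro integral_cong_AE borel_measurable_integrable)
qed

definition norm_l2 :: "l2 \<Rightarrow> real" where "norm_l2 u = sqrt (u \<bullet> u)"
definition sgn_l2 :: "l2 \<Rightarrow> l2" where "sgn_l2 u = inverse (norm u) *\<^sub>R u"
definition dist_l2 :: "l2 \<Rightarrow> l2 \<Rightarrow> real" where "dist_l2 u v = norm (u - v)"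
definition uniformity_l2 :: "(l2 \<times> l2) filter" where
  "uniformity_l2 = (INF e\<in>{0<..}. principal {(u, v). dist u v < e})"
definition open_l2 :: "l2 set \<Rightarrow> bool" where
  "open_l2 U \<longleftrightarrow> (\<forall>x\<in>U. \<forall>\<^sub>F (x', y) in uniformity. x' = x \<longrightarrow> y \<in> U)"

instance
proof
  fix u v w :: l2 and a b :: real and U :: "l2 set"
  show "u + v + w = u + (v + w)"
    by transfer (auto simp: l2_rel_def add.assoc intro!: square_integrable_add)
  show "u + v = v + u"
    by transfer (auto simp: l2_rel_def add.commute intro!: square_integrable_add)
  show "0 + u = u"
    by transfer (auto simp: l2_rel_def)
  show "- u + u = 0"
    by transfer (auto simp: l2_rel_def square_integrable_zero)
  show "u - v = u + - v"
    by transfer (auto simp: l2_rel_def intro!: square_integrable_diff)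
  show "a *\<^sub>R (u + v) = a *\<^sub>R u + a *\<^sub>R v"
    by transfer (auto simp: l2_rel_def scaleR_add_right
        intro!: square_integrable_add square_integrable_scaleR)
  show "(a + b) *\<^sub>R u = a *\<^sub>R u + b *\<^sub>R u"
    by transfer (auto simp: l2_rel_def scaleR_add_left
        intro!: square_integrable_add square_integrable_scaleR)
  show "a *\<^sub>R b *\<^sub>R u = (a * b) *\<^sub>R u"
    by transfer (auto simp: l2_rel_def intro!: square_integrable_scaleR)
  show "1 *\<^sub>R u = u"
    by transfer (auto simp: l2_rel_def)
  show "sgn u = inverse (norm u) *\<^sub>R u"
    by (simp add: sgn_l2_def)
  show "dist u v = norm (u - v)"
    by (rule dist_l2_def)
  show "(uniformity :: (l2 \<times> l2) filter) = (INF e\<in>{0<..}. principal {(u, v). dist u v < e})"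
    by (rule uniformity_l2_def)
  show "open U = (\<forall>x\<in>U. \<forall>\<^sub>F (x', y) in uniformity. x' = x \<longrightarrow> y \<in> U)"
    by (rule open_l2_def)
  show "u \<bullet> v = v \<bullet> u"
    by transfer (simp add: inner_commute)
  show "(u + v) \<bullet> w = u \<bullet> w + v \<bullet> w"
    by transfer (simp add: l2_rel_def inner_add_left integrable_inner_l2)
  show "(a *\<^sub>R u) \<bullet> v = a * (u \<bullet> v)"
    by transfer simp
  show "0 \<le> u \<bullet> u"
    by transfer simp
  show "u \<bullet> u = 0 \<longleftrightarrow> u = 0"
  proof transfer
    fix f assume "l2_rel f f"
    then have f: "square_integrable f"
      by (simp add: l2_rel_def)
    have "(\<integral>x. f x \<bullet> f x \<partial>lborel) = 0 \<longleftrightarrow> (AE x in lborel. f x \<bullet> f x = 0)"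
      by (rule integral_nonneg_eq_0_iff_AE) (use f in \<open>auto intro: integrable_inner_l2\<close>)
    then show "(\<integral>x. f x \<bullet> f x \<partial>lborel) = 0 \<longleftrightarrow> l2_rel f (\<lambda>_. 0)"
      using f square_integrable_zero by (simp add: l2_rel_def)
  qed
  show "norm u = sqrt (u \<bullet> u)"
    by (rule norm_l2_def)
qed

end

section \<open>Unbounded operators, represented by their graphs\<close>

type_synonym 'a operator = "('a \<times> 'a) set"

definition op_apply :: "'a operator \<Rightarrow> 'a \<Rightarrow> 'a" where
  "op_apply A u = (THE v. (u, v) \<in> A)"

text \<open>Sums and products have their natural domains.\<close>

definition op_add :: "'a::plus operator \<Rightarrow> 'a operator \<Rightarrow> 'a operator" where
  "op_add A B = {(u, v + w) | u v w. (u, v) \<in> A \<and> (u, w) \<in> B}"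

definition op_mult :: "'a operator \<Rightarrow> 'a operator \<Rightarrow> 'a operator" where
  "op_mult A B = B O A"

definition op_of :: "('a::real_normed_vector \<Rightarrow>\<^sub>L 'a) \<Rightarrow> 'a operator" where
  "op_of T = {(u, blinfun_apply T u) | u. True}"

text \<open>
  The bounded operator extending a densely defined operator that is bounded on its domain.  On a
  complex Hilbert space the bounded real-linear operators contain the complex-linear ones, with
  the same operator norm, and the extension of a densely defined complex-linear operator is
  complex-linear.
\<close>

definition bounded_extension :: "'a::real_normed_vector operator \<Rightarrow> ('a \<Rightarrow>\<^sub>L 'a)" where
  "bounded_extension A = (THE T. A \<subseteq> op_of T)"

section \<open>Continuous functional calculus for a bounded self-adjoint operator\<close>

definition poly_op :: "real poly \<Rightarrow> ('a::real_normed_vector \<Rightarrow>\<^sub>L 'a) \<Rightarrow> ('a \<Rightarrow>\<^sub>L 'a)" where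
  "poly_op p T = (\<Sum>i\<le>degree p. coeff p i *\<^sub>R (((o\<^sub>L) T ^^ i) id_blinfun))"

text \<open>
  \<open>f(T)\<close> is the norm limit of \<open>p\<^sub>n(T)\<close> for real polynomials \<open>p\<^sub>n\<close> converging to \<open>f\<close> uniformly on
  \<open>[- \<parallel>T\<parallel>, \<parallel>T\<parallel>]\<close>, an interval which contains the spectrum of a self-adjoint \<open>T\<close>.
\<close>

definition fun_calc :: "(real \<Rightarrow> real) \<Rightarrow> ('a::real_normed_vector \<Rightarrow>\<^sub>L 'a) \<Rightarrow> ('a \<Rightarrow>\<^sub>L 'a)" where
  "fun_calc f T = (THE S. \<forall>p. uniform_limit {- norm T..norm T} (\<lambda>n. poly (p n)) f sequentially
     \<longrightarrow> (\<lambda>n. poly_op (p n) T) \<longlonglongrightarrow> S)"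

section \<open>The spherical synthetic spectrum\<close>

text \<open>
  If the operator sum is self-adjoint, taking the closure does not change it; if it is only
  essentially self-adjoint, the closure is its self-adjoint extension.
\<close>

definition sum_squares ::
    "'a::real_normed_vector operator \<Rightarrow> 'a operator \<Rightarrow> 'a operator \<Rightarrow> 'a operator" where
  "sum_squares h1 h2 h3 = closure (op_add (op_add (op_mult h1 h1) (op_mult h2 h2)) (op_mult h3 h3))"

definition resolvent :: "'a::real_normed_vector operator \<Rightarrow> ('a \<Rightarrow>\<^sub>L 'a)" where
  "resolvent d = bounded_extension ((op_add Id d)\<inverse>)"

definition cayley :: "'a::real_normed_vector operator \<Rightarrow> ('a \<Rightarrow>\<^sub>L 'a)" where
  "cayley d = bounded_extension
     (op_mult (op_add (op_of (- id_blinfun)) d) ((op_add Id d)\<inverse>))"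

text \<open>
  The spectrum of \<open>(1 + d)\<inverse>\<close> lies in \<open>[0, 1]\<close>; the values of the (continuous, odd) library
  function \<^const>\<open>sqrt\<close> at negative arguments are irrelevant.
\<close>

definition inv_sqrt :: "'a::real_normed_vector operator \<Rightarrow> ('a \<Rightarrow>\<^sub>L 'a)" where
  "inv_sqrt d = fun_calc sqrt (resolvent d)"

definition bounded_transform ::
    "'a::real_normed_vector operator \<Rightarrow> 'a operator \<Rightarrow> ('a \<Rightarrow>\<^sub>L 'a)" where
  "bounded_transform d h =
     bounded_extension (op_mult (op_of (inv_sqrt d)) (op_mult h (op_of (inv_sqrt d))))"

definition theta :: "real \<Rightarrow> real \<Rightarrow> real \<Rightarrow> real" where
  "theta l \<eta> t =
     (if \<bar>t - l\<bar> \<le> 3 * \<eta> / 4 then 1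
      else if \<bar>t - l\<bar> \<ge> \<eta> then 0
      else 4 * (\<eta> - \<bar>t - l\<bar>) / \<eta>)"

definition Theta_S :: "real \<times> (real^3) \<Rightarrow> real \<Rightarrow>
    'a::real_normed_vector operator \<times> 'a operator \<times> 'a operator \<Rightarrow> ('a \<Rightarrow>\<^sub>L 'a)" where
  "Theta_S x \<eta> h =
     (let (h1, h2, h3) = h; d = sum_squares h1 h2 h3; (t0, t) = x in
        fun_calc (theta t0 \<eta>) (cayley d)
        o\<^sub>L fun_calc (theta (t $ 1) \<eta>) (2 *\<^sub>R bounded_transform d h1)
        o\<^sub>L fun_calc (theta (t $ 2) \<eta>) (2 *\<^sub>R bounded_transform d h2)
        o\<^sub>L fun_calc (theta (t $ 3) \<eta>) (2 *\<^sub>R bounded_transform d h3))"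

text \<open>The product norm on \<^typ>\<open>real \<times> (real^3)\<close> is the Euclidean norm of four-space.\<close>

definition S3 :: "(real \<times> (real^3)) set" where
  "S3 = {(r, \<xi>). r\<^sup>2 + (norm \<xi>)\<^sup>2 = 1}"

definition north_pole :: "real \<times> (real^3)" where
  "north_pole = (1, 0)"

definition Phi :: "real^3 \<Rightarrow> real \<times> (real^3)" where
  "Phi t = (((norm t)\<^sup>2 - 1) / ((norm t)\<^sup>2 + 1), (2 / ((norm t)\<^sup>2 + 1)) *\<^sub>R t)"

text \<open>The conjunct \<open>0 < l\<close> is needed because division by zero yields zero.\<close>

definition k_idx :: "real \<Rightarrow> real \<Rightarrow> nat" where
  "k_idx M \<eta> = Inf {l. 0 < l \<and> (M + 1) / real l < \<eta> / (2 * sqrt 3)}"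

definition grid :: "real \<Rightarrow> nat \<Rightarrow> (real^3) set" where
  "grid M k = (\<Union>l\<in>{1..k}. {\<zeta>. \<exists>m :: 3 \<Rightarrow> int. \<forall>j.
     \<zeta> $ j = of_int (m j) / real l \<and> \<bar>of_int (m j)\<bar> \<le> M * real l})"

definition D_net :: "real \<Rightarrow> real \<Rightarrow> (real^3) set" where
  "D_net M \<eta> = grid M (k_idx M \<eta>) \<inter> {\<zeta>. norm \<zeta> \<le> M}"

definition Sigma_net :: "real \<Rightarrow> real \<Rightarrow> (real \<times> (real^3)) set" where
  "Sigma_net M \<eta> = Phi ` D_net M \<eta>"

definition disc :: "real \<times> (real^3) \<Rightarrow> real \<Rightarrow> (real \<times> (real^3)) set" where
  "disc x \<eta> = {\<xi> \<in> S3 - {north_pole}. norm (\<xi> - x) < \<eta>}"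

definition SSp :: "real \<Rightarrow> real \<Rightarrow>
    'a::real_normed_vector operator \<times> 'a operator \<times> 'a operator \<Rightarrow> (real^3) set" where
  "SSp M \<eta> h = Phi -` (\<Union>{closure (disc x \<eta>) | x.
     x \<in> Sigma_net M \<eta> \<and> norm (Theta_S x \<eta> h) \<ge> 1 - \<eta>})"

section \<open>The angular momentum operators\<close>

definition partial_deriv :: "3 \<Rightarrow> (real^3 \<Rightarrow> complex) \<Rightarrow> (real^3 \<Rightarrow> complex)" where
  "partial_deriv i f x = frechet_derivative f (at x) (axis i 1)"

coinductive smooth :: "(real^3 \<Rightarrow> complex) \<Rightarrow> bool" where
  "f differentiable_on UNIV \<Longrightarrow> (\<And>i. smooth (partial_deriv i f)) \<Longrightarrow> smooth f"

definition test_function :: "(real^3 \<Rightarrow> complex) \<Rightarrow> bool" where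
  "test_function \<phi> \<longleftrightarrow> smooth \<phi> \<and> compact (closure {x. \<phi> x \<noteq> 0})"

text \<open>
  The differential operator \<open>- i hbar (x\<^sub>a \<partial>\<^sub>b - x\<^sub>b \<partial>\<^sub>a)\<close> is essentially self-adjoint on the compactly
  supported smooth functions; the self-adjoint operator is its closure.
\<close>

definition ang_diff :: "real \<Rightarrow> 3 \<Rightarrow> 3 \<Rightarrow> (real^3 \<Rightarrow> complex) \<Rightarrow> (real^3 \<Rightarrow> complex)" where
  "ang_diff hbar a b \<phi> x =
     - \<i> * of_real hbar * (of_real (x $ a) * partial_deriv b \<phi> x - of_real (x $ b) * partial_deriv a \<phi> x)"

definition ang_op :: "real \<Rightarrow> 3 \<Rightarrow> 3 \<Rightarrow> l2 operator" where
  "ang_op hbar a b = closure {(abs_l2 \<phi>, abs_l2 (ang_diff hbar a b \<phi>)) | \<phi>. test_function \<phi>}"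

definition L_x :: "real \<Rightarrow> l2 operator" where "L_x hbar = ang_op hbar 2 3"
definition L_y :: "real \<Rightarrow> l2 operator" where "L_y hbar = ang_op hbar 3 1"
definition L_z :: "real \<Rightarrow> l2 operator" where "L_z hbar = ang_op hbar 1 2"

end

theory Submission
  imports Defs "HOL-Computational_Algebra.Fundamental_Theorem_Algebra"
begin

text \<open>
  For (ii) membership in the synthetic spectrum only matters through the bound
  \<open>\<parallel>\<lambda>\<parallel>\<^sup>2 \<le> 2 (M\<^sup>2 + 1)\<close>, which holds for \<open>\<eta> = 1 / (M\<^sup>2 + 1)\<close>: \<^emph>\<open>every\<close> bounded \<open>\<lambda>\<close> has an
  approximate joint eigenvector, namely a coherent state \<open>exp (i p \<bullet> x / hbar) \<chi>(x - x0)\<close> with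
  \<open>x0 \<times> p = \<lambda>\<close>, where \<open>\<chi>\<close> is a radial bump whose width is fixed before \<open>hbar\<close> becomes small.

  For (i), a radial test function is annihilated by all three operators, so \<open>\<Theta>\<close> at the point
  \<open>Phi 0\<close> fixes it and has norm at least 1.  The content lies in the existence of the operators
  in the definition of \<open>\<Theta>\<close>, which requires that \<open>1 + L\<^sup>2\<close> has dense range: a space of homogeneous
  polynomials times a fixed radial bump is finite dimensional and invariant under the \<open>L\<^sub>j\<close>, hence
  mapped onto itself by \<open>1 + L\<^sup>2 \<ge> 1\<close>, and these spaces are total by the theorem of
  Stone and Weierstrass.
\<close>

section \<open>Polynomial and continuous functional calculus of bounded symmetric operators\<close>

text \<open>\<open>Theta_S\<close> is assembled from definite descriptions, so it is opaque until
  each of them is shown to have exactly one solution. For \<open>fun_calc\<close> this amounts to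
  bounding the norm of \<open>poly_op p T\<close> by the supremum of |p| over an interval. No
  spectral theorem enters: approximate eigenvalues replace the spectrum, and everything stays in the
  real inner product. For \<open>bounded_extension\<close> it amounts to showing that the graphs
  involved are total and bounded, which comes from the form bound |h_j u|^2 \<le> <d u, u>.

  In (ii) the obstruction is the commutator [L_x, L_y] = i hbar L_z, which fades with hbar. Applied
  to a coherent state, the operators produce two errors: freezing their coefficients at the centre
  costs a multiple of the width of the bump, whatever hbar is, and differentiating the bump costs a
  factor hbar times a constant that depends on the width. Hence the order in which the constants are
  chosen.\<close>

definition sym_op :: "('a::real_inner \<Rightarrow>\<^sub>L 'a) \<Rightarrow> bool" where
  "sym_op T \<longleftrightarrow> (\<forall>u v. T u \<bullet> v = u \<bullet> T v)"

text \<open>Failure of this property for T - z says that z is an approximate eigenvalue of T. For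
  symmetric T this serves as the spectrum, without any inverse having to be constructed.\<close>

definition bounded_below :: "('a::real_normed_vector \<Rightarrow>\<^sub>L 'a) \<Rightarrow> bool" where
  "bounded_below T \<longleftrightarrow> (\<exists>a>0. \<forall>v. a * norm v \<le> norm (T v))"

lemma poly_op_altdef:
  assumes "degree p \<le> n"
  shows "poly_op p T = (\<Sum>i\<le>n. coeff p i *\<^sub>R (((o\<^sub>L) T ^^ i) id_blinfun))"
  unfolding poly_op_def
  by (rule sum.mono_neutral_left) (use assms in \<open>auto simp: coeff_eq_0\<close>)

lemma poly_op_0 [simp]: "poly_op 0 T = 0"
  by (simp add: poly_op_def)

text \<open>Horner's recursion: with it, facts about \<open>poly_op\<close> follow by induction on
  \<open>pCons\<close> instead of by manipulating coefficient sums.\<close>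

lemma poly_op_pCons: "poly_op (pCons a p) T = a *\<^sub>R id_blinfun + (T o\<^sub>L poly_op p T)"
proof -
  have "poly_op (pCons a p) T =
      (\<Sum>i\<le>Suc (degree p). coeff (pCons a p) i *\<^sub>R (((o\<^sub>L) T ^^ i) id_blinfun))"
    by (rule poly_op_altdef) (rule degree_pCons_le)
  also have "\<dots> = a *\<^sub>R id_blinfun + (\<Sum>i\<le>degree p. coeff p i *\<^sub>R (T o\<^sub>L (((o\<^sub>L) T ^^ i) id_blinfun)))"
    by (simp add: sum.atMost_Suc_shift del: sum.atMost_Suc)
  also have "(\<Sum>i\<le>degree p. coeff p i *\<^sub>R (T o\<^sub>L (((o\<^sub>L) T ^^ i) id_blinfun))) = T o\<^sub>L poly_op p T"
    unfolding poly_op_def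
    by (simp add: bounded_bilinear.sum_right[OF bounded_bilinear_blinfun_compose]
        bounded_bilinear.scaleR_right[OF bounded_bilinear_blinfun_compose])
  finally show ?thesis .
qed

lemma poly_op_add: "poly_op (p + q) T = poly_op p T + poly_op q T"
  using poly_op_altdef[of "p + q" "max (degree p) (degree q)" T]
    poly_op_altdef[of p "max (degree p) (degree q)" T]
    poly_op_altdef[of q "max (degree p) (degree q)" T]
  by (simp add: degree_add_le_max scaleR_add_left sum.distrib)

lemma poly_op_smult: "poly_op (smult c p) T = c *\<^sub>R poly_op p T"
  using poly_op_altdef[of "smult c p" "degree p" T] poly_op_altdef[of p "degree p" T]
  by (simp add: scaleR_sum_right)

lemma poly_op_diff: "poly_op (p - q) T = poly_op p T - poly_op q T"
  using poly_op_add[of "p - q" q T] by simp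

lemma poly_op_mult: "poly_op (p * q) T = poly_op p T o\<^sub>L poly_op q T"
proof (induction p)
  case (pCons a p)
  then show ?case
    by (simp add: poly_op_add poly_op_smult poly_op_pCons blinfun_eqI blinfun.bilinear_simps)
qed simp

lemma poly_op_X: "poly_op [:0, 1:] T = T"
  by (simp add: poly_op_pCons blinfun_eqI)

lemma poly_op_eigenvector:
  assumes "blinfun_apply T v = l *\<^sub>R v"
  shows "poly_op p T v = poly p l *\<^sub>R v"
  by (induction p) (simp_all add: poly_op_pCons blinfun.bilinear_simps assms algebra_simps)

lemma sym_op_poly_op:
  assumes "sym_op T"
  shows "sym_op (poly_op p T)"
proof (induction p)
  case (pCons a p)
  \<comment> \<open>T is the value at the polynomial X, so it commutes with p(T) because polynomials
    commute.\<close>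
  have "T o\<^sub>L poly_op p T = poly_op p T o\<^sub>L T"
    using poly_op_mult[of "[:0, 1:]" p T] poly_op_mult[of p "[:0, 1:]" T]
    by (simp only: poly_op_X mult.commute)
  then have "blinfun_apply (T o\<^sub>L poly_op p T) w = (poly_op p T o\<^sub>L T) w" for w
    by simp
  then have "T (poly_op p T w) = poly_op p T (T w)" for w
    by simp
  then show ?case
    using pCons assms unfolding sym_op_def poly_op_pCons
    by (simp add: blinfun.bilinear_simps inner_add_left inner_add_right)
qed (simp add: sym_op_def)

lemma bounded_below_compose:
  assumes "bounded_below S" "bounded_below T"
  shows "bounded_below (S o\<^sub>L T)"
proof -
  obtain a b where a: "a > 0" "\<And>v. a * norm v \<le> norm (S v)"
    and b: "b > 0" "\<And>v. b * norm v \<le> norm (T v)"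
    using assms unfolding bounded_below_def by blast
  have "a * b * norm v \<le> norm (S (T v))" for v
    using order_trans[OF mult_left_mono[OF b(2)[of v]] a(2)[of "T v"]] a(1) by simp
  then show ?thesis
    unfolding bounded_below_def using a(1) b(1) by (intro exI[of _ "a * b"]) auto
qed

text \<open>The polynomial is (X - x)^2 + y^2, the real factor of a conjugate pair x + iy, x - iy.
  By symmetry <v, S v> = |T v - x v|^2 + y^2 |v|^2, and Cauchy-Schwarz turns this into a lower bound
  for |S v|.\<close>

lemma bounded_below_quadratic:
  fixes T :: "'a::real_inner \<Rightarrow>\<^sub>L 'a"
  assumes "sym_op T" "y \<noteq> 0"
  shows "bounded_below (poly_op [:x\<^sup>2 + y\<^sup>2, - 2 * x, 1:] T)"
proof -
  have "y\<^sup>2 * norm v \<le> norm (poly_op [:x\<^sup>2 + y\<^sup>2, - 2 * x, 1:] T v)" for v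
  proof -
    let ?S = "poly_op [:x\<^sup>2 + y\<^sup>2, - 2 * x, 1:] T"
    have S: "?S v = (x\<^sup>2 + y\<^sup>2) *\<^sub>R v - (2 * x) *\<^sub>R T v + T (T v)"
      by (simp add: poly_op_pCons blinfun.bilinear_simps algebra_simps)
    have TT: "v \<bullet> T (T v) = T v \<bullet> T v"
      using assms(1) by (simp add: sym_op_def)
    have "(norm (T v - x *\<^sub>R v))\<^sup>2 + y\<^sup>2 * (norm v)\<^sup>2 = v \<bullet> ?S v"
      unfolding S power2_norm_eq_inner
      by (simp add: inner_simps TT inner_commute power2_eq_square algebra_simps)
    also have "\<dots> \<le> norm v * norm (?S v)"
      by (rule norm_cauchy_schwarz)
    finally have "y\<^sup>2 * (norm v)\<^sup>2 \<le> norm v * norm (?S v)"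
      using zero_le_power2[of "norm (T v - x *\<^sub>R v)"] by linarith
    then show ?thesis
      by (cases "v = 0") (auto simp: power2_eq_square mult.commute mult.left_commute)
  qed
  then show ?thesis
    unfolding bounded_below_def using assms(2) by (intro exI[of _ "y\<^sup>2"]) auto
qed

section \<open>Factors of real polynomials coming from complex roots\<close>

lemma map_poly_complex_of_real_add:
  "map_poly complex_of_real (p + q) = map_poly complex_of_real p + map_poly complex_of_real q"
  by (rule poly_eqI) (simp add: coeff_map_poly)

lemma poly_map_poly_complex_of_real_mult:
  "poly (map_poly complex_of_real (p * q)) z =
     poly (map_poly complex_of_real p) z * poly (map_poly complex_of_real q) z"
  by (induction p) (simp_all add: map_poly_complex_of_real_add map_poly_pCons map_poly_smult algebra_simps)

lemma poly_map_poly_complex_of_real: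
  "poly (map_poly complex_of_real p) (of_real x) = of_real (poly p x)"
  by (induction p) (simp_all add: map_poly_pCons)

text \<open>The remainder a + b X also vanishes at z. Its imaginary part b Im z forces b = 0, and
  then a = 0.\<close>

lemma quadratic_dvd:
  fixes p :: "real poly"
  assumes "poly (map_poly complex_of_real p) z = 0" "Im z \<noteq> 0"
  shows "[:(Re z)\<^sup>2 + (Im z)\<^sup>2, - 2 * Re z, 1:] dvd p"
proof -
  let ?s = "[:(Re z)\<^sup>2 + (Im z)\<^sup>2, - 2 * Re z, 1:]"
  have sz: "poly (map_poly complex_of_real ?s) z = 0"
    by (simp add: map_poly_pCons complex_eq_iff power2_eq_square algebra_simps)
  have "poly (map_poly complex_of_real (?s * (p div ?s) + p mod ?s)) z = 0"
    using assms(1) by (simp only: mult_div_mod_eq)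
  then have r: "poly (map_poly complex_of_real (p mod ?s)) z = 0"
    unfolding map_poly_complex_of_real_add poly_add poly_map_poly_complex_of_real_mult sz by simp
  have "degree (p mod ?s) < 2"
    using degree_mod_less[of ?s p] by (auto simp: numeral_2_eq_2)
  then have "p mod ?s = [:coeff (p mod ?s) 0, coeff (p mod ?s) 1:]"
    by (intro poly_eqI) (auto simp: coeff_pCons coeff_eq_0 split: nat.splits)
  then obtain a b where ab: "p mod ?s = [:a, b:]"
    by blast
  from r have "a + b * Re z = 0" "b * Im z = 0"
    unfolding ab by (simp_all add: map_poly_pCons complex_eq_iff algebra_simps)
  then have "p mod ?s = 0"
    using assms(2) ab by simp
  then show ?thesis
    by (simp add: mod_eq_0_iff_dvd)
qed

text \<open>The nontrivial half of the spectral mapping theorem: 0 can be an approximate eigenvalue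
  of q(T) only if some real root of q is one of T. Factors are split off one at a time. A real root
  gives a factor covered by the hypothesis, a nonreal one a factor that is always bounded
  below.\<close>

lemma bounded_below_poly_op:
  fixes T :: "'a::real_inner \<Rightarrow>\<^sub>L 'a"
  assumes T: "sym_op T" and "q \<noteq> 0"
    and "\<And>z. poly q z = 0 \<Longrightarrow> bounded_below (T - z *\<^sub>R id_blinfun)"
  shows "bounded_below (poly_op q T)"
  using assms(2,3)
proof (induction "degree q" arbitrary: q rule: less_induct)
  case less
  show ?case
  proof (cases "degree q = 0")
    case True
    then obtain c where c: "q = [:c:]"
      by (rule degree_eq_zeroE)
    with less.prems have "c \<noteq> 0" by simp
    then show ?thesis
      unfolding bounded_below_def c
      by (intro exI[of _ "\<bar>c\<bar>"]) (simp add: poly_op_pCons blinfun.bilinear_simps)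
  next
    case False
    have "degree (map_poly complex_of_real q) = degree q"
      by (simp add: degree_map_poly)
    then have "\<not> constant (poly (map_poly complex_of_real q))"
      using False by (simp add: constant_degree)
    then obtain z where z: "poly (map_poly complex_of_real q) z = 0"
      using fundamental_theorem_of_algebra by blast
    have "\<exists>s. s dvd q \<and> degree s > 0 \<and> bounded_below (poly_op s T)"
    proof (cases "Im z = 0")
      case True
      then have "z = of_real (Re z)"
        by (simp add: complex_eq_iff)
      then have root: "poly q (Re z) = 0"
        using z by (metis of_real_eq_0_iff poly_map_poly_complex_of_real)
      have "poly_op [:- Re z, 1:] T = T - Re z *\<^sub>R id_blinfun"
        by (simp add: poly_op_pCons blinfun_eqI blinfun.bilinear_simps)
      with less.prems(2)[OF root] root show ?thesis
        by (intro exI[of _ "[:- Re z, 1:]"]) (simp add: poly_eq_0_iff_dvd)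
    next
      case False
      then show ?thesis
        using quadratic_dvd[OF z False] bounded_below_quadratic[OF T False, of "Re z"]
        by (intro exI[of _ "[:(Re z)\<^sup>2 + (Im z)\<^sup>2, - 2 * Re z, 1:]"]) simp
    qed
    then obtain s t where st: "q = s * t" "degree s > 0" "bounded_below (poly_op s T)"
      by (auto elim: dvdE)
    then have "t \<noteq> 0" "degree t < degree q"
      using less.prems(1) by (auto simp: degree_mult_eq)
    then have "bounded_below (poly_op t T)"
      using less.hyps less.prems(2) st(1) by (metis mult_zero_right poly_mult)
    then show ?thesis
      using st by (simp add: poly_op_mult bounded_below_compose)
  qed
qed

text \<open>
  With \<open>s = \<parallel>p(T)\<parallel>\<close> the operator \<open>s\<^sup>2 - p(T)\<^sup>2\<close> is not bounded below, so some real root \<open>z\<close> of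
  \<open>s\<^sup>2 - p\<^sup>2\<close> lies in the approximate point spectrum of \<open>T\<close>, whence \<open>s = \<bar>p z\<bar>\<close>.
\<close>

lemma norm_poly_op_le:
  fixes T :: "'a::real_inner \<Rightarrow>\<^sub>L 'a"
  assumes T: "sym_op T" and I: "z0 \<in> I" "\<And>z. z \<notin> I \<Longrightarrow> bounded_below (T - z *\<^sub>R id_blinfun)"
    and m: "\<And>z. z \<in> I \<Longrightarrow> \<bar>poly p z\<bar> \<le> m"
  shows "norm (poly_op p T) \<le> m"
proof (rule ccontr)
  assume neg: "\<not> norm (poly_op p T) \<le> m"
  define S where "S = poly_op p T"
  define s where "s = norm S"
  have "0 \<le> m" using m[OF I(1)] by linarith
  then have s: "m < s" "0 < s"
    using neg by (auto simp: s_def S_def)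
  define q where "q = [:s\<^sup>2:] - p * p"
  have nz: "poly q z \<noteq> 0" if "z \<in> I" for z
  proof
    assume "poly q z = 0"
    then have "\<bar>poly p z\<bar> = s"
      using s by (simp add: q_def power2_eq_square flip: abs_mult)
        (metis abs_of_pos power2_eq_iff power2_eq_square abs_minus_cancel)
    then show False using m[OF that] s by simp
  qed
  then have "q \<noteq> 0" using I(1) by auto
  then have "bounded_below (poly_op q T)"
    using bounded_below_poly_op[OF T] nz I(2) by blast
  then obtain a where a: "a > 0" "\<And>v. a * norm v \<le> norm (poly_op q T v)"
    unfolding bounded_below_def by blast
  have symS: "sym_op S"
    unfolding S_def by (rule sym_op_poly_op[OF T])
  \<comment> \<open>Expand |s^2 v - S(S v)|^2 using <v, S(S v)> = |S v|^2 and |S(S v)| \<le> s |S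
    v|. The lower bound a then yields |S v| \<le> c |v| with c strictly below s, contradicting that
    s is the norm of S. The \<open>max 0\<close> in \<open>c\<close> saves a discussion of
    signs.\<close>
  have key: "(s * norm (S v))\<^sup>2 \<le> (s ^ 4 - a\<^sup>2) * (norm v)\<^sup>2" for v
  proof -
    have q: "poly_op q T v = s\<^sup>2 *\<^sub>R v - S (S v)"
      by (simp add: q_def poly_op_diff poly_op_mult poly_op_pCons S_def blinfun.bilinear_simps)
    have SS: "v \<bullet> S (S v) = (norm (S v))\<^sup>2"
      using symS by (simp add: sym_op_def power2_norm_eq_inner)
    have "(a * norm v)\<^sup>2 \<le> (norm (poly_op q T v))\<^sup>2"
      using a by (intro power_mono) auto
    also have "\<dots> = s ^ 4 * (norm v)\<^sup>2 - 2 * s\<^sup>2 * (norm (S v))\<^sup>2 + (norm (S (S v)))\<^sup>2"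
    proof -
      have "(norm (s\<^sup>2 *\<^sub>R v - S (S v)))\<^sup>2
          = s\<^sup>2 * s\<^sup>2 * (v \<bullet> v) - 2 * s\<^sup>2 * (v \<bullet> S (S v)) + S (S v) \<bullet> S (S v)"
        unfolding power2_norm_eq_inner
        by (simp add: inner_simps inner_commute algebra_simps)
      then show ?thesis unfolding q SS by (simp add: power2_norm_eq_inner flip: power_add)
    qed
    also have "(norm (S (S v)))\<^sup>2 \<le> (s * norm (S v))\<^sup>2"
      unfolding s_def by (intro power_mono norm_blinfun) auto
    finally show ?thesis
      by (simp add: power_mult_distrib algebra_simps)
  qed
  define c where "c = sqrt (max 0 (s ^ 4 - a\<^sup>2)) / s"
  have c0: "c \<ge> 0" using s by (simp add: c_def)
  have "norm (S v) \<le> c * norm v" for v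
  proof -
    have "(s * norm (S v))\<^sup>2 \<le> max 0 (s ^ 4 - a\<^sup>2) * (norm v)\<^sup>2"
      using key[of v] by (meson max.cobounded2 mult_right_mono order_trans zero_le_power2)
    also have "\<dots> = (sqrt (max 0 (s ^ 4 - a\<^sup>2)) * norm v)\<^sup>2"
      by (simp add: power_mult_distrib)
    finally have "s * norm (S v) \<le> sqrt (max 0 (s ^ 4 - a\<^sup>2)) * norm v"
      by (rule power2_le_imp_le) auto
    then show ?thesis
      using s by (simp add: c_def field_simps)
  qed
  then have "s \<le> c"
    unfolding s_def by (rule norm_blinfun_bound[OF c0])
  then have "s * s \<le> sqrt (max 0 (s ^ 4 - a\<^sup>2))"
    using s by (simp add: c_def field_simps)
  moreover have "sqrt (max 0 (s ^ 4 - a\<^sup>2)) < sqrt ((s * s)\<^sup>2)"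
    using s a(1) by (intro real_sqrt_less_mono) (auto simp: power2_eq_square power4_eq_xxxx)
  ultimately show False
    using s by simp
qed

lemma bounded_below_outside_norm:
  assumes "z \<notin> {- norm T..norm T}"
  shows "bounded_below (T - z *\<^sub>R id_blinfun)"
proof -
  have "(\<bar>z\<bar> - norm T) * norm v \<le> norm (T v - z *\<^sub>R v)" for v
    using norm_triangle_ineq2[of "z *\<^sub>R v" "T v"] norm_blinfun[of T v]
    by (simp add: norm_minus_commute algebra_simps)
  then show ?thesis
    unfolding bounded_below_def using assms
    by (intro exI[of _ "\<bar>z\<bar> - norm T"]) (auto simp: blinfun.bilinear_simps)
qed

text \<open>For positive T the set \<open>I\<close> of \<open>norm_poly_op_le\<close> may thus be
  shrunk to \<open>{0..norm T}\<close>, which is what the square root requires.\<close>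

lemma bounded_below_neg:
  fixes T :: "'a::real_inner \<Rightarrow>\<^sub>L 'a"
  assumes "\<And>v. 0 \<le> T v \<bullet> v" "z < 0"
  shows "bounded_below (T - z *\<^sub>R id_blinfun)"
proof -
  have "- z * norm v \<le> norm (T v - z *\<^sub>R v)" for v
  proof -
    have "- z * (norm v)\<^sup>2 \<le> (T v - z *\<^sub>R v) \<bullet> v"
      using assms(1)[of v] by (simp add: inner_simps power2_norm_eq_inner)
    also have "\<dots> \<le> norm (T v - z *\<^sub>R v) * norm v"
      by (rule norm_cauchy_schwarz)
    finally have "(- z * norm v) * norm v \<le> norm (T v - z *\<^sub>R v) * norm v"
      by (simp add: power2_eq_square)
    then show ?thesis
      by (metis mult_right_le_imp_le mult_zero_right norm_ge_zero norm_zero zero_less_norm_iff)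
  qed
  then show ?thesis
    unfolding bounded_below_def using assms
    by (intro exI[of _ "- z"]) (auto simp: blinfun.bilinear_simps)
qed

section \<open>The continuous functional calculus is well defined\<close>

lemma fun_calc_tendsto:
  fixes T :: "'a::{real_inner,banach} \<Rightarrow>\<^sub>L 'a"
  assumes T: "sym_op T"
    and p: "uniform_limit {- norm T..norm T} (\<lambda>n. poly (p n)) f sequentially"
  shows "(\<lambda>n. poly_op (p n) T) \<longlonglongrightarrow> fun_calc f T"
proof -
  \<comment> \<open>Two approximating sequences, possibly equal, merge in operator norm. This one
    estimate gives the Cauchy property as well as independence of the chosen sequence.\<close>
  have diff: "\<exists>N. \<forall>n\<ge>N. \<forall>m\<ge>N. norm (poly_op (q n) T - poly_op (r m) T) \<le> e"
    if qr: "uniform_limit {- norm T..norm T} (\<lambda>n. poly (q n)) f sequentially"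
      "uniform_limit {- norm T..norm T} (\<lambda>n. poly (r n)) f sequentially" "e > 0"
    for q r :: "nat \<Rightarrow> real poly" and e
  proof -
    have "e / 2 > 0" using qr(3) by simp
    then obtain N1 N2 where N:
      "\<And>n x. n \<ge> N1 \<Longrightarrow> x \<in> {- norm T..norm T} \<Longrightarrow> dist (poly (q n) x) (f x) < e / 2"
      "\<And>n x. n \<ge> N2 \<Longrightarrow> x \<in> {- norm T..norm T} \<Longrightarrow> dist (poly (r n) x) (f x) < e / 2"
      using qr(1,2)[THEN uniform_limitD, of "e / 2"]
      unfolding eventually_sequentially by metis
    have "norm (poly_op (q n) T - poly_op (r m) T) \<le> e" if nm: "n \<ge> N1" "m \<ge> N2" for n m
      unfolding poly_op_diff[symmetric]
    proof (rule norm_poly_op_le[OF T])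
      show "0 \<in> {- norm T..norm T}" by simp
      fix z assume z: "z \<in> {- norm T..norm T}"
      show "\<bar>poly (q n - r m) z\<bar> \<le> e"
        using N(1)[OF nm(1) z] N(2)[OF nm(2) z] unfolding dist_real_def poly_diff by arith
    qed (rule bounded_below_outside_norm)
    then show ?thesis
      by (intro exI[of _ "max N1 N2"]) auto
  qed
  have "Cauchy (\<lambda>n. poly_op (p n) T)"
  proof (rule metric_CauchyI)
    fix e :: real assume "e > 0"
    then obtain N where "\<forall>n\<ge>N. \<forall>m\<ge>N. norm (poly_op (p n) T - poly_op (p m) T) \<le> e / 2"
      using diff[OF p p, of "e / 2"] by auto
    then show "\<exists>M. \<forall>m\<ge>M. \<forall>n\<ge>M. dist (poly_op (p m) T) (poly_op (p n) T) < e"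
      using \<open>e > 0\<close> by (fastforce simp: dist_norm)
  qed
  then obtain S where S: "(\<lambda>n. poly_op (p n) T) \<longlonglongrightarrow> S"
    by (auto simp: Cauchy_convergent_iff convergent_def)
  have "fun_calc f T = S"
    unfolding fun_calc_def
  proof (rule the_equality, intro allI impI)
    fix q :: "nat \<Rightarrow> real poly"
    assume q: "uniform_limit {- norm T..norm T} (\<lambda>n. poly (q n)) f sequentially"
    have "(\<lambda>n. poly_op (q n) T - poly_op (p n) T) \<longlonglongrightarrow> 0"
    proof (rule metric_LIMSEQ_I)
      fix e :: real assume "e > 0"
      then obtain N where "\<forall>n\<ge>N. \<forall>m\<ge>N. norm (poly_op (q n) T - poly_op (p m) T) \<le> e / 2"
        using diff[OF q p, of "e / 2"] by auto
      then show "\<exists>N. \<forall>n\<ge>N. dist (poly_op (q n) T - poly_op (p n) T) 0 < e"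
        using \<open>e > 0\<close> by (fastforce simp: dist_norm)
    qed
    from tendsto_add[OF this S] show "(\<lambda>n. poly_op (q n) T) \<longlonglongrightarrow> S"
      by simp
  next
    fix S' assume "\<forall>q. uniform_limit {- norm T..norm T} (\<lambda>n. poly (q n)) f sequentially \<longrightarrow>
      (\<lambda>n. poly_op (q n) T) \<longlonglongrightarrow> S'"
    \<comment> \<open>The given sequence \<open>p\<close> makes the description unique: if nothing
      approximated f, every S would satisfy it.\<close>
    with p S show "S' = S"
      using LIMSEQ_unique by blast
  qed
  with S show ?thesis by simp
qed

lemma poly_uniform_approx:
  fixes f :: "real \<Rightarrow> real"
  assumes "continuous_on {a..b} f"
  obtains p where "uniform_limit {a..b} (\<lambda>n. poly (p n)) f sequentially"
proof -
  have "\<exists>p. \<forall>x\<in>{a..b}. \<bar>f x - poly p x\<bar> < inverse (Suc n)" for n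
  proof -
    obtain g where g: "real_polynomial_function g" "\<And>x. x \<in> {a..b} \<Longrightarrow> \<bar>f x - g x\<bar> < inverse (Suc n)"
      using Stone_Weierstrass_real_polynomial_function[OF compact_Icc assms, of "inverse (Suc n)"]
      by auto
    obtain c N where "g = (\<lambda>x. \<Sum>i\<le>N. c i * x ^ i)"
      using g(1) real_polynomial_function_iff_sum by auto
    then have "g x = poly (\<Sum>i\<le>N. monom (c i) i) x" for x
      by (simp add: poly_sum poly_monom)
    then show ?thesis using g(2) by metis
  qed
  then obtain p where p: "\<And>n x. x \<in> {a..b} \<Longrightarrow> \<bar>f x - poly (p n) x\<bar> < inverse (Suc n)"
    by metis
  have "uniform_limit {a..b} (\<lambda>n. poly (p n)) f sequentially"
  proof (rule uniform_limitI)
    fix e :: real assume "e > 0"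
    then obtain N where N: "inverse (Suc N) < e"
      using reals_Archimedean by blast
    have "dist (poly (p n) x) (f x) < e" if "n \<ge> N" "x \<in> {a..b}" for n x
    proof -
      have "inverse (Suc n) \<le> (inverse (Suc N) :: real)"
        using that by (simp add: field_simps)
      then show ?thesis
        using p[OF that(2), of n] N unfolding dist_real_def abs_minus_commute[of "poly (p n) x"]
        by linarith
    qed
    then show "\<forall>\<^sub>F n in sequentially. \<forall>x\<in>{a..b}. dist (poly (p n) x) (f x) < e"
      unfolding eventually_sequentially by blast
  qed
  then show ?thesis by (rule that)
qed

text \<open>Because v is nonzero, |l| \<le> \<open>norm T\<close>, so l lies in the interval where
  the polynomials converge.\<close>

lemma fun_calc_eigenvector:
  fixes T :: "'a::{real_inner,banach} \<Rightarrow>\<^sub>L 'a"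
  assumes T: "sym_op T" and f: "continuous_on UNIV f" and v: "v \<noteq> 0" "T v = l *\<^sub>R v"
  shows "fun_calc f T v = f l *\<^sub>R v"
proof -
  obtain p where p: "uniform_limit {- norm T..norm T} (\<lambda>n. poly (p n)) f sequentially"
    using poly_uniform_approx continuous_on_subset[OF f subset_UNIV] by metis
  have "\<bar>l\<bar> \<le> norm T"
    using norm_blinfun[of T v] v by simp
  then have "(\<lambda>n. poly (p n) l) \<longlonglongrightarrow> f l"
    by (intro tendsto_uniform_limitI[OF p]) auto
  then have "(\<lambda>n. poly_op (p n) T v) \<longlonglongrightarrow> f l *\<^sub>R v"
    unfolding poly_op_eigenvector[OF v(2)] by (intro tendsto_intros)
  moreover have "(\<lambda>n. poly_op (p n) T v) \<longlonglongrightarrow> fun_calc f T v"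
    by (intro blinfun.tendsto fun_calc_tendsto[OF T p] tendsto_const)
  ultimately show ?thesis
    using LIMSEQ_unique by blast
qed

lemma sym_op_fun_calc:
  fixes T :: "'a::{real_inner,banach} \<Rightarrow>\<^sub>L 'a"
  assumes T: "sym_op T" and f: "continuous_on UNIV f"
  shows "sym_op (fun_calc f T)"
  unfolding sym_op_def
proof (intro allI)
  fix u v
  obtain p where p: "uniform_limit {- norm T..norm T} (\<lambda>n. poly (p n)) f sequentially"
    using poly_uniform_approx continuous_on_subset[OF f subset_UNIV] by metis
  note lim = fun_calc_tendsto[OF T p]
  have "(\<lambda>n. poly_op (p n) T u \<bullet> v) \<longlonglongrightarrow> fun_calc f T u \<bullet> v"
    "(\<lambda>n. u \<bullet> poly_op (p n) T v) \<longlonglongrightarrow> u \<bullet> fun_calc f T v"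
    by (intro tendsto_inner blinfun.tendsto lim tendsto_const)+
  moreover have "poly_op (p n) T u \<bullet> v = u \<bullet> poly_op (p n) T v" for n
    using sym_op_poly_op[OF T] by (simp add: sym_op_def)
  ultimately show "fun_calc f T u \<bullet> v = u \<bullet> fun_calc f T v"
    using LIMSEQ_unique by simp
qed

text \<open>The library function \<open>sqrt\<close> is odd, so the square of sqrt x is |x|, and the
  squares of the approximating polynomials tend to x only on \<open>{0..norm T}\<close>. Positivity
  of T allows the norm bound to be taken over that smaller interval.\<close>

lemma fun_calc_sqrt_compose:
  fixes T :: "'a::{real_inner,banach} \<Rightarrow>\<^sub>L 'a"
  assumes T: "sym_op T" and pos: "\<And>v. 0 \<le> T v \<bullet> v"
  shows "fun_calc sqrt T o\<^sub>L fun_calc sqrt T = T"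
proof -
  have cont: "continuous_on {- norm T..norm T} sqrt"
    by (intro continuous_intros)
  obtain p where p: "uniform_limit {- norm T..norm T} (\<lambda>n. poly (p n)) sqrt sequentially"
    using poly_uniform_approx[OF cont] by metis
  let ?I = "{0..norm T}"
  have "uniform_limit ?I (\<lambda>n. poly (p n)) sqrt sequentially"
    using p by (rule uniform_limit_on_subset) auto
  moreover have "bounded (sqrt ` ?I)"
    by (intro compact_imp_bounded compact_continuous_image continuous_intros) auto
  ultimately have lim: "uniform_limit ?I (\<lambda>n x. poly (p n) x * poly (p n) x) (\<lambda>x. sqrt x * sqrt x) sequentially"
    by (intro bounded_bilinear.bounded_uniform_limit[OF bounded_bilinear_mult])
  have "(\<lambda>n. (poly_op (p n) T o\<^sub>L poly_op (p n) T) - T) \<longlonglongrightarrow> 0"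
  proof (rule metric_LIMSEQ_I)
    fix e :: real assume "e > 0"
    then have "\<forall>\<^sub>F n in sequentially. \<forall>x\<in>?I. dist (poly (p n) x * poly (p n) x) (sqrt x * sqrt x) < e / 2"
      using uniform_limitD[OF lim, of "e / 2"] by simp
    then obtain N where N: "\<And>n x. n \<ge> N \<Longrightarrow> x \<in> ?I \<Longrightarrow>
        dist (poly (p n) x * poly (p n) x) (sqrt x * sqrt x) < e / 2"
      unfolding eventually_sequentially by blast
    have "norm ((poly_op (p n) T o\<^sub>L poly_op (p n) T) - T) \<le> e / 2" if n: "n \<ge> N" for n
    proof -
      have "norm (poly_op (p n * p n - [:0, 1:]) T) \<le> e / 2"
      proof (rule norm_poly_op_le[OF T])
        show "0 \<in> ?I" by simp
        fix z assume z: "z \<notin> ?I"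
        show "bounded_below (T - z *\<^sub>R id_blinfun)"
          using bounded_below_neg[OF pos, of z] bounded_below_outside_norm[of z T] z by force
      next
        fix z assume z: "z \<in> ?I"
        then show "\<bar>poly (p n * p n - [:0, 1:]) z\<bar> \<le> e / 2"
          using N[OF n z] by (simp add: dist_real_def)
      qed
      then show ?thesis
        by (simp only: poly_op_diff poly_op_mult poly_op_X)
    qed
    then show "\<exists>N. \<forall>n\<ge>N. dist ((poly_op (p n) T o\<^sub>L poly_op (p n) T) - T) 0 < e"
      using \<open>e > 0\<close> by (fastforce simp: dist_norm)
  qed
  then have "(\<lambda>n. poly_op (p n) T o\<^sub>L poly_op (p n) T) \<longlonglongrightarrow> T"
    by (simp add: LIM_zero_iff)
  moreover have "(\<lambda>n. poly_op (p n) T o\<^sub>L poly_op (p n) T) \<longlonglongrightarrow> (fun_calc sqrt T o\<^sub>L fun_calc sqrt T)"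
    using fun_calc_tendsto[OF T p] by (intro bounded_bilinear.tendsto[OF bounded_bilinear_blinfun_compose])
  ultimately show ?thesis
    using LIMSEQ_unique by blast
qed

section \<open>Bounded transforms of closed symmetric operators\<close>

lemma subspace_closure:
  fixes S :: "'a::real_normed_vector set"
  assumes "subspace S"
  shows "subspace (closure S)"
  unfolding subspace_def
proof (intro conjI ballI allI)
  show "0 \<in> closure S"
    using subspace_0[OF assms] closure_subset by blast
next
  fix x y assume "x \<in> closure S" "y \<in> closure S"
  then obtain X Y where "\<And>n. X n \<in> S" "X \<longlonglongrightarrow> x" "\<And>n. Y n \<in> S" "Y \<longlonglongrightarrow> y"
    unfolding closure_sequential by metis
  then show "x + y \<in> closure S"
    unfolding closure_sequential
    by (intro exI[of _ "\<lambda>n. X n + Y n"]) (auto intro!: tendsto_add subspace_add[OF assms])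
next
  fix c :: real and x assume "x \<in> closure S"
  then obtain X where "\<And>n. X n \<in> S" "X \<longlonglongrightarrow> x"
    unfolding closure_sequential by metis
  then show "c *\<^sub>R x \<in> closure S"
    unfolding closure_sequential
    by (intro exI[of _ "\<lambda>n. c *\<^sub>R X n"]) (auto intro!: tendsto_intros subspace_mul[OF assms])
qed

lemma op_addI: "(u, v) \<in> A \<Longrightarrow> (u, w) \<in> B \<Longrightarrow> (u, v + w) \<in> op_add A B"
  unfolding op_add_def by blast

lemma subspace_op_add:
  assumes "subspace A" "subspace B"
  shows "subspace (op_add A B)"
  unfolding subspace_def
proof (intro conjI ballI allI)
  show "0 \<in> op_add A B"
    unfolding op_add_def using subspace_0[OF assms(1)] subspace_0[OF assms(2)]
    by (auto simp: zero_prod_def intro!: exI[of _ 0])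
next
  fix x y assume "x \<in> op_add A B" "y \<in> op_add A B"
  then obtain u v w u' v' w' where
    "x = (u, v + w)" "(u, v) \<in> A" "(u, w) \<in> B" "y = (u', v' + w')" "(u', v') \<in> A" "(u', w') \<in> B"
    unfolding op_add_def by auto
  then show "x + y \<in> op_add A B"
    using op_addI[of "u + u'" "v + v'" A "w + w'" B]
      subspace_add[OF assms(1), of "(u, v)" "(u', v')"] subspace_add[OF assms(2), of "(u, w)" "(u', w')"]
    by (simp add: algebra_simps)
next
  fix c :: real and x assume "x \<in> op_add A B"
  then obtain u v w where "x = (u, v + w)" "(u, v) \<in> A" "(u, w) \<in> B"
    unfolding op_add_def by auto
  then show "c *\<^sub>R x \<in> op_add A B"
    using op_addI[of "c *\<^sub>R u" "c *\<^sub>R v" A "c *\<^sub>R w" B]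
      subspace_mul[OF assms(1), of "(u, v)" c] subspace_mul[OF assms(2), of "(u, w)" c]
    by (simp add: scaleR_add_right)
qed

lemma subspace_op_mult:
  fixes A B :: "'a::real_vector operator"
  assumes "subspace A" "subspace B"
  shows "subspace (op_mult A B)"
  unfolding subspace_def
proof (intro conjI ballI allI)
  show "0 \<in> op_mult A B"
    unfolding op_mult_def using subspace_0[OF assms(1)] subspace_0[OF assms(2)]
    by (auto simp: zero_prod_def)
next
  fix x y assume "x \<in> op_mult A B" "y \<in> op_mult A B"
  then obtain u v w u' v' w' where
    "x = (u, w)" "(u, v) \<in> B" "(v, w) \<in> A" "y = (u', w')" "(u', v') \<in> B" "(v', w') \<in> A"
    unfolding op_mult_def by auto
  then show "x + y \<in> op_mult A B"
    unfolding op_mult_def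
    using subspace_add[OF assms(2), of "(u, v)" "(u', v')"] subspace_add[OF assms(1), of "(v, w)" "(v', w')"]
    by auto
next
  fix c :: real and x assume "x \<in> op_mult A B"
  then obtain u v w where "x = (u, w)" "(u, v) \<in> B" "(v, w) \<in> A"
    unfolding op_mult_def by auto
  then show "c *\<^sub>R x \<in> op_mult A B"
    unfolding op_mult_def
    using subspace_mul[OF assms(2), of "(u, v)" c] subspace_mul[OF assms(1), of "(v, w)" c]
    by auto
qed

lemma subspace_converse:
  fixes A :: "'a::real_vector operator"
  assumes "subspace A"
  shows "subspace (A\<inverse>)"
proof -
  have "0 \<in> A" using assms by (rule subspace_0)
  moreover have "(u + u', v + v') \<in> A" if "(u, v) \<in> A" "(u', v') \<in> A" for u v u' v'
    using subspace_add[OF assms that] by simp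
  moreover have "(c *\<^sub>R u, c *\<^sub>R v) \<in> A" if "(u, v) \<in> A" for c u v
    using subspace_mul[OF assms that, of c] by simp
  ultimately show ?thesis
    unfolding subspace_def by (auto simp: zero_prod_def)
qed

lemma subspace_Id: "subspace (Id :: 'a::real_vector operator)"
  unfolding subspace_def by (auto simp: zero_prod_def)

lemma subspace_op_of: "subspace (op_of T)"
  unfolding subspace_def op_of_def by (auto simp: zero_prod_def blinfun.bilinear_simps)

text \<open>The graph of a function defined everywhere has no proper extension to another such
  graph. All graphs to which \<open>bounded_extension\<close> is applied below turn out to be of
  this kind.\<close>

lemma bounded_extension_op_of: "bounded_extension (op_of T) = T"
  unfolding bounded_extension_def
proof (rule the_equality)
  fix S assume "op_of T \<subseteq> op_of S"
  then have "(u, T u) \<in> op_of S" for u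
    by (auto simp: op_of_def)
  then show "S = T"
    by (intro blinfun_eqI) (auto simp: op_of_def)
qed simp

text \<open>The bound at u = 0 makes the relation single valued, and linearity is inherited from the
  subspace. Resolvent and bounded transforms are both obtained in this way.\<close>

lemma total_bounded_graph:
  fixes G :: "'a::real_normed_vector operator"
  assumes G: "subspace G" and total: "\<And>u. \<exists>v. (u, v) \<in> G"
    and bound: "\<And>u v. (u, v) \<in> G \<Longrightarrow> norm v \<le> K * norm u"
  obtains T where "G = op_of T"
proof -
  have single: "v = w" if "(u, v) \<in> G" "(u, w) \<in> G" for u v w
    using bound[of 0 "v - w"] subspace_diff[OF G that] by simp
  obtain f where f: "\<And>u. (u, f u) \<in> G"
    using total by metis
  have "bounded_linear f"
  proof (rule bounded_linear_intro)
    show "f (x + y) = f x + f y" for x y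
      using subspace_add[OF G f f, of x y] by (intro single[OF f]) simp
    show "f (c *\<^sub>R x) = c *\<^sub>R f x" for c x
      using subspace_mul[OF G f, of c x] by (intro single[OF f]) simp
    show "norm (f x) \<le> norm x * K" for x
      using bound[OF f] by (simp add: mult.commute)
  qed
  then have "G = op_of (Blinfun f)"
    unfolding op_of_def by (auto simp: bounded_linear_Blinfun_apply f dest: single[OF f])
  then show ?thesis by (rule that)
qed

text \<open>Formulated for relations: being single valued is not presupposed but follows once the
  domain is dense.\<close>

definition symmetric_op :: "'a::real_inner operator \<Rightarrow> bool" where
  "symmetric_op A \<longleftrightarrow> (\<forall>(u, v)\<in>A. \<forall>(u', v')\<in>A. v \<bullet> u' = u \<bullet> v')"

lemma symmetric_opD:
  "symmetric_op A \<Longrightarrow> (u, v) \<in> A \<Longrightarrow> (u', v') \<in> A \<Longrightarrow> v \<bullet> u' = u \<bullet> v'"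
  unfolding symmetric_op_def by blast

lemma symmetric_op_closure:
  assumes "symmetric_op A"
  shows "symmetric_op (closure A)"
  unfolding symmetric_op_def
proof clarify
  fix u v u' v' assume "(u, v) \<in> closure A" "(u', v') \<in> closure A"
  then obtain X Y where XY: "\<And>n. X n \<in> A" "X \<longlonglongrightarrow> (u, v)" "\<And>n. Y n \<in> A" "Y \<longlonglongrightarrow> (u', v')"
    unfolding closure_sequential by metis
  have "(\<lambda>n. snd (X n) \<bullet> fst (Y n)) \<longlonglongrightarrow> v \<bullet> u'" "(\<lambda>n. fst (X n) \<bullet> snd (Y n)) \<longlonglongrightarrow> u \<bullet> v'"
    using tendsto_inner[OF tendsto_snd[OF XY(2)] tendsto_fst[OF XY(4)]]
      tendsto_inner[OF tendsto_fst[OF XY(2)] tendsto_snd[OF XY(4)]] by simp_all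
  moreover have "snd (X n) \<bullet> fst (Y n) = fst (X n) \<bullet> snd (Y n)" for n
    using symmetric_opD[OF assms, of "fst (X n)" "snd (X n)" "fst (Y n)" "snd (Y n)"] XY(1,3) by simp
  ultimately show "v \<bullet> u' = u \<bullet> v'"
    using LIMSEQ_unique by simp
qed

text \<open>Symmetry applied to the pair (0, v - w) makes v - w orthogonal to the dense
  domain.\<close>

lemma symmetric_op_single_valued:
  fixes A :: "'a::real_inner operator"
  assumes A: "subspace A" "symmetric_op A" and dense: "closure (Domain A) = UNIV"
    and uv: "(u, v) \<in> A" "(u, w) \<in> A"
  shows "v = w"
proof -
  have vw: "(0, v - w) \<in> A"
    using subspace_diff[OF A(1) uv] by simp
  have "v - w \<in> closure (Domain A)"
    using dense by simp
  then obtain X where X: "\<And>n. X n \<in> Domain A" "X \<longlonglongrightarrow> v - w"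
    unfolding closure_sequential by metis
  have "(v - w) \<bullet> X n = 0" for n
    using X(1)[of n] symmetric_opD[OF A(2) vw] by fastforce
  then have "(\<lambda>n. (v - w) \<bullet> X n) \<longlonglongrightarrow> 0"
    by simp
  moreover have "(\<lambda>n. (v - w) \<bullet> X n) \<longlonglongrightarrow> (v - w) \<bullet> (v - w)"
    by (intro tendsto_intros X(2))
  ultimately have "(v - w) \<bullet> (v - w) = 0"
    using LIMSEQ_unique by blast
  then show ?thesis by simp
qed

lemma continuous_on_sqrt_UNIV: "continuous_on UNIV sqrt"
  by (intro continuous_intros)

lemma theta_continuous: "\<eta> > 0 \<Longrightarrow> continuous_on UNIV (theta l \<eta>)"
proof -
  assume "\<eta> > 0"
  then have "theta l \<eta> = (\<lambda>t. min 1 (max 0 (4 * (\<eta> - \<bar>t - l\<bar>) / \<eta>)))"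
    by (auto simp: theta_def fun_eq_iff min_def max_def field_simps)
  then show ?thesis
    using \<open>\<eta> > 0\<close> by (auto intro!: continuous_intros)
qed

lemma theta_self: "\<eta> > 0 \<Longrightarrow> theta l \<eta> l = 1"
  by (simp add: theta_def)

text \<open>Kept apart from the density assumptions of \<open>symmetric_triple\<close>, because for
  angular momentum those are themselves proved by means of \<open>S\<close>,
  \<open>subspace_S\<close> and \<open>S_nonneg\<close>.\<close>

locale symmetric_family =
  fixes h :: "3 \<Rightarrow> 'a::{real_inner,banach} operator"
  assumes subspace_h: "subspace (h j)"
    and closed_h: "closed (h j)"
    and symmetric_h: "symmetric_op (h j)"
  begin

definition S :: "'a operator" where
  "S = op_add (op_add (op_mult (h 1) (h 1)) (op_mult (h 2) (h 2))) (op_mult (h 3) (h 3))"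

definition d :: "'a operator" where "d = closure S"

lemma subspace_S: "subspace S"
  unfolding S_def by (intro subspace_op_add subspace_op_mult subspace_h)

lemma S_cases:
  assumes "(u, w) \<in> S"
  obtains a b where "\<And>j. (u, a j) \<in> h j" "\<And>j. (a j, b j) \<in> h j" "w = b 1 + b 2 + b (3::3)"
proof -
  obtain a1 b1 a2 b2 a3 b3 where *: "(u, a1) \<in> h 1" "(a1, b1) \<in> h 1" "(u, a2) \<in> h 2" "(a2, b2) \<in> h 2"
    "(u, a3) \<in> h 3" "(a3, b3) \<in> h 3" "w = b1 + b2 + b3"
    using assms unfolding S_def op_add_def op_mult_def by blast
  show ?thesis
  proof
    let ?a = "\<lambda>j::3. if j = 1 then a1 else if j = 2 then a2 else a3"
    let ?b = "\<lambda>j::3. if j = 1 then b1 else if j = 2 then b2 else b3"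
    show "(u, ?a j) \<in> h j" "(?a j, ?b j) \<in> h j" for j
      using * exhaust_3[of j] by auto
    show "w = ?b 1 + ?b 2 + ?b 3"
      using * by simp
  qed
qed

lemma symmetric_S: "symmetric_op S"
  unfolding symmetric_op_def
proof clarify
  fix u w u' w' assume "(u, w) \<in> S" "(u', w') \<in> S"
  then obtain a b a' b' where *:
    "\<And>j. (u, a j) \<in> h j" "\<And>j. (a j, b j) \<in> h j" "w = b 1 + b 2 + b (3::3)"
    "\<And>j. (u', a' j) \<in> h j" "\<And>j. (a' j, b' j) \<in> h j" "w' = b' 1 + b' 2 + b' (3::3)"
    by (metis S_cases)
  have "b j \<bullet> u' = u \<bullet> b' j" for j
    using symmetric_opD[OF symmetric_h *(2,4)] symmetric_opD[OF symmetric_h *(1,5)] by simp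
  then show "w \<bullet> u' = u \<bullet> w'"
    by (simp add: * inner_add_left inner_add_right)
qed

lemma S_nonneg:
  assumes "(u, w) \<in> S"
  shows "0 \<le> w \<bullet> u"
proof -
  obtain a b where *: "\<And>j. (u, a j) \<in> h j" "\<And>j. (a j, b j) \<in> h j" "w = b 1 + b 2 + b (3::3)"
    using S_cases[OF assms] by blast
  have "b i \<bullet> u = a i \<bullet> a i" for i
    using symmetric_opD[OF symmetric_h *(2,1)] .
  then show ?thesis
    by (simp add: * inner_add_left)
qed

end

text \<open>For a densely defined, positive, symmetric S, dense range of 1 + S is equivalent to
  essential self-adjointness; this is the form in which it can be both checked and applied.\<close>

locale symmetric_triple = symmetric_family h for h :: "3 \<Rightarrow> 'a::{real_inner,banach} operator" +
  assumes dense_Domain: "closure (Domain S) = UNIV"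
    and dense_Range: "closure (Range (op_add Id S)) = UNIV"
begin

lemma Domain_S_le: "Domain S \<subseteq> Domain (h j)"
  by (auto elim!: S_cases)

lemma dense_Domain_h: "closure (Domain (h j)) = UNIV"
  using closure_mono[OF Domain_S_le[of j]] dense_Domain S_def by auto

lemmas h_single = symmetric_op_single_valued[OF subspace_h symmetric_h dense_Domain_h]

text \<open><S u, u> is the sum of the three squares |h_i u|^2, and c is one of the vectors h_i
  u.\<close>

lemma S_bound:
  assumes "(u, w) \<in> S" "(u, c) \<in> h j"
  shows "(norm c)\<^sup>2 \<le> w \<bullet> u"
proof -
  obtain a b where *: "\<And>j. (u, a j) \<in> h j" "\<And>j. (a j, b j) \<in> h j" "w = b 1 + b 2 + b (3::3)"
    using S_cases[OF assms(1)] by blast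
  have "b i \<bullet> u = (norm (a i))\<^sup>2" for i
    using symmetric_opD[OF symmetric_h *(2,1)] by (simp add: power2_norm_eq_inner)
  then have "w \<bullet> u = (norm (a 1))\<^sup>2 + (norm (a 2))\<^sup>2 + (norm (a 3))\<^sup>2"
    by (simp add: * inner_add_left)
  moreover have "c = a j"
    using h_single[OF assms(2) *(1)] .
  ultimately show ?thesis
    using exhaust_3[of j] by auto
qed

lemma subspace_d: "subspace d" and closed_d: "closed d" and symmetric_d: "symmetric_op d"
  and S_le_d: "S \<subseteq> d"
  unfolding d_def
  using subspace_closure[OF subspace_S] symmetric_op_closure[OF symmetric_S] closure_subset by auto

text \<open>Passing to the closure keeps the domain inside that of h_j: applied to differences,
  \<open>S_bound\<close> shows that h_j U_n is Cauchy along any sequence defining (u, w), and h_j is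
  closed.\<close>

lemma d_bound:
  assumes "(u, w) \<in> d"
  obtains c where "(u, c) \<in> h j" "(norm c)\<^sup>2 \<le> w \<bullet> u"
proof -
  obtain X where X: "\<And>n. X n \<in> S" "X \<longlonglongrightarrow> (u, w)"
    using assms unfolding d_def closure_sequential by metis
  define U W where "U n = fst (X n)" and "W n = snd (X n)" for n
  have UW: "(U n, W n) \<in> S" for n
    using X(1) by (simp add: U_def W_def)
  have lim: "U \<longlonglongrightarrow> u" "W \<longlonglongrightarrow> w"
    using tendsto_fst[OF X(2)] tendsto_snd[OF X(2)] by (simp_all add: U_def[abs_def] W_def[abs_def])
  obtain C where C: "\<And>n. (U n, C n) \<in> h j"
    using UW Domain_S_le[of j] by (meson DomainE DomainI subset_iff)
  have diff: "(norm (C n - C m))\<^sup>2 \<le> norm (W n - W m) * norm (U n - U m)" for n m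
    using S_bound[of "U n - U m" "W n - W m" "C n - C m" j] norm_cauchy_schwarz[of "W n - W m" "U n - U m"]
      subspace_diff[OF subspace_S UW UW, of n m] subspace_diff[OF subspace_h C C, of n m] by simp
  have "Cauchy C"
  proof (rule metric_CauchyI)
    fix e :: real assume "e > 0"
    then obtain N1 N2 where N: "\<And>n m. n \<ge> N1 \<Longrightarrow> m \<ge> N1 \<Longrightarrow> dist (U n) (U m) < e"
      "\<And>n m. n \<ge> N2 \<Longrightarrow> m \<ge> N2 \<Longrightarrow> dist (W n) (W m) < e"
      using metric_CauchyD[OF LIMSEQ_imp_Cauchy[OF lim(1)]] metric_CauchyD[OF LIMSEQ_imp_Cauchy[OF lim(2)]]
      by metis
    have "dist (C n) (C m) < e" if nm: "n \<ge> max N1 N2" "m \<ge> max N1 N2" for n m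
    proof -
      have "(norm (C n - C m))\<^sup>2 \<le> norm (W n - W m) * norm (U n - U m)" by (rule diff)
      also have "\<dots> < e * e"
        using N nm by (intro mult_strict_mono') (auto simp: dist_norm)
      finally show ?thesis
        using \<open>e > 0\<close> by (auto simp: dist_norm power2_eq_square intro: power2_less_imp_less)
    qed
    then show "\<exists>M. \<forall>m\<ge>M. \<forall>n\<ge>M. dist (C m) (C n) < e" by blast
  qed
  then obtain c where c: "C \<longlonglongrightarrow> c"
    by (auto simp: Cauchy_convergent_iff convergent_def)
  have "(u, c) \<in> h j"
    by (rule closed_sequentially[OF closed_h, of "\<lambda>n. (U n, C n)"]) (use C lim c in \<open>auto intro: tendsto_Pair\<close>)
  moreover have "(norm c)\<^sup>2 \<le> w \<bullet> u"
    by (rule LIMSEQ_le[of "\<lambda>n. (norm (C n))\<^sup>2" _ "\<lambda>n. W n \<bullet> U n"])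
      (use c lim S_bound[OF UW C] in \<open>auto intro!: tendsto_intros\<close>)
  ultimately show ?thesis by (rule that)
qed

lemma d_nonneg: "(u, w) \<in> d \<Longrightarrow> 0 \<le> w \<bullet> u"
  using d_bound[of u w 1] zero_le_power2 order_trans by metis

lemma d_coercive:
  assumes "(u, w) \<in> d"
  shows "norm u \<le> norm (u + w)"
proof -
  have "norm u * norm u \<le> (u + w) \<bullet> u"
    using d_nonneg[OF assms] by (simp add: inner_add_left flip: power2_norm_eq_inner power2_eq_square)
  also have "\<dots> \<le> norm (u + w) * norm u"
    by (rule norm_cauchy_schwarz)
  finally show ?thesis
    by (metis mult_right_le_imp_le norm_ge_zero norm_zero zero_less_norm_iff)
qed

text \<open>By \<open>d_coercive\<close>, convergence of (1 + d) U_n forces convergence of U_n.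
  Since d is closed, the range of 1 + d is closed as well as dense.\<close>

lemma range_Id_plus_d: "\<exists>u. (u, f - u) \<in> d"
proof -
  have "f \<in> closure (Range (op_add Id S))"
    using dense_Range by simp
  then obtain F where F: "\<And>n. F n \<in> Range (op_add Id S)" "F \<longlonglongrightarrow> f"
    unfolding closure_sequential by metis
  have "\<exists>u w. (u, w) \<in> S \<and> F n = u + w" for n
    using F(1)[of n] by (auto simp: op_add_def)
  then obtain U W where UW: "\<And>n. (U n, W n) \<in> d" "\<And>n. F n = U n + W n"
    using S_le_d by (metis subsetD)
  have "norm (U n - U m) \<le> norm (F n - F m)" for n m
    using d_coercive[of "U n - U m" "W n - W m"] subspace_diff[OF subspace_d UW(1) UW(1), of n m]
    by (simp add: UW(2) algebra_simps)
  then have "Cauchy U"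
    using LIMSEQ_imp_Cauchy[OF F(2)] unfolding Cauchy_def dist_norm by (meson le_less_trans)
  then obtain u where u: "U \<longlonglongrightarrow> u"
    by (auto simp: Cauchy_convergent_iff convergent_def)
  have "(\<lambda>n. (U n, F n - U n)) \<longlonglongrightarrow> (u, f - u)"
    by (intro tendsto_intros u F(2))
  then have "(u, f - u) \<in> d"
    by (rule closed_sequentially[OF closed_d, rotated]) (use UW in simp)
  then show ?thesis ..
qed

section \<open>Resolvent, Cayley transform and inverse square root\<close>

lemma resolvent_graph: "(op_add Id d)\<inverse> = op_of (resolvent d)"
proof -
  let ?G = "(op_add Id d)\<inverse>"
  have "subspace ?G"
    by (intro subspace_converse subspace_op_add subspace_Id subspace_d)
  moreover have "\<exists>v. (u, v) \<in> ?G" for u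
  proof -
    obtain v where "(v, u - v) \<in> d" using range_Id_plus_d by blast
    then have "(v, v + (u - v)) \<in> op_add Id d"
      by (intro op_addI) auto
    then show ?thesis by auto
  qed
  moreover have "norm v \<le> 1 * norm u" if "(u, v) \<in> ?G" for u v
    using that d_coercive by (auto simp: op_add_def)
  ultimately obtain T where "?G = op_of T"
    by (rule total_bounded_graph)
  then show ?thesis
    by (simp add: resolvent_def bounded_extension_op_of)
qed

lemma resolvent_in_d: "(resolvent d f, f - resolvent d f) \<in> d"
proof -
  have "(f, resolvent d f) \<in> (op_add Id d)\<inverse>"
    unfolding resolvent_graph by (auto simp: op_of_def)
  then obtain w where "f = resolvent d f + w" "(resolvent d f, w) \<in> d"
    by (auto simp: op_add_def)
  then show ?thesis by (metis add_diff_cancel_left')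
qed

lemma resolvent_apply:
  assumes "(u, w) \<in> d"
  shows "resolvent d (u + w) = u"
proof -
  have "(u + w, u) \<in> (op_add Id d)\<inverse>"
    using assms by (auto simp: op_add_def)
  then show ?thesis
    unfolding resolvent_graph by (auto simp: op_of_def)
qed

lemma sym_op_resolvent: "sym_op (resolvent d)"
  unfolding sym_op_def
proof (intro allI)
  fix f g
  show "resolvent d f \<bullet> g = f \<bullet> resolvent d g"
    using symmetric_opD[OF symmetric_d resolvent_in_d[of f] resolvent_in_d[of g]]
    by (simp add: inner_diff_left inner_diff_right)
qed

lemma resolvent_inner: "(norm (resolvent d f))\<^sup>2 \<le> resolvent d f \<bullet> f"
  using d_nonneg[OF resolvent_in_d[of f]]
  by (simp add: inner_diff_left inner_commute[of f] power2_norm_eq_inner)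

lemma resolvent_nonneg: "0 \<le> resolvent d f \<bullet> f"
  using resolvent_inner[of f] zero_le_power2 order_trans by blast

lemma dense_Domain_d: "closure (Domain d) = UNIV"
  using closure_mono[OF Domain_mono[OF S_le_d]] dense_Domain by auto

text \<open>With R the resolvent, d R f = f - R f, hence (d - 1) R f = f - 2 R f. Single-valuedness
  of d excludes any other value.\<close>

lemma cayley_eq: "cayley d = id_blinfun - 2 *\<^sub>R resolvent d"
proof -
  have "op_mult (op_add (op_of (- id_blinfun)) d) ((op_add Id d)\<inverse>)
      = op_of (id_blinfun - 2 *\<^sub>R resolvent d)"
  proof -
    have "(resolvent d f, w) \<in> d \<longleftrightarrow> w = f - resolvent d f" for f w
      using resolvent_in_d symmetric_op_single_valued[OF subspace_d symmetric_d dense_Domain_d] by blast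
    then show ?thesis
      unfolding resolvent_graph
      by (auto simp: op_mult_def op_add_def op_of_def relcomp_unfold blinfun.bilinear_simps
          scaleR_2 algebra_simps)
  qed
  then show ?thesis
    by (simp add: cayley_def bounded_extension_op_of)
qed

lemma sym_op_cayley: "sym_op (cayley d)"
  using sym_op_resolvent unfolding sym_op_def cayley_eq
  by (simp add: blinfun.bilinear_simps inner_diff_left inner_diff_right)

lemma sym_op_inv_sqrt: "sym_op (inv_sqrt d)"
  unfolding inv_sqrt_def by (rule sym_op_fun_calc[OF sym_op_resolvent continuous_on_sqrt_UNIV])

lemma inv_sqrt_inv_sqrt: "inv_sqrt d (inv_sqrt d f) = resolvent d f"
  using fun_calc_sqrt_compose[OF sym_op_resolvent resolvent_nonneg]
  unfolding inv_sqrt_def by (metis blinfun_apply_blinfun_compose)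

text \<open>The domain of d is contained in the range of the resolvent, which is the square of
  \<open>inv_sqrt d\<close>.\<close>

lemma dense_range_inv_sqrt: "closure (range (inv_sqrt d)) = UNIV"
proof -
  have "Domain d \<subseteq> range (inv_sqrt d)"
  proof
    fix u assume "u \<in> Domain d"
    then obtain w where "(u, w) \<in> d" by blast
    then have "u = inv_sqrt d (inv_sqrt d (u + w))"
      by (simp add: inv_sqrt_inv_sqrt resolvent_apply)
    then show "u \<in> range (inv_sqrt d)" by blast
  qed
  then show ?thesis
    using closure_mono dense_Domain_d by blast
qed

text \<open>Write B for \<open>inv_sqrt d\<close> and R = B B. The form bound gives |h_j R f|^2
  \<le> <f - R f, R f> \<le> <f, R f> = |B f|^2, so h_j B is a contraction on the range of
  B.\<close>

lemma h_inv_sqrt_range: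
  obtains a where "(inv_sqrt d (inv_sqrt d f), a) \<in> h j" "norm a \<le> norm (inv_sqrt d f)"
proof -
  obtain a where a: "(resolvent d f, a) \<in> h j" "(norm a)\<^sup>2 \<le> (f - resolvent d f) \<bullet> resolvent d f"
    using d_bound[OF resolvent_in_d] .
  have "(norm a)\<^sup>2 \<le> f \<bullet> resolvent d f"
    using a(2) inner_ge_zero[of "resolvent d f"] unfolding inner_diff_left by linarith
  also have "\<dots> = (norm (inv_sqrt d f))\<^sup>2"
    using sym_op_inv_sqrt by (simp add: sym_op_def power2_norm_eq_inner flip: inv_sqrt_inv_sqrt)
  finally have "norm a \<le> norm (inv_sqrt d f)"
    by (rule power2_le_imp_le) simp
  with a(1) show ?thesis
    by (intro that) (simp_all add: inv_sqrt_inv_sqrt)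
qed

text \<open>The contraction extends from the dense range of \<open>inv_sqrt d\<close> to all w
  because h_j is closed.\<close>

lemma h_inv_sqrt:
  obtains a where "(inv_sqrt d w, a) \<in> h j" "norm a \<le> norm w"
proof -
  have "w \<in> closure (range (inv_sqrt d))"
    by (simp add: dense_range_inv_sqrt)
  then obtain W where W: "\<And>n. W n \<in> range (inv_sqrt d)" "W \<longlonglongrightarrow> w"
    unfolding closure_sequential by metis
  have "\<forall>n. \<exists>f. W n = inv_sqrt d f"
    using W(1) by blast
  then obtain F where F: "\<And>n. W n = inv_sqrt d (F n)"
    by metis
  have "\<exists>a. (inv_sqrt d (W n), a) \<in> h j \<and> norm a \<le> norm (W n)" for n
    unfolding F using h_inv_sqrt_range[of "F n" j] by blast
  then obtain A where A: "\<And>n. (inv_sqrt d (W n), A n) \<in> h j" "\<And>n. norm (A n) \<le> norm (W n)"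
    by metis
  have "norm (A n - A m) \<le> norm (W n - W m)" for n m
  proof -
    obtain a where a: "(inv_sqrt d (W n - W m), a) \<in> h j" "norm a \<le> norm (W n - W m)"
      using h_inv_sqrt_range[of "F n - F m" j] unfolding F blinfun.diff_right[symmetric] by blast
    have "(inv_sqrt d (W n - W m), A n - A m) \<in> h j"
      using subspace_diff[OF subspace_h A(1) A(1), of n m] by (simp add: blinfun.diff_right)
    then show ?thesis
      \<comment> \<open>The bound is known for some value of h_j at the difference;
        single-valuedness identifies that value with A n - A m.\<close>
      using a h_single by metis
  qed
  then have "Cauchy A"
    using LIMSEQ_imp_Cauchy[OF W(2)] unfolding Cauchy_def dist_norm by (meson le_less_trans)
  then obtain a where a: "A \<longlonglongrightarrow> a"
    by (auto simp: Cauchy_convergent_iff convergent_def)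
  have "(\<lambda>n. (inv_sqrt d (W n), A n)) \<longlonglongrightarrow> (inv_sqrt d w, a)"
    by (intro tendsto_Pair blinfun.tendsto tendsto_const a W(2))
  then have "(inv_sqrt d w, a) \<in> h j"
    by (rule closed_sequentially[OF closed_h, rotated]) (rule A)
  moreover have "norm a \<le> norm w"
    by (rule LIMSEQ_le[OF tendsto_norm[OF a] tendsto_norm[OF W(2)]]) (use A in auto)
  ultimately show ?thesis by (rule that)
qed

text \<open>By \<open>h_inv_sqrt\<close> the natural domain of the product is already the whole
  space.\<close>

lemma bounded_transform_graph:
  "op_mult (op_of (inv_sqrt d)) (op_mult (h j) (op_of (inv_sqrt d))) = op_of (bounded_transform d (h j))"
proof -
  let ?G = "op_mult (op_of (inv_sqrt d)) (op_mult (h j) (op_of (inv_sqrt d)))"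
  have G: "(u, v) \<in> ?G \<longleftrightarrow> (\<exists>a. (inv_sqrt d u, a) \<in> h j \<and> v = inv_sqrt d a)" for u v
    by (auto simp: op_mult_def op_of_def relcomp_unfold)
  have "subspace ?G"
    by (intro subspace_op_mult subspace_op_of subspace_h)
  moreover have "\<exists>v. (u, v) \<in> ?G" for u
    unfolding G using h_inv_sqrt[of u j] by blast
  moreover have "norm v \<le> norm (inv_sqrt d) * norm u" if uv: "(u, v) \<in> ?G" for u v
  proof -
    obtain a where a: "(inv_sqrt d u, a) \<in> h j" "v = inv_sqrt d a"
      using uv unfolding G by blast
    have "norm a \<le> norm u"
      using h_inv_sqrt[of u j] h_single a(1) by metis
    then show ?thesis
      using norm_blinfun[of "inv_sqrt d" a] mult_left_mono[of "norm a" "norm u" "norm (inv_sqrt d)"]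
      by (simp add: a(2))
  qed
  ultimately obtain T where "?G = op_of T"
    by (rule total_bounded_graph)
  then show ?thesis
    by (simp add: bounded_transform_def bounded_extension_op_of)
qed

lemma bounded_transform_apply:
  "(inv_sqrt d u, a) \<in> h j \<Longrightarrow> bounded_transform d (h j) u = inv_sqrt d a"
proof -
  assume a: "(inv_sqrt d u, a) \<in> h j"
  have "(u, inv_sqrt d a) \<in> op_mult (op_of (inv_sqrt d)) (op_mult (h j) (op_of (inv_sqrt d)))"
    using a by (auto simp: op_mult_def op_of_def relcomp_unfold)
  then show ?thesis
    unfolding bounded_transform_graph by (auto simp: op_of_def)
qed

lemma sym_op_bounded_transform: "sym_op (bounded_transform d (h j))"
  unfolding sym_op_def
proof (intro allI)
  fix u v
  obtain a where a: "(inv_sqrt d u, a) \<in> h j" by (rule h_inv_sqrt)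
  obtain b where b: "(inv_sqrt d v, b) \<in> h j" by (rule h_inv_sqrt)
  show "bounded_transform d (h j) u \<bullet> v = u \<bullet> bounded_transform d (h j) v"
    using symmetric_opD[OF symmetric_h a b] sym_op_inv_sqrt
    by (simp add: bounded_transform_apply[OF a] bounded_transform_apply[OF b] sym_op_def)
qed

text \<open>The coordinates of \<open>(-1, 0)\<close>, which is \<open>Phi 0\<close>, are the
  eigenvalues belonging to v: from d v = 0 one gets -1 for the Cayley transform, 1 for
  \<open>inv_sqrt d\<close>, and 0 for the three bounded transforms. Each cut-off function equals 1
  at its centre.\<close>

lemma norm_Theta_S_ge_1:
  assumes v: "v \<noteq> 0" "\<And>j. (v, 0) \<in> h j" and "\<eta> > 0"
  shows "1 \<le> norm (Theta_S (-1, 0) \<eta> (h 1, h 2, h 3))"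
proof -
  have zero: "(0, 0) \<in> h j" for j
    using subspace_0[OF subspace_h] by (simp add: zero_prod_def)
  have "(v, 0 + 0 + 0) \<in> S"
    using v(2) zero unfolding S_def op_add_def op_mult_def by blast
  then have vd: "(v, 0) \<in> d" using S_le_d by auto
  have R: "resolvent d v = v"
    using resolvent_apply[OF vd] by simp
  then have B: "inv_sqrt d v = v"
    unfolding inv_sqrt_def
    using fun_calc_eigenvector[OF sym_op_resolvent continuous_on_sqrt_UNIV v(1), of 1] by simp
  have C: "cayley d v = (-1) *\<^sub>R v"
    by (simp add: cayley_eq blinfun.bilinear_simps R scaleR_2)
  have T: "bounded_transform d (h j) v = 0" for j
    using bounded_transform_apply[of v 0 j] B v(2) by simp
  have T1: "fun_calc (theta 0 \<eta>) (2 *\<^sub>R bounded_transform d (h j)) v = v" for j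
  proof -
    have "sym_op (2 *\<^sub>R bounded_transform d (h j))"
      using sym_op_bounded_transform by (simp add: sym_op_def blinfun.bilinear_simps)
    then show ?thesis
      using fun_calc_eigenvector[OF _ theta_continuous v(1), of "2 *\<^sub>R bounded_transform d (h j)" \<eta> 0 0]
        \<open>\<eta> > 0\<close> by (simp add: T blinfun.bilinear_simps theta_self)
  qed
  have C1: "fun_calc (theta (-1) \<eta>) (cayley d) v = v"
    using fun_calc_eigenvector[OF sym_op_cayley theta_continuous v(1) C, of \<eta> "-1"] \<open>\<eta> > 0\<close>
    by (simp add: theta_self)
  have "Theta_S (-1, 0) \<eta> (h 1, h 2, h 3) v = v"
    by (simp add: Theta_S_def Let_def sum_squares_def C1 T1 flip: S_def d_def)
  then have "norm v \<le> norm (Theta_S (-1, 0) \<eta> (h 1, h 2, h 3)) * norm v"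
    using norm_blinfun[of "Theta_S (-1, 0) \<eta> (h 1, h 2, h 3)" v] by simp
  then show ?thesis using v(1) by simp
qed

end

section \<open>Completeness of the space of square integrable functions\<close>

lemma l2_cases:
  obtains f where "square_integrable f" "u = abs_l2 f"
proof
  show "square_integrable (rep_l2 u)"
    using Quotient_rep_reflp[OF Quotient_l2, of u] by (simp add: l2_rel_def)
  show "u = abs_l2 (rep_l2 u)"
    using Quotient_abs_rep[OF Quotient_l2, of u] by simp
qed

lemma l2_rel_refl: "square_integrable f \<Longrightarrow> l2_rel f f"
  by (simp add: l2_rel_def)

lemma abs_l2_add:
  "square_integrable f \<Longrightarrow> square_integrable g \<Longrightarrow> abs_l2 f + abs_l2 g = abs_l2 (\<lambda>x. f x + g x)"
  by (simp add: plus_l2.abs_eq l2_rel_refl)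

lemma abs_l2_diff:
  "square_integrable f \<Longrightarrow> square_integrable g \<Longrightarrow> abs_l2 f - abs_l2 g = abs_l2 (\<lambda>x. f x - g x)"
  by (simp add: minus_l2.abs_eq l2_rel_refl)

lemma abs_l2_scaleR:
  "square_integrable f \<Longrightarrow> r *\<^sub>R abs_l2 f = abs_l2 (\<lambda>x. r *\<^sub>R f x)"
  by (simp add: scaleR_l2.abs_eq l2_rel_refl)

lemma abs_l2_inner:
  "square_integrable f \<Longrightarrow> square_integrable g \<Longrightarrow> abs_l2 f \<bullet> abs_l2 g = (\<integral>x. f x \<bullet> g x \<partial>lborel)"
  by (simp add: inner_l2.abs_eq l2_rel_refl)

lemma abs_l2_zero: "abs_l2 (\<lambda>_. 0) = 0"
  by (simp add: zero_l2_def)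

lemma norm_abs_l2:
  "square_integrable f \<Longrightarrow> (norm (abs_l2 f))\<^sup>2 = (\<integral>x. (norm (f x))\<^sup>2 \<partial>lborel)"
  by (simp add: power2_norm_eq_inner abs_l2_inner)

lemma nn_integral_square_integrable:
  assumes "square_integrable f"
  shows "(\<integral>\<^sup>+x. ennreal ((norm (f x))\<^sup>2) \<partial>lborel) = ennreal ((norm (abs_l2 f))\<^sup>2)"
  using assms unfolding norm_abs_l2[OF assms] square_integrable_def
  by (intro nn_integral_eq_integral) auto

lemma square_integrableI_nn_integral:
  assumes "f \<in> borel_measurable lborel" "(\<integral>\<^sup>+x. ennreal ((norm (f x))\<^sup>2) \<partial>lborel) \<le> ennreal c"
  shows "square_integrable f"
proof -
  have "(\<integral>\<^sup>+x. ennreal (norm ((norm (f x))\<^sup>2)) \<partial>lborel) < \<infinity>"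
    using assms(2) by (simp add: le_less_trans)
  then show ?thesis
    using assms(1) by (auto simp: square_integrable_def integrable_iff_bounded)
qed

lemma half_power_square: "((1/2) ^ k)\<^sup>2 = ((1/4) ^ k :: real)"
proof -
  have "((1/2) ^ k)\<^sup>2 = (((1/2)\<^sup>2) ^ k :: real)"
    by (simp only: power_mult[symmetric] mult.commute)
  then show ?thesis by (simp add: power2_eq_square)
qed

text \<open>The hypothesis says that |z_k| is of order 2^(-k/2), hence dominated by a geometric
  series.\<close>

lemma summable_of_weighted_squares:
  fixes z :: "nat \<Rightarrow> 'a::banach"
  assumes "\<And>k. 2 ^ k * (norm (z k))\<^sup>2 \<le> C"
  shows "summable z"
proof (rule summable_comparison_test)
  have "norm (z k) \<le> sqrt C * (sqrt (1/2)) ^ k" for k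
  proof -
    have "(norm (z k))\<^sup>2 \<le> C * (1/2) ^ k"
      using assms[of k] by (simp add: field_simps)
    also have "C * (1/2) ^ k = (sqrt C * (sqrt (1/2)) ^ k)\<^sup>2"
    proof -
      have "((sqrt (1/2)) ^ k)\<^sup>2 = ((sqrt (1/2))\<^sup>2) ^ k"
        by (simp only: power_mult[symmetric] mult.commute)
      moreover have "0 \<le> C"
        using order_trans[OF _ assms[of 0], of 0] by simp
      ultimately show ?thesis
        by (simp add: power_mult_distrib del: power_one_over)
    qed
    finally show ?thesis
      by (rule power2_le_imp_le) (use order_trans[OF _ assms[of 0], of 0] in simp)
  qed
  then show "\<exists>N. \<forall>n\<ge>N. norm (z n) \<le> sqrt C * (sqrt (1/2)) ^ n"
    by blast
  have "sqrt (1/2) < sqrt 1" by (rule real_sqrt_less_mono) simp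
  then show "summable (\<lambda>n. sqrt C * (sqrt (1/2)) ^ n)"
    by (intro summable_mult summable_geometric) simp
qed

text \<open>Riesz-Fischer argument: summable increments give a limit almost everywhere, and Fatou's
  lemma shows that it is also the limit in norm.\<close>

lemma l2_fast_Cauchy_converges:
  fixes Y :: "nat \<Rightarrow> l2"
  assumes Y: "\<And>j k. k \<le> j \<Longrightarrow> norm (Y j - Y k) \<le> (1/2) ^ k"
  shows "convergent Y"
proof -
  have "\<forall>k. \<exists>f. square_integrable f \<and> Y k = abs_l2 f"
    using l2_cases by metis
  then obtain f where f: "\<And>k. square_integrable (f k)" "\<And>k. Y k = abs_l2 (f k)"
    by metis
  have meas [measurable]: "f k \<in> borel_measurable borel" for k
    using f(1)[of k] by (simp add: square_integrable_def)
  have int: "(\<integral>\<^sup>+x. ennreal ((norm (f j x - f k x))\<^sup>2) \<partial>lborel) \<le> ennreal ((1/4) ^ k)" if "k \<le> j" for j k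
  proof -
    have "(\<integral>\<^sup>+x. ennreal ((norm (f j x - f k x))\<^sup>2) \<partial>lborel) = ennreal ((norm (Y j - Y k))\<^sup>2)"
      using f by (simp add: nn_integral_square_integrable square_integrable_diff abs_l2_diff)
    also have "\<dots> \<le> ennreal (((1/2) ^ k)\<^sup>2)"
      using Y[OF that] by (intro ennreal_leI power_mono) auto
    finally show ?thesis
      by (simp only: half_power_square)
  qed
  \<comment> \<open>The squared norms of the increments are at most 4^(-k). The weight 2^k leaves a
    convergent series and is still strong enough for pointwise summability.\<close>
  have "(\<integral>\<^sup>+x. (\<Sum>k. ennreal (2 ^ k * (norm (f (Suc k) x - f k x))\<^sup>2)) \<partial>lborel)
      = (\<Sum>k. \<integral>\<^sup>+x. ennreal (2 ^ k) * ennreal ((norm (f (Suc k) x - f k x))\<^sup>2) \<partial>lborel)"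
    by (subst nn_integral_suminf) (auto simp: ennreal_mult)
  also have "\<dots> \<le> (\<Sum>k. ennreal ((1/2) ^ k))"
  proof (intro suminf_le allI)
    fix k
    have "(\<integral>\<^sup>+x. ennreal (2 ^ k) * ennreal ((norm (f (Suc k) x - f k x))\<^sup>2) \<partial>lborel)
        \<le> ennreal (2 ^ k) * ennreal ((1/4) ^ k)"
      using int[of k "Suc k"] by (subst nn_integral_cmult) (auto intro!: mult_left_mono)
    also have "\<dots> = ennreal ((1/2) ^ k)"
      by (simp add: power_divide flip: ennreal_mult) (simp add: field_simps flip: power_mult_distrib)
    finally show "(\<integral>\<^sup>+x. ennreal (2 ^ k) * ennreal ((norm (f (Suc k) x - f k x))\<^sup>2) \<partial>lborel)
        \<le> ennreal ((1/2) ^ k)" .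
  qed auto
  also have "\<dots> = ennreal (\<Sum>k. (1/2) ^ k)"
    by (intro suminf_ennreal2 summable_geometric) auto
  finally have "(\<integral>\<^sup>+x. (\<Sum>k. ennreal (2 ^ k * (norm (f (Suc k) x - f k x))\<^sup>2)) \<partial>lborel) \<noteq> \<infinity>"
    by (auto simp: top_unique)
  then have fin: "AE x in lborel. (\<Sum>k. ennreal (2 ^ k * (norm (f (Suc k) x - f k x))\<^sup>2)) \<noteq> \<infinity>"
    by (intro nn_integral_noteq_infinite) auto
  have conv_pt: "convergent (\<lambda>k. f k x)"
    if "(\<Sum>k. ennreal (2 ^ k * (norm (f (Suc k) x - f k x))\<^sup>2)) \<noteq> \<infinity>" for x
  proof -
    let ?t = "\<lambda>k. 2 ^ k * (norm (f (Suc k) x - f k x))\<^sup>2"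
    define s where "s = (\<Sum>k. ennreal (?t k))"
    have "s \<noteq> \<infinity>"
      unfolding s_def by (rule that)
    then obtain c where c: "0 \<le> c" "s = ennreal c"
      by (cases s) auto
    have "?t k \<le> c" for k
    proof -
      have "ennreal (?t k) \<le> s"
        unfolding s_def using sum_le_suminf[OF summableI, of "{k}" "\<lambda>k. ennreal (?t k)"]
        by (simp only: finite.intros sum.insert sum.empty empty_iff not_False_eq_True add_0_right zero_le simp_thms)
      then show ?thesis
        unfolding c(2) by (simp only: ennreal_le_iff[OF c(1)])
    qed
    then have "summable (\<lambda>k. f (Suc k) x - f k x)"
      by (rule summable_of_weighted_squares)
    then have "convergent (\<lambda>n. \<Sum>k<n. f (Suc k) x - f k x)"
      by (simp add: summable_iff_convergent)
    then have "convergent (\<lambda>n. f n x - f 0 x)"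
      by (simp add: sum_lessThan_telescope[of "\<lambda>k. f k x"])
    then show "convergent (\<lambda>k. f k x)"
      by (simp add: convergent_diff_const_right_iff)
  qed
  have conv: "AE x in lborel. convergent (\<lambda>k. f k x)"
    using fin by (rule eventually_mono) (rule conv_pt)
  define g where "g x = lim (\<lambda>k. f k x)" for x
  have g_meas [measurable]: "g \<in> borel_measurable borel"
    unfolding g_def by measurable
  have lim: "AE x in lborel. (\<lambda>k. f k x) \<longlonglongrightarrow> g x"
    using conv by eventually_elim (simp add: g_def convergent_LIMSEQ_iff)
  have g_int: "(\<integral>\<^sup>+x. ennreal ((norm (g x - f k x))\<^sup>2) \<partial>lborel) \<le> ennreal ((1/4) ^ k)" for k
  proof -
    have "(\<integral>\<^sup>+x. ennreal ((norm (g x - f k x))\<^sup>2) \<partial>lborel)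
        = (\<integral>\<^sup>+x. liminf (\<lambda>j. ennreal ((norm (f j x - f k x))\<^sup>2)) \<partial>lborel)"
    proof (rule nn_integral_cong_AE)
      show "AE x in lborel. ennreal ((norm (g x - f k x))\<^sup>2) = liminf (\<lambda>j. ennreal ((norm (f j x - f k x))\<^sup>2))"
        using lim
      proof eventually_elim
        fix x assume "(\<lambda>k. f k x) \<longlonglongrightarrow> g x"
        then have "(\<lambda>j. ennreal ((norm (f j x - f k x))\<^sup>2)) \<longlonglongrightarrow> ennreal ((norm (g x - f k x))\<^sup>2)"
          by (intro tendsto_intros)
        from lim_imp_Liminf[OF sequentially_bot this]
        show "ennreal ((norm (g x - f k x))\<^sup>2) = liminf (\<lambda>j. ennreal ((norm (f j x - f k x))\<^sup>2))" ..
      qed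
    qed
    also have "\<dots> \<le> liminf (\<lambda>j. \<integral>\<^sup>+x. ennreal ((norm (f j x - f k x))\<^sup>2) \<partial>lborel)"
      by (rule nn_integral_liminf) auto
    also have "\<dots> \<le> liminf (\<lambda>j. ennreal ((1/4) ^ k))"
      using int by (intro Liminf_mono) (auto simp: eventually_sequentially)
    finally show ?thesis
      by (simp add: Liminf_const)
  qed
  have "square_integrable (\<lambda>x. g x - f 0 x)"
    by (rule square_integrableI_nn_integral[OF _ g_int]) simp
  from square_integrable_add[OF this f(1)[of 0]] have g: "square_integrable g"
    by simp
  have "norm (Y k - abs_l2 g) \<le> (1/2) ^ k" for k
  proof -
    have "ennreal ((norm (abs_l2 g - Y k))\<^sup>2) = (\<integral>\<^sup>+x. ennreal ((norm (g x - f k x))\<^sup>2) \<partial>lborel)"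
      using f g by (simp add: nn_integral_square_integrable square_integrable_diff abs_l2_diff)
    also have "\<dots> \<le> ennreal ((1/4) ^ k)"
      by (rule g_int)
    finally have "(norm (abs_l2 g - Y k))\<^sup>2 \<le> (1/4) ^ k"
      by (simp add: ennreal_le_iff)
    also have "((1/4) ^ k :: real) = ((1/2) ^ k)\<^sup>2"
      by (simp only: half_power_square)
    finally show ?thesis
      unfolding norm_minus_commute[of "Y k"] by (rule power2_le_imp_le) simp
  qed
  then have "(\<lambda>k. Y k - abs_l2 g) \<longlonglongrightarrow> 0"
    by (intro Lim_null_comparison[OF always_eventually LIMSEQ_realpow_zero[of "1/2"]]) simp_all
  from LIM_zero_cancel[OF this] show ?thesis
    by (rule convergentI)
qed

instance l2 :: complete_space
proof
  fix X :: "nat \<Rightarrow> l2" assume X: "Cauchy X"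
  have "\<forall>k. \<exists>N. \<forall>m\<ge>N. \<forall>n\<ge>N. dist (X m) (X n) < (1/2) ^ k"
    using X unfolding Cauchy_def by simp
  then obtain N where N: "\<And>k m n. m \<ge> N k \<Longrightarrow> n \<ge> N k \<Longrightarrow> dist (X m) (X n) < (1/2) ^ k"
    by metis
  \<comment> \<open>Partial sums turn N into an index sequence that is monotone and dominates
    N.\<close>
  define r where "r k = (\<Sum>i\<le>k. N i)" for k
  have rN: "N k \<le> r k" for k
    unfolding r_def by (rule member_le_sum) auto
  have mono: "r k \<le> r j" if "k \<le> j" for j k
    unfolding r_def using that by (intro sum_mono2) auto
  have "norm (X (r j) - X (r k)) \<le> (1/2) ^ k" if "k \<le> j" for j k
    using N[of k "r j" "r k"] rN[of k] mono[OF that] by (simp add: dist_norm)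
  then obtain L where L: "(\<lambda>k. X (r k)) \<longlonglongrightarrow> L"
    using l2_fast_Cauchy_converges[of "\<lambda>k. X (r k)"] by (auto simp: convergent_def)
  have "X \<longlonglongrightarrow> L"
  proof (rule metric_LIMSEQ_I)
    fix e :: real assume "e > 0"
    obtain K1 where K1: "\<And>k. k \<ge> K1 \<Longrightarrow> dist (X (r k)) L < e / 2"
      using metric_LIMSEQ_D[OF L, of "e / 2"] \<open>e > 0\<close> by auto
    obtain K2 where K2: "(1/2) ^ K2 < e / 2"
      using real_arch_pow_inv[of "e / 2" "1/2"] \<open>e > 0\<close> by auto
    define k where "k = max K1 K2"
    have "(1/2) ^ k \<le> (1/2 :: real) ^ K2"
      unfolding k_def by (intro power_decreasing) auto
    have "dist (X n) L < e" if "n \<ge> r k" for n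
    proof -
      have "dist (X n) (X (r k)) < (1/2) ^ k"
        using N[of k n "r k"] rN[of k] that by simp
      moreover have "dist (X (r k)) L < e / 2"
        by (rule K1) (simp add: k_def)
      ultimately show ?thesis
        using K2 \<open>(1/2) ^ k \<le> (1/2) ^ K2\<close> dist_triangle[of "X n" L "X (r k)"] by linarith
    qed
    then show "\<exists>no. \<forall>n\<ge>no. dist (X n) L < e" by blast
  qed
  then show "convergent X" by (auto simp: convergent_def)
qed

instance l2 :: banach ..

section \<open>Smooth functions and bumps\<close>

text \<open>Smoothness by finite orders. Closure under products is a plain induction on the order,
  whereas a coinduction would have to carry along all sums of products created by the Leibniz
  rule.\<close>

fun Ck :: "nat \<Rightarrow> (real^3 \<Rightarrow> complex) \<Rightarrow> bool" where
  "Ck 0 f = True"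
| "Ck (Suc k) f = (f differentiable_on UNIV \<and> (\<forall>i. Ck k (partial_deriv i f)))"

lemma smooth_iff_Ck: "smooth f \<longleftrightarrow> (\<forall>k. Ck k f)"
proof
  show "\<forall>k. Ck k f" if "smooth f"
  proof
    show "Ck k f" for k
      using that
    proof (induction k arbitrary: f)
      case (Suc k)
      from Suc.prems show ?case
        by (cases rule: smooth.cases) (use Suc.IH in auto)
    qed simp
  qed
  show "smooth f" if "\<forall>k. Ck k f"
    using that
  proof (coinduction arbitrary: f)
    case smooth
    have "f differentiable_on UNIV" "Ck k (partial_deriv i f)" for k i
      using smooth Ck.simps(2) by blast+
    then show ?case by auto
  qed
qed

lemma partial_deriv_eq:
  "(f has_derivative D) (at x) \<Longrightarrow> partial_deriv i f x = D (axis i 1)"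
  by (simp add: partial_deriv_def flip: frechet_derivative_at)

lemma Ck_SucI:
  assumes "\<And>x. (f has_derivative D x) (at x)" "\<And>i. Ck k (\<lambda>x. D x (axis i 1))"
  shows "Ck (Suc k) f"
proof -
  have "partial_deriv i f = (\<lambda>x. D x (axis i 1))" for i
    using partial_deriv_eq[OF assms(1)] by (simp add: fun_eq_iff)
  moreover have "f differentiable_on UNIV"
    using assms(1) by (auto simp: differentiable_on_def differentiable_def)
  ultimately show ?thesis
    using assms(2) by simp
qed

lemma Ck_SucD: "Ck (Suc k) f \<Longrightarrow> Ck k f"
  by (induction k arbitrary: f) auto

lemma Ck_const: "Ck k (\<lambda>_. c)"
proof (induction k arbitrary: c)
  case (Suc k)
  show ?case by (rule Ck_SucI[of _ "\<lambda>_ _. 0"]) (auto intro: Suc)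
qed simp

lemma Ck_imp_has_derivative:
  "Ck (Suc k) f \<Longrightarrow> (f has_derivative frechet_derivative f (at x)) (at x)"
  by (auto simp: differentiable_on_def frechet_derivative_works)

lemma Ck_add: "Ck k f \<Longrightarrow> Ck k g \<Longrightarrow> Ck k (\<lambda>x. f x + g x)"
proof (induction k arbitrary: f g)
  case (Suc k)
  show ?case
  proof (rule Ck_SucI)
    show "((\<lambda>x. f x + g x) has_derivative
        (\<lambda>h. frechet_derivative f (at x) h + frechet_derivative g (at x) h)) (at x)" for x
      using Suc.prems by (intro has_derivative_add Ck_imp_has_derivative)
    show "Ck k (\<lambda>x. frechet_derivative f (at x) (axis i 1) + frechet_derivative g (at x) (axis i 1))" for i
      using Suc by (simp flip: partial_deriv_def)
  qed
qed simp

lemma Ck_mult: "Ck k f \<Longrightarrow> Ck k g \<Longrightarrow> Ck k (\<lambda>x. f x * g x)"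
proof (induction k arbitrary: f g)
  case (Suc k)
  show ?case
  proof (rule Ck_SucI)
    show "((\<lambda>x. f x * g x) has_derivative
        (\<lambda>h. f x * frechet_derivative g (at x) h + frechet_derivative f (at x) h * g x)) (at x)" for x
      using Suc.prems by (intro has_derivative_mult Ck_imp_has_derivative)
    have "Ck k (\<lambda>x. f x * partial_deriv i g x)" "Ck k (\<lambda>x. partial_deriv i f x * g x)" for i
      using Suc.prems Suc.prems[THEN Ck_SucD] by (auto intro: Suc.IH)
    then show "Ck k (\<lambda>x. f x * frechet_derivative g (at x) (axis i 1) + frechet_derivative f (at x) (axis i 1) * g x)" for i
      by (intro Ck_add) (simp_all flip: partial_deriv_def)
  qed
qed simp

lemma coord_has_derivative:
  "((\<lambda>x. complex_of_real (x $ i)) has_derivative (\<lambda>h. of_real (h $ i))) (at x)"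
  by (intro has_derivative_of_real bounded_linear_imp_has_derivative bounded_linear_vec_nth)

lemma Ck_coord: "Ck k (\<lambda>x. of_real (x $ i))"
proof (cases k)
  case (Suc l)
  show ?thesis
    unfolding Suc
    by (rule Ck_SucI[OF coord_has_derivative]) (rule Ck_const)
qed simp

lemma smooth_const: "smooth (\<lambda>_. c)"
  and smooth_coord: "smooth (\<lambda>x. of_real (x $ i))"
  and smooth_add: "smooth f \<Longrightarrow> smooth g \<Longrightarrow> smooth (\<lambda>x. f x + g x)"
  and smooth_mult: "smooth f \<Longrightarrow> smooth g \<Longrightarrow> smooth (\<lambda>x. f x * g x)"
  by (auto simp: smooth_iff_Ck intro: Ck_const Ck_coord Ck_add Ck_mult)

lemma smooth_partial_deriv: "smooth f \<Longrightarrow> smooth (partial_deriv i f)"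
  by (auto elim: smooth.cases)

lemma smooth_has_derivative:
  "smooth f \<Longrightarrow> (f has_derivative frechet_derivative f (at x)) (at x)"
  by (auto elim: smooth.cases simp: differentiable_on_def frechet_derivative_works)

lemma smooth_continuous: "smooth f \<Longrightarrow> continuous_on UNIV f"
  by (auto elim: smooth.cases intro: differentiable_imp_continuous_on)

text \<open>Plane wave; for b = p / hbar it has momentum p.\<close>

definition phase :: "real^3 \<Rightarrow> real^3 \<Rightarrow> complex" where
  "phase b x = exp (\<i> * of_real (b \<bullet> x))"

lemma phase_has_derivative:
  "(phase b has_derivative (\<lambda>h. phase b x * (\<i> * of_real (b \<bullet> h)))) (at x)"
proof -
  have "((\<lambda>x. exp (\<i> * complex_of_real (b \<bullet> x))) has_derivative
      (\<lambda>h. exp (\<i> * complex_of_real (b \<bullet> x)) * (\<i> * of_real (b \<bullet> h)))) (at x)"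
    by (rule has_derivative_compose[of "\<lambda>x. \<i> * complex_of_real (b \<bullet> x)" "\<lambda>h. \<i> * of_real (b \<bullet> h)"
          _ _ exp "\<lambda>z. exp (\<i> * complex_of_real (b \<bullet> x)) * z"])
      (auto intro!: derivative_eq_intros DERIV_exp[unfolded has_field_derivative_def])
  then show ?thesis by (simp add: phase_def[abs_def])
qed

lemma smooth_phase: "smooth (phase b)"
proof -
  have "Ck k (phase b)" for k
  proof (induction k)
    case (Suc k)
    show ?case
      by (rule Ck_SucI[OF phase_has_derivative]) (intro Ck_mult Suc Ck_const)
  qed simp
  then show ?thesis by (simp add: smooth_iff_Ck)
qed

lemma norm_phase [simp]: "norm (phase b x) = 1"
  by (simp add: phase_def)

text \<open>\<open>flat 1\<close> is the classical exp(-1/t), extended by 0. The polynomial in 1/t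
  makes the family closed under differentiation.\<close>

definition flat :: "real poly \<Rightarrow> real \<Rightarrow> real" where
  "flat p t = (if t > 0 then poly p (inverse t) * exp (- inverse t) else 0)"

text \<open>From d/dt (p(1/t) exp(-1/t)) = t^(-2) (p - p')(1/t) exp(-1/t); the factor
  \<open>[:0, 0, 1:]\<close> is the square of X.\<close>

definition flat_deriv :: "real poly \<Rightarrow> real poly" where
  "flat_deriv p = [:0, 0, 1:] * (p - pderiv p)"

lemma poly_times_exp_tendsto_0: "((\<lambda>s. poly p s * exp (- s)) \<longlongrightarrow> 0) at_top" for p :: "real poly"
proof -
  have "((\<lambda>s. \<Sum>i\<le>degree p. coeff p i * (s ^ i / exp s)) \<longlongrightarrow> (\<Sum>i\<le>degree p. coeff p i * 0)) at_top"
    by (intro tendsto_sum tendsto_mult tendsto_const tendsto_power_div_exp_0)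
  then show ?thesis
    by (simp add: poly_altdef exp_minus field_simps sum_divide_distrib)
qed

lemma flat_has_derivative: "(flat p has_real_derivative flat (flat_deriv p) t) (at t)"
proof -
  consider "t > 0" | "t < 0" | "t = 0" by linarith
  then show ?thesis
  proof cases
    case 1
    have inv: "(inverse has_real_derivative - (inverse t * inverse t)) (at t)"
      using DERIV_inverse[of t] 1 by (simp add: power2_eq_square)
    have "((\<lambda>t. poly p (inverse t) * exp (- inverse t)) has_real_derivative
        poly (pderiv p) (inverse t) * - (inverse t * inverse t) * exp (- inverse t)
        + exp (- inverse t) * - (- (inverse t * inverse t)) * poly p (inverse t)) (at t)"
      by (intro DERIV_mult DERIV_chain2[OF poly_DERIV inv] DERIV_chain2[OF DERIV_exp DERIV_minus[OF inv]])
    also have "poly (pderiv p) (inverse t) * - (inverse t * inverse t) * exp (- inverse t)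
        + exp (- inverse t) * - (- (inverse t * inverse t)) * poly p (inverse t) = flat (flat_deriv p) t"
      using 1 by (simp add: flat_def flat_deriv_def algebra_simps)
    finally show ?thesis
      by (rule has_field_derivative_transform_within_open[where S = "{0<..}"])
        (use 1 in \<open>auto simp: flat_def\<close>)
  next
    case 2
    have "((\<lambda>t. 0) has_real_derivative flat (flat_deriv p) t) (at t)"
      using 2 by (simp add: flat_def)
    then show ?thesis
      by (rule has_field_derivative_transform_within_open[where S = "{..<0}"])
        (use 2 in \<open>auto simp: flat_def\<close>)
  next
    case 3
    \<comment> \<open>At 0 the difference quotient from the right is (X p)(1/h) exp(-1/h), which the
      exponential drives to 0.\<close>
    have "((\<lambda>h. flat p h / h) \<longlongrightarrow> 0) (at 0)"
      unfolding filterlim_at_split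
    proof
      have "((\<lambda>h. 0) \<longlongrightarrow> (0::real)) (at_left 0)" by simp
      then show "((\<lambda>h. flat p h / h) \<longlongrightarrow> 0) (at_left 0)"
        by (rule Lim_transform_eventually) (auto simp: eventually_at_filter flat_def)
      have "((\<lambda>h. poly ([:0, 1:] * p) (inverse h) * exp (- inverse h)) \<longlongrightarrow> 0) (at_right 0)"
        by (rule filterlim_compose[OF poly_times_exp_tendsto_0 filterlim_inverse_at_top_right])
      then show "((\<lambda>h. flat p h / h) \<longlongrightarrow> 0) (at_right 0)"
        by (rule Lim_transform_eventually)
          (auto simp: eventually_at_filter flat_def field_simps)
    qed
    then show ?thesis
      using 3 by (simp add: has_field_derivative_iff flat_def)
  qed
qed

lemma flat_1_pos: "t > 0 \<Longrightarrow> flat 1 t > 0"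
  by (simp add: flat_def)

lemma flat_nonpos: "t \<le> 0 \<Longrightarrow> flat p t = 0"
  by (simp add: flat_def)

text \<open>Using the squared distance keeps the function differentiable at its centre x0.\<close>

definition bump :: "real poly \<Rightarrow> real \<Rightarrow> real^3 \<Rightarrow> real^3 \<Rightarrow> complex" where
  "bump p R x0 x = of_real (flat p (R\<^sup>2 - (norm (x - x0))\<^sup>2))"

lemma bump_has_derivative:
  "(bump p R x0 has_derivative (\<lambda>h. bump (flat_deriv p) R x0 x * of_real (- 2 * ((x - x0) \<bullet> h)))) (at x)"
proof -
  have 1: "((\<lambda>x. R\<^sup>2 - (norm (x - x0))\<^sup>2) has_derivative (\<lambda>h. - 2 * ((x - x0) \<bullet> h))) (at x)"
    unfolding power2_norm_eq_inner
    by (auto intro!: derivative_eq_intros simp: inner_commute)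
  have "((\<lambda>x. flat p (R\<^sup>2 - (norm (x - x0))\<^sup>2)) has_derivative
      (\<lambda>h. flat (flat_deriv p) (R\<^sup>2 - (norm (x - x0))\<^sup>2) * (- 2 * ((x - x0) \<bullet> h)))) (at x)"
    by (rule has_derivative_compose[OF 1 flat_has_derivative[unfolded has_field_derivative_def]])
  then have "((\<lambda>x. complex_of_real (flat p (R\<^sup>2 - (norm (x - x0))\<^sup>2))) has_derivative
      (\<lambda>h. of_real (flat (flat_deriv p) (R\<^sup>2 - (norm (x - x0))\<^sup>2) * (- 2 * ((x - x0) \<bullet> h))))) (at x)"
    by (rule has_derivative_of_real)
  then show ?thesis
    by (simp add: bump_def[abs_def])
qed

lemma smooth_bump: "smooth (bump p R x0)"
proof -
  have "Ck k (bump p R x0)" for k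
  \<comment> \<open>Differentiation replaces p by \<open>flat_deriv p\<close>, so p must vary in the
    induction.\<close>
  proof (induction k arbitrary: p)
    case (Suc k)
    show ?case
    proof (rule Ck_SucI[OF bump_has_derivative])
      fix i
      have "Ck k (\<lambda>x. bump (flat_deriv p) R x0 x * (- 2 * (of_real (x $ i) + - of_real (x0 $ i))))"
        by (intro Ck_mult Suc Ck_add Ck_const Ck_coord)
      then show "Ck k (\<lambda>x. bump (flat_deriv p) R x0 x * complex_of_real (- 2 * ((x - x0) \<bullet> axis i 1)))"
        by (simp add: inner_axis)
    qed
  qed simp
  then show ?thesis by (simp add: smooth_iff_Ck)
qed

lemma bump_outside: "R \<ge> 0 \<Longrightarrow> R \<le> norm (x - x0) \<Longrightarrow> bump p R x0 x = 0"
  by (simp add: bump_def flat_nonpos power_mono)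

section \<open>Test functions and the angular momentum operators on them\<close>

lemma test_function_iff: "test_function \<phi> \<longleftrightarrow> smooth \<phi> \<and> bounded {x. \<phi> x \<noteq> 0}"
  by (simp add: test_function_def compact_closure)

lemma test_function_smooth: "test_function \<phi> \<Longrightarrow> smooth \<phi>"
  by (simp add: test_function_iff)

lemma test_function_zero: "test_function (\<lambda>_. 0)"
  by (simp add: test_function_iff smooth_const)

lemma test_function_add:
  assumes "test_function \<phi>" "test_function \<psi>"
  shows "test_function (\<lambda>x. \<phi> x + \<psi> x)"
proof -
  have "bounded {x. \<phi> x + \<psi> x \<noteq> 0}"
    by (rule bounded_subset[of "{x. \<phi> x \<noteq> 0} \<union> {x. \<psi> x \<noteq> 0}"]) (use assms in \<open>auto simp: test_function_iff\<close>)
  then show ?thesis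
    using assms by (simp add: test_function_iff smooth_add)
qed

lemma test_function_mult:
  assumes "smooth \<phi>" "test_function \<psi>"
  shows "test_function (\<lambda>x. \<phi> x * \<psi> x)"
proof -
  have "bounded {x. \<phi> x * \<psi> x \<noteq> 0}"
    by (rule bounded_subset[of "{x. \<psi> x \<noteq> 0}"]) (use assms in \<open>auto simp: test_function_iff\<close>)
  then show ?thesis
    using assms by (simp add: test_function_iff smooth_mult)
qed

lemma test_function_partial_deriv:
  assumes "test_function \<phi>"
  shows "test_function (partial_deriv i \<phi>)"
proof -
  let ?K = "closure {x. \<phi> x \<noteq> 0}"
  have "partial_deriv i \<phi> x = 0" if "x \<notin> ?K" for x
  proof -
    have "((\<lambda>_. 0) has_derivative (\<lambda>_. 0)) (at x)" by simp
    then have "(\<phi> has_derivative (\<lambda>_. 0)) (at x)"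
      by (rule has_derivative_transform_within_open[where s = "- ?K"])
        (use that closure_subset[of "{x. \<phi> x \<noteq> 0}"] in auto)
    then show ?thesis by (simp add: partial_deriv_eq)
  qed
  then have "{x. partial_deriv i \<phi> x \<noteq> 0} \<subseteq> ?K"
    by blast
  moreover have "bounded ?K"
    using assms by (simp add: test_function_iff bounded_closure)
  ultimately have "bounded {x. partial_deriv i \<phi> x \<noteq> 0}"
    using bounded_subset by blast
  then show ?thesis
    using assms by (simp add: test_function_iff smooth_partial_deriv)
qed

lemma test_function_bump: "R \<ge> 0 \<Longrightarrow> test_function (bump p R x0)"
proof -
  assume "R \<ge> 0"
  then have "{x. bump p R x0 x \<noteq> 0} \<subseteq> cball x0 R"
    using bump_outside by (auto simp: dist_norm norm_minus_commute) (metis nle_le norm_minus_commute)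
  then show ?thesis
    by (auto simp: test_function_iff smooth_bump intro: bounded_subset)
qed

lemma ang_diff_add:
  assumes "smooth f" "smooth g"
  shows "ang_diff hbar a b (\<lambda>x. f x + g x) = (\<lambda>x. ang_diff hbar a b f x + ang_diff hbar a b g x)"
proof -
  have "partial_deriv i (\<lambda>x. f x + g x) x = partial_deriv i f x + partial_deriv i g x" for i x
    by (subst partial_deriv_eq[OF has_derivative_add[OF assms[THEN smooth_has_derivative]]])
      (simp add: partial_deriv_def)
  then show ?thesis
    by (simp add: ang_diff_def fun_eq_iff algebra_simps)
qed

lemma ang_diff_mult:
  assumes "smooth f" "smooth g"
  shows "ang_diff hbar a b (\<lambda>x. f x * g x) = (\<lambda>x. f x * ang_diff hbar a b g x + ang_diff hbar a b f x * g x)"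
proof -
  have "partial_deriv i (\<lambda>x. f x * g x) x = f x * partial_deriv i g x + partial_deriv i f x * g x" for i x
    by (subst partial_deriv_eq[OF has_derivative_mult[OF assms[THEN smooth_has_derivative]]])
      (simp add: partial_deriv_def)
  then show ?thesis
    by (simp add: ang_diff_def fun_eq_iff algebra_simps)
qed

lemma ang_diff_const: "ang_diff hbar a b (\<lambda>_. c) = (\<lambda>_. 0)"
  by (simp add: ang_diff_def fun_eq_iff partial_deriv_eq[OF has_derivative_const])

lemma ang_diff_cmult:
  assumes "smooth f"
  shows "ang_diff hbar a b (\<lambda>x. c * f x) = (\<lambda>x. c * ang_diff hbar a b f x)"
  by (simp add: ang_diff_mult[OF smooth_const assms] ang_diff_const)

lemma ang_diff_coord:
  "ang_diff hbar a b (\<lambda>x. of_real (x $ i)) =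
     (\<lambda>x. - \<i> * of_real hbar * ((if i = b then 1 else 0) * of_real (x $ a) - (if i = a then 1 else 0) * of_real (x $ b)))"
proof -
  show ?thesis
    by (auto simp: ang_diff_def fun_eq_iff axis_def partial_deriv_eq[OF coord_has_derivative])
qed

text \<open>With y = x - x0 the gradient is a multiple of y, and in x_a y_b - x_b y_a the products
  of components of y cancel. What remains is of the size of y, and it vanishes for a bump centred at
  the origin.\<close>

lemma ang_diff_bump:
  "ang_diff hbar a b (bump p R x0) =
     (\<lambda>x. 2 * \<i> * of_real hbar * of_real (x0 $ a * (x $ b - x0 $ b) - x0 $ b * (x $ a - x0 $ a)) * bump (flat_deriv p) R x0 x)"
  (is "_ = ?r")
proof
  fix x
  have "complex_of_real (x $ a) * of_real (x $ b - x0 $ b) - of_real (x $ b) * of_real (x $ a - x0 $ a)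
    = of_real (x0 $ a * (x $ b - x0 $ b) - x0 $ b * (x $ a - x0 $ a))"
    by (simp add: algebra_simps)
  then show "ang_diff hbar a b (bump p R x0) x = ?r x"
    unfolding ang_diff_def partial_deriv_eq[OF bump_has_derivative] inner_axis
    by (simp add: algebra_simps)
qed

text \<open>For frequency p / hbar the factor becomes a component of x \<times> p, the classical
  angular momentum.\<close>

lemma ang_diff_phase:
  "ang_diff hbar a b (phase p) =
     (\<lambda>x. of_real hbar * of_real (x $ a * p $ b - x $ b * p $ a) * phase p x)"
proof
  fix x
  show "ang_diff hbar a b (phase p) x = of_real hbar * of_real (x $ a * p $ b - x $ b * p $ a) * phase p x"
    unfolding ang_diff_def partial_deriv_eq[OF phase_has_derivative] inner_axis
    by (simp add: algebra_simps)
qed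

lemma test_function_ang_diff:
  assumes "test_function \<phi>"
  shows "test_function (ang_diff hbar a b \<phi>)"
proof -
  have "test_function (\<lambda>x. (- \<i> * of_real hbar * of_real (x $ a)) * partial_deriv b \<phi> x
      + (\<i> * of_real hbar * of_real (x $ b)) * partial_deriv a \<phi> x)"
    by (intro test_function_add test_function_mult smooth_mult smooth_const smooth_coord
        test_function_partial_deriv assms)
  also have "(\<lambda>x. (- \<i> * of_real hbar * of_real (x $ a)) * partial_deriv b \<phi> x
      + (\<i> * of_real hbar * of_real (x $ b)) * partial_deriv a \<phi> x) = ang_diff hbar a b \<phi>"
    by (simp add: ang_diff_def fun_eq_iff algebra_simps)
  finally show ?thesis .
qed

section \<open>Symmetry of the angular momentum operators\<close>

lemma integrable_continuous_bounded_support: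
  fixes f :: "real^3 \<Rightarrow> 'b::{banach,second_countable_topology}"
  assumes "continuous_on UNIV f" "bounded {x. f x \<noteq> 0}"
  shows "integrable lborel f"
proof -
  obtain R where R: "\<forall>x\<in>{x. f x \<noteq> 0}. norm x \<le> R"
    using assms(2) unfolding bounded_iff by blast
  have "integrable lborel (\<lambda>x. indicator (cball 0 R) x *\<^sub>R f x)"
    by (rule borel_integrable_compact[OF compact_cball continuous_on_subset[OF assms(1)]]) simp
  moreover have "(\<lambda>x. indicator (cball 0 R) x *\<^sub>R f x) = f"
    using R by (fastforce simp: fun_eq_iff indicator_def)
  ultimately show ?thesis by simp
qed

lemma square_integrable_bounded_support:
  assumes "continuous_on UNIV f" "bounded {x. f x \<noteq> 0}"
  shows "square_integrable f"
  unfolding square_integrable_def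
proof
  show "f \<in> borel_measurable lborel"
    using assms(1) by (simp add: borel_measurable_continuous_onI)
  show "integrable lborel (\<lambda>x. (norm (f x))\<^sup>2)"
    by (rule integrable_continuous_bounded_support)
      (use assms in \<open>auto intro!: continuous_intros\<close>)
qed

lemma test_function_square_integrable: "test_function \<phi> \<Longrightarrow> square_integrable \<phi>"
  by (rule square_integrable_bounded_support) (auto simp: test_function_iff smooth_continuous)

lemma lborel_translate:
  fixes f :: "real^3 \<Rightarrow> real"
  shows "(\<integral>x. f (x + c) \<partial>lborel) = (\<integral>x. f x \<partial>lborel)"
    and "integrable lborel f \<Longrightarrow> integrable lborel (\<lambda>x. f (x + c))"
proof -
  have d: "distr lborel borel (\<lambda>x. c + x) = (lborel :: (real^3) measure)"
    using lborel_distr_plus[of c] by simp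
  show "(\<integral>x. f (x + c) \<partial>lborel) = (\<integral>x. f x \<partial>lborel)"
  proof (cases "f \<in> borel_measurable borel")
    case True
    then have "(\<integral>x. f x \<partial>distr lborel borel (\<lambda>x. c + x)) = (\<integral>x. f (c + x) \<partial>lborel)"
      by (intro integral_distr) auto
    then show ?thesis unfolding d by (simp add: add.commute)
  next
    case False
    \<comment> \<open>Without measurability both integrals have the default value 0.\<close>
    have "(\<lambda>x. f (x + c)) \<notin> borel_measurable borel"
    proof
      assume "(\<lambda>x. f (x + c)) \<in> borel_measurable borel"
      then have "(\<lambda>x. f (x + c)) \<circ> (\<lambda>x. x - c) \<in> borel_measurable borel"
        by (intro measurable_comp[of _ borel borel]) auto
      then show False using False by (simp add: comp_def)
    qed
    then have "\<not> integrable lborel (\<lambda>x. f (x + c))" "\<not> integrable lborel f"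
      using False by auto
    then show ?thesis by (simp add: not_integrable_integral_eq)
  qed
  show "integrable lborel (\<lambda>x. f (x + c))" if "integrable lborel f"
  proof -
    have "integrable (distr lborel borel (\<lambda>x. c + x)) f"
      unfolding d by (rule that)
    then show ?thesis
      using that by (subst (asm) integrable_distr_eq) (auto simp: add.commute)
  qed
qed

text \<open>The integral of a difference quotient vanishes by translation invariance.\<close>

lemma integral_directional_derivative_eq_0:
  fixes G :: "real^3 \<Rightarrow> real"
  assumes G: "\<And>x. (G has_derivative G' x) (at x)" and cont: "continuous_on UNIV (\<lambda>x. G' x e)"
    and supp: "bounded {x. G x \<noteq> 0}" and e: "norm e = 1"
  shows "(\<integral>x. G' x e \<partial>lborel) = 0"
proof -
  obtain R where R: "\<forall>x\<in>{x. G x \<noteq> 0}. norm x \<le> R"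
    using supp unfolding bounded_iff by blast
  have R0: "G x = 0" if "norm x > R" for x
    using R that by fastforce
  \<comment> \<open>The steps t n are at most 1, so the quotients vanish outside radius R + 1 and
    the intermediate points of the mean value theorem stay within R + 2.\<close>
  have "bounded ((\<lambda>x. G' x e) ` cball 0 (R + 2))"
    by (intro compact_imp_bounded compact_continuous_image continuous_on_subset[OF cont]) auto
  then obtain M where "\<forall>y\<in>(\<lambda>x. G' x e) ` cball 0 (R + 2). norm y \<le> M"
    unfolding bounded_iff by blast
  then have M: "\<bar>G' x e\<bar> \<le> M" if "norm x \<le> R + 2" for x
    using that by simp
  have contG: "continuous_on UNIV G"
    by (rule has_derivative_continuous_on[of UNIV G G']) (simp add: G)
  have intG: "integrable lborel G"
    by (rule integrable_continuous_bounded_support[OF contG supp])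
  define t where "t n = inverse (real (Suc n))" for n
  have t: "0 < t n" "t n \<le> 1" for n
    by (auto simp: t_def field_simps)
  define q where "q n x = (G (x + t n *\<^sub>R e) - G x) / t n" for n x
  have q0: "(\<integral>x. q n x \<partial>lborel) = 0" for n
  proof -
    have "(\<integral>x. G (x + t n *\<^sub>R e) - G x \<partial>lborel) = 0"
      by (subst Bochner_Integration.integral_diff)
        (use intG in \<open>auto simp: lborel_translate\<close>)
    then show ?thesis by (simp add: q_def)
  qed
  have line: "((\<lambda>s. G (x + s *\<^sub>R e)) has_real_derivative G' (x + s *\<^sub>R e) e) (at s)" for x s
  proof -
    have "((\<lambda>s. x + s *\<^sub>R e) has_derivative (\<lambda>s. s *\<^sub>R e)) (at s)"
      by (auto intro!: derivative_eq_intros)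
    from has_derivative_compose[OF this G]
    have "((\<lambda>s. G (x + s *\<^sub>R e)) has_derivative (\<lambda>r. G' (x + s *\<^sub>R e) (r *\<^sub>R e))) (at s)" .
    moreover have "G' (x + s *\<^sub>R e) (r *\<^sub>R e) = G' (x + s *\<^sub>R e) e * r" for r
      using linear_scale[OF has_derivative_linear[OF G]] by (simp add: mult.commute)
    ultimately show ?thesis
      by (simp add: has_field_derivative_def)
  qed
  have bound: "\<bar>q n x\<bar> \<le> M * indicator (cball 0 (R + 1)) x" for n x
  proof (cases "norm x \<le> R + 1")
    case True
    obtain s where s: "0 < s" "s < t n"
      "G (x + t n *\<^sub>R e) - G (x + 0 *\<^sub>R e) = (t n - 0) * G' (x + s *\<^sub>R e) e"
      using MVT2[of 0 "t n" "\<lambda>s. G (x + s *\<^sub>R e)" "\<lambda>s. G' (x + s *\<^sub>R e) e"] line t by blast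
    have "norm (x + s *\<^sub>R e) \<le> R + 2"
      using norm_triangle_ineq[of x "s *\<^sub>R e"] True s(1,2) t(2)[of n] e by simp
    from M[OF this] show ?thesis
      using s(3) t(1)[of n] True by (simp add: q_def)
  next
    case False
    then have "norm (x + t n *\<^sub>R e) > R"
      using norm_triangle_ineq2[of x "- (t n *\<^sub>R e)"] t[of n] e by simp
    then show ?thesis
      using False R0 by (simp add: q_def)
  qed
  have "(\<lambda>n. \<integral>x. q n x \<partial>lborel) \<longlonglongrightarrow> (\<integral>x. G' x e \<partial>lborel)"
  proof (rule integral_dominated_convergence)
    show "(\<lambda>x. G' x e) \<in> borel_measurable lborel"
      using cont by (simp add: borel_measurable_continuous_onI)
    have "continuous_on UNIV (q n)" for n
      unfolding q_def using t(1)[of n]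
      by (intro continuous_intros continuous_on_compose2[OF contG]) auto
    then show "q n \<in> borel_measurable lborel" for n
      by (simp add: borel_measurable_continuous_onI)
    show "integrable lborel (\<lambda>x::real^3. M * indicator (cball 0 (R + 1)) x :: real)"
      using emeasure_bounded_finite[of "cball (0::real^3) (R + 1)"]
      by (intro integrable_mult_right integrable_real_indicator) simp_all
    show "AE x in lborel. (\<lambda>n. q n x) \<longlonglongrightarrow> G' x e"
    proof (rule AE_I2)
      fix x
      have "((\<lambda>h. (G (x + h *\<^sub>R e) - G x) / h) \<longlongrightarrow> G' x e) (at 0)"
        using line[of x 0] by (simp add: DERIV_def)
      moreover have "filterlim t (at 0) sequentially"
        using t(1) LIMSEQ_inverse_real_of_nat unfolding t_def[abs_def] filterlim_at
        by (auto simp: less_imp_neq)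
      ultimately show "(\<lambda>n. q n x) \<longlonglongrightarrow> G' x e"
        unfolding q_def by (rule filterlim_compose)
    qed
    show "AE x in lborel. norm (q n x) \<le> M * indicator (cball 0 (R + 1)) x" for n
      using bound by auto
  qed
  then show ?thesis
    unfolding q0 using LIMSEQ_unique tendsto_const by blast
qed

text \<open>For F = <u \<phi>, \<psi>> with u = -i hbar, which is skew for the real inner product,
  the two integrands differ by x_a \<partial>_b F - x_b \<partial>_a F. Both terms are total
  derivatives, as x_i does not depend on x_j for i \<noteq> j.\<close>

lemma ang_diff_symmetric:
  assumes \<phi>: "test_function \<phi>" and \<psi>: "test_function \<psi>" and ab: "a \<noteq> b"
  shows "(\<integral>x. ang_diff hbar a b \<phi> x \<bullet> \<psi> x \<partial>lborel) = (\<integral>x. \<phi> x \<bullet> ang_diff hbar a b \<psi> x \<partial>lborel)"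
proof -
  define u where "u = - \<i> * complex_of_real hbar"
  define F where "F x = (u * \<phi> x) \<bullet> \<psi> x" for x
  define D where "D x h = (u * \<phi> x) \<bullet> frechet_derivative \<psi> (at x) h
      + (u * frechet_derivative \<phi> (at x) h) \<bullet> \<psi> x" for x h
  note s = \<phi>[THEN test_function_smooth] \<psi>[THEN test_function_smooth]
  have F: "(F has_derivative D x) (at x)" for x
    unfolding F_def[abs_def] D_def[abs_def]
    by (intro has_derivative_inner has_derivative_mult_right smooth_has_derivative s)
  have contF: "continuous_on UNIV F"
    unfolding F_def by (intro continuous_intros smooth_continuous s)
  have contD: "continuous_on UNIV (\<lambda>x. D x (axis i 1))" for i
    unfolding D_def partial_deriv_def[symmetric]
    by (intro continuous_intros smooth_continuous smooth_partial_deriv s)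
  have suppF: "bounded {x. F x \<noteq> 0}"
    by (rule bounded_subset[of "{x. \<phi> x \<noteq> 0}"]) (use \<phi> in \<open>auto simp: test_function_iff F_def\<close>)
  have part: "(\<integral>x. x $ i * D x (axis j 1) \<partial>lborel) = 0" if "i \<noteq> j" for i j
  proof -
    have d: "((\<lambda>x. x $ i * F x) has_derivative (\<lambda>h. x $ i * D x h + h $ i * F x)) (at x)" for x
      by (intro has_derivative_mult F bounded_linear_imp_has_derivative bounded_linear_vec_nth)
    have "(\<integral>x. x $ i * D x (axis j 1) + axis j 1 $ i * F x \<partial>lborel) = 0"
    proof (rule integral_directional_derivative_eq_0[OF d])
      show "continuous_on UNIV (\<lambda>x. x $ i * D x (axis j 1) + axis j 1 $ i * F x)"
        by (intro continuous_intros contF contD)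
      show "bounded {x. x $ i * F x \<noteq> 0}"
        by (rule bounded_subset[OF suppF]) auto
    qed simp
    then show ?thesis
      using that by (simp add: axis_def)
  qed
  have suppD: "bounded {x. x $ i * D x (axis j 1) \<noteq> 0}" for i j
  proof (rule bounded_subset)
    show "bounded ({x. \<phi> x \<noteq> 0} \<union> {x. \<psi> x \<noteq> 0})"
      using \<phi> \<psi> by (simp add: test_function_iff)
    show "{x. x $ i * D x (axis j 1) \<noteq> 0} \<subseteq> {x. \<phi> x \<noteq> 0} \<union> {x. \<psi> x \<noteq> 0}"
      by (auto simp: D_def)
  qed
  have intD: "integrable lborel (\<lambda>x. x $ i * D x (axis j 1))" for i j
    by (rule integrable_continuous_bounded_support[OF _ suppD]) (intro continuous_intros contD)
  have int: "integrable lborel (\<lambda>x. ang_diff hbar a b \<phi> x \<bullet> \<psi> x)"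
    "integrable lborel (\<lambda>x. \<phi> x \<bullet> ang_diff hbar a b \<psi> x)"
    by (intro integrable_inner_l2 test_function_square_integrable test_function_ang_diff \<phi> \<psi>)+
  have "ang_diff hbar a b \<phi> x \<bullet> \<psi> x - \<phi> x \<bullet> ang_diff hbar a b \<psi> x
      = x $ a * D x (axis b 1) - x $ b * D x (axis a 1)" for x
    by (simp add: ang_diff_def D_def u_def inner_complex_def algebra_simps flip: partial_deriv_def)
  then have "(\<integral>x. ang_diff hbar a b \<phi> x \<bullet> \<psi> x - \<phi> x \<bullet> ang_diff hbar a b \<psi> x \<partial>lborel)
      = (\<integral>x. x $ a * D x (axis b 1) - x $ b * D x (axis a 1) \<partial>lborel)"
    by simp
  also have "\<dots> = 0"
    using part[of a b] part[of b a] ab intD by (subst Bochner_Integration.integral_diff) auto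
  finally show ?thesis
    using int by (simp add: Bochner_Integration.integral_diff)
qed

definition ang_graph :: "real \<Rightarrow> 3 \<Rightarrow> 3 \<Rightarrow> l2 operator" where
  "ang_graph hbar a b = {(abs_l2 \<phi>, abs_l2 (ang_diff hbar a b \<phi>)) | \<phi>. test_function \<phi>}"

lemma ang_op_eq_closure: "ang_op hbar a b = closure (ang_graph hbar a b)"
  by (simp add: ang_op_def ang_graph_def)

lemma ang_graphI: "test_function \<phi> \<Longrightarrow> (abs_l2 \<phi>, abs_l2 (ang_diff hbar a b \<phi>)) \<in> ang_graph hbar a b"
  by (auto simp: ang_graph_def)

lemma ang_opI: "test_function \<phi> \<Longrightarrow> (abs_l2 \<phi>, abs_l2 (ang_diff hbar a b \<phi>)) \<in> ang_op hbar a b"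
  unfolding ang_op_eq_closure using ang_graphI closure_subset by blast

lemma subspace_ang_graph: "subspace (ang_graph hbar a b)"
  unfolding subspace_def
proof (intro conjI ballI allI)
  show "0 \<in> ang_graph hbar a b"
    using ang_graphI[OF test_function_zero, of hbar a b]
    by (simp add: ang_diff_const abs_l2_zero zero_prod_def)
next
  fix x y assume "x \<in> ang_graph hbar a b" "y \<in> ang_graph hbar a b"
  then obtain \<phi> \<psi> where
    x: "x = (abs_l2 \<phi>, abs_l2 (ang_diff hbar a b \<phi>))" "test_function \<phi>" and
    y: "y = (abs_l2 \<psi>, abs_l2 (ang_diff hbar a b \<psi>))" "test_function \<psi>"
    by (auto simp: ang_graph_def)
  note t = x(2) y(2)
  have "x + y = (abs_l2 (\<lambda>x. \<phi> x + \<psi> x), abs_l2 (ang_diff hbar a b (\<lambda>x. \<phi> x + \<psi> x)))"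
    using t by (simp add: x y abs_l2_add test_function_square_integrable test_function_ang_diff
        ang_diff_add test_function_smooth)
  then show "x + y \<in> ang_graph hbar a b"
    using ang_graphI[OF test_function_add[OF t], of hbar a b] by simp
next
  fix c :: real and x assume "x \<in> ang_graph hbar a b"
  then obtain \<phi> where
    x: "x = (abs_l2 \<phi>, abs_l2 (ang_diff hbar a b \<phi>))" "test_function \<phi>"
    by (auto simp: ang_graph_def)
  have "c *\<^sub>R x = (abs_l2 (\<lambda>x. of_real c * \<phi> x), abs_l2 (ang_diff hbar a b (\<lambda>x. of_real c * \<phi> x)))"
    using x(2) by (simp add: x abs_l2_scaleR test_function_square_integrable test_function_ang_diff
        ang_diff_cmult test_function_smooth scaleR_conv_of_real)
  then show "c *\<^sub>R x \<in> ang_graph hbar a b"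
    using ang_graphI[OF test_function_mult[OF smooth_const x(2)]] by simp
qed

lemma symmetric_ang_graph: "a \<noteq> b \<Longrightarrow> symmetric_op (ang_graph hbar a b)"
  by (auto simp: symmetric_op_def ang_graph_def abs_l2_inner test_function_square_integrable
      test_function_ang_diff ang_diff_symmetric)

lemma subspace_ang_op: "subspace (ang_op hbar a b)"
  and closed_ang_op: "closed (ang_op hbar a b)"
  and symmetric_ang_op: "a \<noteq> b \<Longrightarrow> symmetric_op (ang_op hbar a b)"
  unfolding ang_op_eq_closure
  by (simp_all add: subspace_closure subspace_ang_graph symmetric_op_closure symmetric_ang_graph)

section \<open>Homogeneous polynomials times a radial bump\<close>

text \<open>Monomials as words in the coordinates. They repeat up to reordering, but differentiation
  can act letter by letter.\<close>

fun mon :: "3 list \<Rightarrow> real^3 \<Rightarrow> complex" where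
  "mon [] x = 1"
| "mon (i # ws) x = of_real (x $ i) * mon ws x"

inductive hpoly :: "nat \<Rightarrow> (real^3 \<Rightarrow> complex) \<Rightarrow> bool" for n where
  word: "length ws = n \<Longrightarrow> hpoly n (\<lambda>x. c * mon ws x)"
| add: "hpoly n f \<Longrightarrow> hpoly n g \<Longrightarrow> hpoly n (\<lambda>x. f x + g x)"

lemma smooth_mon: "smooth (mon ws)"
proof (induction ws)
  case Nil
  have "mon [] = (\<lambda>x. 1)" by auto
  then show ?case by (simp add: smooth_const)
next
  case (Cons i ws)
  have "mon (i # ws) = (\<lambda>x. of_real (x $ i) * mon ws x)" by auto
  then show ?case using smooth_mult[OF smooth_coord Cons] by simp
qed

lemma hpoly_smooth: "hpoly n f \<Longrightarrow> smooth f"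
  by (induction rule: hpoly.induct) (auto intro: smooth_add smooth_mult smooth_const smooth_mon)

lemma hpoly_cmult: "hpoly n f \<Longrightarrow> hpoly n (\<lambda>x. c * f x)"
proof (induction rule: hpoly.induct)
  case (word ws c')
  then show ?case
    using hpoly.word[of ws n "c * c'"] by (simp add: mult.assoc)
next
  case (add f g)
  then show ?case
    using hpoly.add[of n "\<lambda>x. c * f x" "\<lambda>x. c * g x"] by (simp add: distrib_left)
qed

lemma hpoly_coord: "hpoly n f \<Longrightarrow> hpoly (Suc n) (\<lambda>x. of_real (x $ i) * f x)"
proof (induction rule: hpoly.induct)
  case (word ws c)
  then show ?case
    using hpoly.word[of "i # ws" "Suc n" c] by (simp add: mult.left_commute)
next
  case (add f g)
  then show ?case
    using hpoly.add[of "Suc n" "\<lambda>x. of_real (x $ i) * f x" "\<lambda>x. of_real (x $ i) * g x"]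
    by (simp add: distrib_left)
qed

text \<open>By the product rule the operator replaces one letter at a time by another, so the degree
  is preserved. This makes the spaces \<open>hspace n R\<close> invariant.\<close>

lemma hpoly_ang_diff_mon: "hpoly (length ws) (ang_diff hbar a b (mon ws))"
proof (induction ws)
  case Nil
  have "mon [] = (\<lambda>x. 1)" by auto
  then have "ang_diff hbar a b (mon []) = (\<lambda>x. 0 * mon [] x)"
    by (simp add: ang_diff_const)
  then show ?case by (simp only: hpoly.word)
next
  case (Cons i ws)
  let ?c = "- \<i> * complex_of_real hbar"
  let ?d = "\<lambda>j::3. if i = j then 1 else (0::complex)"
  have "mon (i # ws) = (\<lambda>x. of_real (x $ i) * mon ws x)" by auto
  then have "ang_diff hbar a b (mon (i # ws)) =
      (\<lambda>x. of_real (x $ i) * ang_diff hbar a b (mon ws) x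
        + ang_diff hbar a b (\<lambda>x. of_real (x $ i)) x * mon ws x)"
    by (simp add: ang_diff_mult smooth_coord smooth_mon)
  also have "\<dots> = (\<lambda>x. of_real (x $ i) * ang_diff hbar a b (mon ws) x
        + (?c * ?d b * mon (a # ws) x + - ?c * ?d a * mon (b # ws) x))"
    by (simp add: ang_diff_coord fun_eq_iff algebra_simps)
  finally have ang: "ang_diff hbar a b (mon (i # ws)) = \<dots>" .
  show ?case
    unfolding ang length_Cons by (intro hpoly.add hpoly_coord hpoly.word Cons) simp_all
qed

lemma hpoly_ang_diff: "hpoly n f \<Longrightarrow> hpoly n (ang_diff hbar a b f)"
proof (induction rule: hpoly.induct)
  case (word ws c)
  then show ?case
    using hpoly_cmult[OF hpoly_ang_diff_mon] by (auto simp: ang_diff_cmult smooth_mon)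
next
  case (add f g)
  then show ?case
    by (simp add: ang_diff_add hpoly_smooth hpoly.add)
qed

lemma ang_diff_radial_bump: "ang_diff hbar a b (bump p R 0) = (\<lambda>_. 0)"
  by (simp add: ang_diff_bump)

lemma test_function_hpoly_bump: "hpoly n f \<Longrightarrow> R \<ge> 0 \<Longrightarrow> test_function (\<lambda>x. f x * bump 1 R 0 x)"
  by (intro test_function_mult hpoly_smooth test_function_bump)

text \<open>The bump makes polynomials square integrable. Being radial, it is annihilated by the
  operators, which therefore act on the polynomial factor alone.\<close>

definition hspace :: "nat \<Rightarrow> real \<Rightarrow> l2 set" where
  "hspace n R = {abs_l2 (\<lambda>x. f x * bump 1 R 0 x) | f. hpoly n f}"

lemma hspaceI: "hpoly n f \<Longrightarrow> abs_l2 (\<lambda>x. f x * bump 1 R 0 x) \<in> hspace n R"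
  by (auto simp: hspace_def)

lemma subspace_hspace:
  assumes R: "R \<ge> 0"
  shows "subspace (hspace n R)"
  unfolding subspace_def
proof (intro conjI ballI allI)
  have "hpoly n (\<lambda>x. 0 * mon (replicate n 1) x)"
    by (rule hpoly.word) simp
  from hspaceI[OF this] show "0 \<in> hspace n R"
    by (simp add: abs_l2_zero)
next
  fix u v assume "u \<in> hspace n R" "v \<in> hspace n R"
  then obtain f g where f: "hpoly n f" "u = abs_l2 (\<lambda>x. f x * bump 1 R 0 x)"
    and g: "hpoly n g" "v = abs_l2 (\<lambda>x. g x * bump 1 R 0 x)"
    by (auto simp: hspace_def)
  have "u + v = abs_l2 (\<lambda>x. (f x + g x) * bump 1 R 0 x)"
    using f g R by (simp add: abs_l2_add test_function_square_integrable test_function_hpoly_bump distrib_right)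
  then show "u + v \<in> hspace n R"
    using hspaceI[OF hpoly.add[OF f(1) g(1)]] by simp
next
  fix c :: real and u assume "u \<in> hspace n R"
  then obtain f where f: "hpoly n f" "u = abs_l2 (\<lambda>x. f x * bump 1 R 0 x)"
    by (auto simp: hspace_def)
  have "c *\<^sub>R u = abs_l2 (\<lambda>x. (of_real c * f x) * bump 1 R 0 x)"
    using f R by (simp add: abs_l2_scaleR test_function_square_integrable test_function_hpoly_bump
        scaleR_conv_of_real mult.assoc)
  then show "c *\<^sub>R u \<in> hspace n R"
    using hspaceI[OF hpoly_cmult[OF f(1)]] by simp
qed

lemma hspace_finite_span:
  assumes R: "R \<ge> 0"
  obtains B where "finite B" "hspace n R = span B"
proof
  \<comment> \<open>Spans are real, so every word occurs with both coefficients 1 and i.\<close>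
  let ?w = "\<lambda>(c, ws). abs_l2 (\<lambda>x. (c * mon ws x) * bump 1 R 0 x)"
  let ?B = "?w ` ({1, \<i>} \<times> {ws. set ws \<subseteq> UNIV \<and> length ws = n})"
  show "finite ?B"
    by (intro finite_imageI finite_cartesian_product finite_lists_length_eq) auto
  have "?B \<subseteq> hspace n R"
    by (auto intro!: hspaceI hpoly.word)
  moreover have "u \<in> span ?B" if u: "u \<in> hspace n R" for u
  proof -
    obtain f where f: "hpoly n f" "u = abs_l2 (\<lambda>x. f x * bump 1 R 0 x)"
      using u by (auto simp: hspace_def)
    have "abs_l2 (\<lambda>x. f x * bump 1 R 0 x) \<in> span ?B"
      using f(1)
    proof (induction rule: hpoly.induct)
      case (word ws c)
      let ?t = "\<lambda>c. \<lambda>x. (c * mon ws x) * bump 1 R 0 x"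
      have sq: "square_integrable (?t c)" for c
        by (intro test_function_square_integrable test_function_hpoly_bump[OF hpoly.word[OF word] R])
      have c: "c = of_real (Re c) + of_real (Im c) * \<i>"
        by (simp add: complex_eq_iff)
      have "?t c = (\<lambda>x. of_real (Re c) * ?t 1 x + of_real (Im c) * ?t \<i> x)"
        by (rule ext, subst c) (simp add: algebra_simps)
      then have "abs_l2 (?t c) = Re c *\<^sub>R abs_l2 (?t 1) + Im c *\<^sub>R abs_l2 (?t \<i>)"
        using sq[of 1] sq[of \<i>]
        by (simp add: abs_l2_scaleR abs_l2_add square_integrable_scaleR flip: scaleR_conv_of_real)
      moreover have "abs_l2 (?t 1) \<in> ?B" "abs_l2 (?t \<i>) \<in> ?B"
        using word by force+
      ultimately show ?case
        by (simp only: span_add span_mul span_base)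
    next
      case (add f g)
      have "abs_l2 (\<lambda>x. (f x + g x) * bump 1 R 0 x)
          = abs_l2 (\<lambda>x. f x * bump 1 R 0 x) + abs_l2 (\<lambda>x. g x * bump 1 R 0 x)"
        using add.hyps R by (simp add: abs_l2_add test_function_square_integrable test_function_hpoly_bump distrib_right)
      with add.IH show ?case by (simp only: span_add)
    qed
    then show ?thesis using f by simp
  qed
  ultimately show "hspace n R = span ?B"
    using span_minimal[OF _ subspace_hspace[OF R]] by blast
qed

lemma hspace_ang_op:
  assumes "u \<in> hspace n R" "R \<ge> 0"
  shows "\<exists>w\<in>hspace n R. (u, w) \<in> ang_op hbar a b"
proof -
  obtain f where f: "hpoly n f" "u = abs_l2 (\<lambda>x. f x * bump 1 R 0 x)"
    using assms by (auto simp: hspace_def)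
  have "ang_diff hbar a b (\<lambda>x. f x * bump 1 R 0 x) = (\<lambda>x. ang_diff hbar a b f x * bump 1 R 0 x)"
    using f(1) by (simp add: ang_diff_mult hpoly_smooth smooth_bump ang_diff_radial_bump)
  then have "(u, abs_l2 (\<lambda>x. ang_diff hbar a b f x * bump 1 R 0 x)) \<in> ang_op hbar a b"
    using ang_opI[OF test_function_hpoly_bump[OF f(1) assms(2)]] f(2) by metis
  then show ?thesis
    using hspaceI[OF hpoly_ang_diff[OF f(1)]] by blast
qed

definition ang_family :: "real \<Rightarrow> 3 \<Rightarrow> l2 operator" where
  "ang_family hbar j = (if j = 1 then L_x hbar else if j = 2 then L_y hbar else L_z hbar)"

lemma ang_family_cases: "\<exists>a b. a \<noteq> b \<and> ang_family hbar j = ang_op hbar a b"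
proof -
  have "(2::3) \<noteq> 3" "(3::3) \<noteq> 1" "(1::3) \<noteq> 2" by simp_all
  then show ?thesis
    unfolding ang_family_def L_x_def L_y_def L_z_def by metis
qed

interpretation ang: symmetric_family "ang_family hbar" for hbar
proof
  fix j
  obtain a b where "a \<noteq> b" "ang_family hbar j = ang_op hbar a b"
    using ang_family_cases by blast
  then show "subspace (ang_family hbar j)" "closed (ang_family hbar j)" "symmetric_op (ang_family hbar j)"
    by (simp_all add: subspace_ang_op closed_ang_op symmetric_ang_op)
qed

lemma hspace_ang_family:
  assumes "u \<in> hspace n R" "R \<ge> 0"
  shows "\<exists>w\<in>hspace n R. (u, w) \<in> ang_family hbar j"
  using hspace_ang_op[OF assms] ang_family_cases by metis

lemma hspace_S:
  assumes "u \<in> hspace n R" "R \<ge> 0"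
  shows "\<exists>w\<in>hspace n R. (u, w) \<in> ang.S hbar"
proof -
  have "\<exists>b\<in>hspace n R. (u, b) \<in> op_mult (ang_family hbar j) (ang_family hbar j)" for j
    using hspace_ang_family[OF _ assms(2)] assms(1) unfolding op_mult_def by (meson relcompI)
  then obtain b where b: "\<And>j. b j \<in> hspace n R"
    "\<And>j. (u, b j) \<in> op_mult (ang_family hbar j) (ang_family hbar j)"
    by metis
  have "(u, b 1 + b 2 + b 3) \<in> ang.S hbar"
    unfolding ang.S_def by (intro op_addI b)
  moreover have "b 1 + b 2 + b 3 \<in> hspace n R"
    by (intro subspace_add[OF subspace_hspace[OF assms(2)]] b)
  ultimately show ?thesis by blast
qed

text \<open>An injective endomorphism in finite dimension is onto. As G is a relation that may reach
  outside the span, a linear selection g is first built from a basis.\<close>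

lemma injective_graph_onto_span:
  fixes G :: "('a::real_vector \<times> 'a) set"
  assumes G: "subspace G" and B: "finite B"
    and total: "\<And>u. u \<in> span B \<Longrightarrow> \<exists>w\<in>span B. (u, w) \<in> G"
    and inj: "\<And>u. (u, 0) \<in> G \<Longrightarrow> u = 0"
    and v: "v \<in> span B"
  shows "\<exists>u\<in>span B. (u, v) \<in> G"
proof -
  obtain B' where B': "B' \<subseteq> B" "independent B'" "B \<subseteq> span B'"
    using maximal_independent_subset by blast
  have span: "span B' = span B"
    using B' by (metis span_mono span_span subset_antisym)
  have "\<forall>b\<in>B'. \<exists>w\<in>span B. (b, w) \<in> G"
    using total B'(1) span_base by blast
  then obtain A where A: "\<And>b. b \<in> B' \<Longrightarrow> A b \<in> span B \<and> (b, A b) \<in> G"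
    by metis
  obtain g where g: "linear g" "\<And>b. b \<in> B' \<Longrightarrow> g b = A b"
    using linear_independent_extend[OF B'(2), of A] by blast
  have graph: "g u \<in> span B \<and> (u, g u) \<in> G" if "u \<in> span B'" for u
    using that
  proof (induction rule: span_induct_alt)
    case base
    then show ?case
      using subspace_0[OF G] linear_0[OF g(1)] by (simp add: zero_prod_def span_zero)
  next
    case (step c x y)
    have "(c *\<^sub>R x + y, c *\<^sub>R g x + g y) \<in> G"
      using subspace_add[OF G subspace_mul[OF G, of "(x, g x)" c], of "(y, g y)"] step A g(2) by simp
    then show ?case
      using step A g by (simp add: linear_add linear_scale span_add span_mul)
  qed
  have injg: "inj_on g (span B')"
  proof (rule inj_onI)
    fix x y assume xy: "x \<in> span B'" "y \<in> span B'" "g x = g y"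
    have "x - y \<in> span B'" using xy by (simp add: span_diff)
    from graph[OF this] have "(x - y, 0) \<in> G"
      using xy(3) by (simp add: linear_diff[OF g(1)])
    then show "x = y" using inj by fastforce
  qed
  have ind: "independent (g ` B')"
    by (rule linear_independent_injective_image[OF g(1) B'(2) injg])
  have card: "card (g ` B') = card B'"
    by (rule card_image) (use injg inj_on_subset span_superset in blast)
  have fin: "finite B'"
    using B B'(1) finite_subset by blast
  have "v \<in> span (g ` B')"
  \<comment> \<open>A missed vector v would enlarge the independent image of the basis to more
    vectors than the dimension allows.\<close>
  proof (rule ccontr)
    assume notin: "v \<notin> span (g ` B')"
    then have "v \<notin> g ` B'"
      using span_base[of v "g ` B'"] by blast
    then have "card (insert v (g ` B')) = Suc (card B')"
      using fin card by simp
    moreover have "independent (insert v (g ` B'))"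
      using ind notin by (simp add: independent_insert)
    moreover have "insert v (g ` B') \<subseteq> span B'"
      using v graph span_base[of _ B'] unfolding span by blast
    ultimately show False
      using independent_span_bound[OF fin, of "insert v (g ` B')"] by simp
  qed
  then obtain u where "u \<in> span B'" "v = g u"
    unfolding linear_span_image[OF g(1)] by blast
  then show ?thesis
    using graph span by blast
qed

lemma hspace_onto:
  assumes "v \<in> hspace n R" "R \<ge> 0"
  shows "\<exists>u\<in>hspace n R. (u, v) \<in> op_add Id (ang.S hbar)"
proof -
  obtain B where B: "finite B" "hspace n R = span B"
    using hspace_finite_span[OF assms(2)] by blast
  have "\<exists>u\<in>span B. (u, v) \<in> op_add Id (ang.S hbar)"
  proof (rule injective_graph_onto_span[OF _ B(1)])
    show "subspace (op_add Id (ang.S hbar))"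
      by (intro subspace_op_add subspace_Id ang.subspace_S)
    show "v \<in> span B" using assms B by simp
  next
    fix u assume u: "u \<in> span B"
    then obtain w where w: "w \<in> hspace n R" "(u, w) \<in> ang.S hbar"
      using hspace_S[OF _ assms(2)] B(2) by blast
    have "(u, u + w) \<in> op_add Id (ang.S hbar)"
      using w(2) by (intro op_addI) auto
    moreover have "u + w \<in> span B"
      using u w(1) B(2) by (simp add: span_add)
    ultimately show "\<exists>w\<in>span B. (u, w) \<in> op_add Id (ang.S hbar)" by blast
  next
    \<comment> \<open>The pair (u, -u) lies in S, and positivity gives 0 \<le> -|u|^2.\<close>
    fix u assume "(u, 0) \<in> op_add Id (ang.S hbar)"
    then have "(u, - u) \<in> ang.S hbar"
      by (auto simp: op_add_def add_eq_0_iff2 minus_equation_iff)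
    from ang.S_nonneg[OF this] show "u = 0"
      by (metis inner_eq_zero_iff inner_ge_zero inner_minus_left neg_0_le_iff_le order_antisym)
  qed
  then show ?thesis using B(2) by simp
qed

section \<open>Arbitrary polynomials, as supplied by Stone-Weierstrass\<close>

inductive poly3 :: "(real^3 \<Rightarrow> complex) \<Rightarrow> bool" where
  word: "poly3 (\<lambda>x. c * mon ws x)"
| add: "poly3 f \<Longrightarrow> poly3 g \<Longrightarrow> poly3 (\<lambda>x. f x + g x)"

lemma poly3_smooth: "poly3 f \<Longrightarrow> smooth f"
  by (induction rule: poly3.induct) (auto intro: smooth_add smooth_mult smooth_const smooth_mon)

lemma mon_append: "mon (ws @ vs) x = mon ws x * mon vs x"
  by (induction ws) auto

lemma poly3_mult: "poly3 f \<Longrightarrow> poly3 g \<Longrightarrow> poly3 (\<lambda>x. f x * g x)"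
proof (induction rule: poly3.induct)
  case (word c ws)
  from word show ?case
  proof (induction rule: poly3.induct)
    case (word c' vs)
    then show ?case
      using poly3.word[of "c * c'" "ws @ vs"] by (simp add: mon_append mult_ac)
  next
    case (add f g)
    then show ?case
      using poly3.add[of "\<lambda>x. c * mon ws x * f x" "\<lambda>x. c * mon ws x * g x"] by (simp add: distrib_left)
  qed
next
  case (add f h)
  then show ?case
    using poly3.add[of "\<lambda>x. f x * g x" "\<lambda>x. h x * g x"] by (simp add: distrib_right)
qed

lemma poly3_const: "poly3 (\<lambda>x. c)"
  using poly3.word[of c "[]"] by simp

lemma poly3_real_polynomial:
  assumes "real_polynomial_function f"
  shows "poly3 (\<lambda>x. of_real (f x))"
  using assms
proof (induction rule: real_polynomial_function.induct)
  case (linear f)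
  define k where "k i = f (axis i 1)" for i
  have f: "f x = (\<Sum>i\<in>UNIV. k i * x $ i)" for x
  proof -
    have "f x = f (\<Sum>i\<in>UNIV. x $ i *\<^sub>R axis i 1)"
      by (simp add: basis_expansion scalar_mult_eq_scaleR[symmetric])
    also have "\<dots> = (\<Sum>i\<in>UNIV. k i * x $ i)"
      using linear by (simp add: k_def linear_sum bounded_linear.linear linear_scale mult.commute)
    finally show ?thesis .
  qed
  have *: "(\<lambda>x. complex_of_real (f x)) =
      (\<lambda>x. of_real (k 1) * mon [1] x + of_real (k 2) * mon [2] x + of_real (k 3) * mon [3] x)"
    by (simp add: f sum_3 fun_eq_iff)
  show ?case
    unfolding * by (intro poly3.intros)
qed (auto intro: poly3_const poly3.add poly3_mult)

lemma poly3_polynomial_function: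
  assumes "polynomial_function p"
  shows "poly3 p"
proof -
  have "real_polynomial_function (Re \<circ> p)" "real_polynomial_function (Im \<circ> p)"
    using assms bounded_linear_Re bounded_linear_Im unfolding polynomial_function_def by blast+
  then have "poly3 (\<lambda>x. of_real ((Re \<circ> p) x) + \<i> * of_real ((Im \<circ> p) x))"
    by (intro poly3.add poly3_mult poly3_const poly3_real_polynomial)
  moreover have "(\<lambda>x. of_real ((Re \<circ> p) x) + \<i> * of_real ((Im \<circ> p) x)) = p"
    by (simp add: fun_eq_iff complex_eq_iff)
  ultimately show ?thesis by simp
qed

text \<open>Every monomial is homogeneous, so sums of elements of the spaces
  \<open>hspace n R\<close> exhaust all polynomials times the bump.\<close>

lemma poly3_bump_induct:
  assumes poly: "poly3 f" and R: "R \<ge> 0" and W: "subspace W" "\<And>n. hspace n R \<subseteq> W"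
  shows "abs_l2 (\<lambda>x. f x * bump 1 R 0 x) \<in> W"
  using poly
proof (induction rule: poly3.induct)
  case (word c ws)
  then show ?case
    using hspaceI[OF hpoly.word[OF refl]] W(2) by blast
next
  case (add f g)
  have "square_integrable (\<lambda>x. f x * bump 1 R 0 x)" "square_integrable (\<lambda>x. g x * bump 1 R 0 x)"
    using add.hyps R by (auto intro!: test_function_square_integrable test_function_mult poly3_smooth test_function_bump)
  then have "abs_l2 (\<lambda>x. (f x + g x) * bump 1 R 0 x)
      = abs_l2 (\<lambda>x. f x * bump 1 R 0 x) + abs_l2 (\<lambda>x. g x * bump 1 R 0 x)"
    by (simp add: abs_l2_add distrib_right)
  with add.IH show ?case
    by (simp only: subspace_add[OF W(1)])
qed

section \<open>Density and essential self-adjointness\<close>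

lemma abs_l2_dominated_convergence:
  fixes f :: "nat \<Rightarrow> real^3 \<Rightarrow> complex"
  assumes meas: "\<And>n. f n \<in> borel_measurable borel" "g \<in> borel_measurable borel"
    and lim: "AE x in lborel. (\<lambda>n. f n x) \<longlonglongrightarrow> g x"
    and bound: "\<And>n x. norm (f n x) \<le> w x"
    and w: "w \<in> borel_measurable borel" "integrable lborel (\<lambda>x. (w x)\<^sup>2)"
  shows "square_integrable (f n)" "square_integrable g" "(\<lambda>n. abs_l2 (f n)) \<longlonglongrightarrow> abs_l2 g"
proof -
  have w0: "0 \<le> w x" for x
    using bound[of 0 x] norm_ge_zero order_trans by blast
  have g_bound: "AE x in lborel. norm (g x) \<le> w x"
    using lim by (rule eventually_mono) (auto intro!: LIMSEQ_le_const2[OF tendsto_norm] bound)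
  show sf: "square_integrable (f n)" for n
    unfolding square_integrable_def
  proof
    show "f n \<in> borel_measurable lborel" using meas by simp
    have "AE x in lborel. norm ((norm (f n x))\<^sup>2) \<le> norm ((w x)\<^sup>2)"
      using bound by (auto intro!: power_mono)
    then show "integrable lborel (\<lambda>x. (norm (f n x))\<^sup>2)"
      using meas by (intro Bochner_Integration.integrable_bound[OF w(2)]) auto
  qed
  show sg: "square_integrable g"
    unfolding square_integrable_def
  proof
    show "g \<in> borel_measurable lborel" using meas by simp
    have "AE x in lborel. norm ((norm (g x))\<^sup>2) \<le> norm ((w x)\<^sup>2)"
      using g_bound by (rule eventually_mono) (auto intro!: power_mono)
    then show "integrable lborel (\<lambda>x. (norm (g x))\<^sup>2)"
      using meas by (intro Bochner_Integration.integrable_bound[OF w(2)]) auto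
  qed
  have "(\<lambda>n. \<integral>x. (norm (f n x - g x))\<^sup>2 \<partial>lborel) \<longlonglongrightarrow> (\<integral>x. 0 \<partial>(lborel :: (real^3) measure))"
  proof (rule integral_dominated_convergence)
    show "AE x in lborel. (\<lambda>n. (norm (f n x - g x))\<^sup>2) \<longlonglongrightarrow> 0"
      using lim
    proof (rule eventually_mono)
      fix x assume "(\<lambda>n. f n x) \<longlonglongrightarrow> g x"
      then have "(\<lambda>n. (norm (f n x - g x))\<^sup>2) \<longlonglongrightarrow> (norm (g x - g x))\<^sup>2"
        by (intro tendsto_intros)
      then show "(\<lambda>n. (norm (f n x - g x))\<^sup>2) \<longlonglongrightarrow> 0" by simp
    qed
    show "AE x in lborel. norm ((norm (f n x - g x))\<^sup>2) \<le> (2 * w x)\<^sup>2" for n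
      using g_bound
    proof (rule eventually_mono)
      fix x assume "norm (g x) \<le> w x"
      then have "norm (f n x - g x) \<le> 2 * w x"
        using bound[of n x] norm_triangle_ineq4[of "f n x" "g x"] by linarith
      then have "(norm (f n x - g x))\<^sup>2 \<le> (2 * w x)\<^sup>2"
        by (rule power_mono) simp
      then show "norm ((norm (f n x - g x))\<^sup>2) \<le> (2 * w x)\<^sup>2"
        by simp
    qed
    show "integrable lborel (\<lambda>x. (2 * w x)\<^sup>2)"
      using w(2) by (simp add: power_mult_distrib)
  qed (use meas in auto)
  then have "(\<lambda>n. (norm (abs_l2 (f n) - abs_l2 g))\<^sup>2) \<longlonglongrightarrow> 0"
    using sf sg by (simp add: abs_l2_diff norm_abs_l2 square_integrable_diff)
  then have "(\<lambda>n. sqrt ((norm (abs_l2 (f n) - abs_l2 g))\<^sup>2)) \<longlonglongrightarrow> sqrt 0"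
    by (rule tendsto_real_sqrt)
  then have "(\<lambda>n. norm (abs_l2 (f n) - abs_l2 g)) \<longlonglongrightarrow> 0"
    by simp
  then show "(\<lambda>n. abs_l2 (f n)) \<longlonglongrightarrow> abs_l2 g"
    using tendsto_norm_zero_iff LIM_zero_iff by blast
qed



text \<open>Polynomials approximate h uniformly on the ball only; outside it the bump removes
  whatever they do.\<close>

lemma continuous_bump_in_closure:
  assumes W: "closed W" "\<And>f. poly3 f \<Longrightarrow> abs_l2 (\<lambda>x. f x * bump 1 R 0 x) \<in> W"
    and R: "R \<ge> 0" and h: "continuous_on UNIV h"
  shows "abs_l2 (\<lambda>x. h x * bump 1 R 0 x) \<in> W"
proof -
  have "\<exists>p. polynomial_function p \<and> (\<forall>x\<in>cball 0 R. norm (h x - p x) < inverse (Suc n))" for n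
    by (rule Stone_Weierstrass_polynomial_function) (use continuous_on_subset[OF h] in auto)
  then obtain p where p: "\<And>n. polynomial_function (p n)"
    "\<And>n x. x \<in> cball 0 R \<Longrightarrow> norm (h x - p n x) < inverse (Suc n)"
    by metis
  have p3: "poly3 (p n)" for n
    by (rule poly3_polynomial_function[OF p(1)])
  have cb: "continuous_on UNIV (bump 1 R 0)"
    by (rule smooth_continuous[OF smooth_bump])
  \<comment> \<open>The approximation errors are below 1 on the ball, whence the summand 1.\<close>
  let ?w = "\<lambda>x. (norm (h x) + 1) * norm (bump 1 R 0 x)"
  have cw: "continuous_on UNIV ?w"
    by (intro continuous_intros h cb)
  have out: "bump 1 R 0 x = 0" if "x \<notin> cball 0 R" for x
    using bump_outside[OF R, of x 0] that by simp
  have "(\<lambda>n. abs_l2 (\<lambda>x. p n x * bump 1 R 0 x)) \<longlonglongrightarrow> abs_l2 (\<lambda>x. h x * bump 1 R 0 x)"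
  proof (rule abs_l2_dominated_convergence(3))
    show "(\<lambda>x. p n x * bump 1 R 0 x) \<in> borel_measurable borel" for n
      by (intro borel_measurable_continuous_onI continuous_intros cb smooth_continuous poly3_smooth p3)
    show "(\<lambda>x. h x * bump 1 R 0 x) \<in> borel_measurable borel"
      by (intro borel_measurable_continuous_onI continuous_intros cb h)
    show "AE x in lborel. (\<lambda>n. p n x * bump 1 R 0 x) \<longlonglongrightarrow> h x * bump 1 R 0 x"
    proof (rule AE_I2)
      fix x
      show "(\<lambda>n. p n x * bump 1 R 0 x) \<longlonglongrightarrow> h x * bump 1 R 0 x"
      proof (cases "x \<in> cball 0 R")
        case True
        have "(\<lambda>n. h x - p n x) \<longlonglongrightarrow> 0"
          by (rule Lim_null_comparison[OF _ LIMSEQ_inverse_real_of_nat])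
            (use p(2)[OF True] in \<open>auto intro!: always_eventually less_imp_le\<close>)
        from tendsto_diff[OF tendsto_const[of "h x"] this] have "(\<lambda>n. p n x) \<longlonglongrightarrow> h x"
          by simp
        then show ?thesis by (intro tendsto_intros)
      qed (simp add: out)
    qed
    show "norm (p n x * bump 1 R 0 x) \<le> ?w x" for n x
    proof (cases "x \<in> cball 0 R")
      case True
      have "inverse (real (Suc n)) \<le> 1" by (simp add: field_simps)
      then have "norm (p n x) \<le> norm (h x) + 1"
        using p(2)[OF True, of n] norm_triangle_ineq3[of "h x" "p n x"] by linarith
      then show ?thesis by (simp add: norm_mult mult_right_mono)
    qed (simp add: out)
    show "?w \<in> borel_measurable borel"
      by (rule borel_measurable_continuous_onI[OF cw])
    show "integrable lborel (\<lambda>x. (?w x)\<^sup>2)"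
    proof (rule integrable_continuous_bounded_support)
      show "continuous_on UNIV (\<lambda>x. (?w x)\<^sup>2)"
        by (intro continuous_intros cw)
      have "{x. (?w x)\<^sup>2 \<noteq> 0} \<subseteq> cball 0 R"
        by (rule subsetI, rule ccontr) (simp add: out del: mem_cball)
      then show "bounded {x. (?w x)\<^sup>2 \<noteq> 0}"
        using bounded_subset bounded_cball by blast
    qed
  qed
  then show ?thesis
    by (rule closed_sequentially[OF W(1) W(2)[OF p3]])
qed

text \<open>Continuous retraction onto the disc of radius K. It bounds continuous approximants
  uniformly without losing their limit.\<close>

definition truncate :: "real \<Rightarrow> complex \<Rightarrow> complex" where
  "truncate K z = of_real (K / max K (norm z)) * z"

lemma truncate_norm_le: "K > 0 \<Longrightarrow> norm (truncate K z) \<le> K"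
  by (simp add: truncate_def norm_mult norm_divide field_simps max_def)

lemma truncate_id: "K > 0 \<Longrightarrow> norm z \<le> K \<Longrightarrow> truncate K z = z"
  by (simp add: truncate_def max_def)

lemma continuous_on_truncate: "K > 0 \<Longrightarrow> continuous_on UNIV (truncate K)"
  unfolding truncate_def by (intro continuous_intros) (auto simp: max_def)

text \<open>This is how \<open>measurable_on\<close> is defined; the work is to pass from Borel to
  Lebesgue measurability and back to \<open>lborel\<close>.\<close>

lemma AE_limit_of_continuous:
  fixes k :: "real^3 \<Rightarrow> complex"
  assumes "k \<in> borel_measurable borel"
  obtains h where "\<And>n. continuous_on UNIV (h n)" "AE x in lborel. (\<lambda>n. h n x) \<longlonglongrightarrow> k x"
proof -
  have "k \<in> borel_measurable (lebesgue_on UNIV)"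
    using measurable_completion[of k lborel borel] assms by (simp add: lebesgue_on_UNIV_eq)
  then have "k measurable_on UNIV"
    by (simp add: measurable_on_iff_borel_measurable)
  then obtain N h where *: "negligible N \<and> (\<forall>n. continuous_on UNIV (h n)) \<and>
      (\<forall>x. x \<notin> N \<longrightarrow> (\<lambda>n. h n x) \<longlonglongrightarrow> (if x \<in> UNIV then k x else 0))"
    unfolding measurable_on_def by (elim exE) (rule that)
  then have N: "negligible N" and h: "\<And>n. continuous_on UNIV (h n)"
    "\<And>x. x \<notin> N \<Longrightarrow> (\<lambda>n. h n x) \<longlonglongrightarrow> k x"
    by simp_all
  have "AE x in lebesgue. (\<lambda>n. h n x) \<longlonglongrightarrow> k x"
    by (rule AE_I'[of N]) (use N h(2) in \<open>auto simp: negligible_iff_null_sets\<close>)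
  then have "AE x in lborel. (\<lambda>n. h n x) \<longlonglongrightarrow> k x"
    by (simp add: AE_completion_iff)
  with h(1) show ?thesis by (rule that)
qed

text \<open>On a slightly larger ball the bump is bounded below on the ball of radius r outside
  which f vanishes, so f is k times the bump with k bounded and measurable. Truncated continuous
  approximants of k then converge dominatedly.\<close>

lemma bounded_measurable_in_closure:
  assumes W: "closed W" "\<And>f R. poly3 f \<Longrightarrow> R \<ge> 0 \<Longrightarrow> abs_l2 (\<lambda>x. f x * bump 1 R 0 x) \<in> W"
    and f: "f \<in> borel_measurable borel" "\<And>x. norm (f x) \<le> K" "\<And>x. r < norm x \<Longrightarrow> f x = 0"
    and r: "r \<ge> 0"
  shows "abs_l2 f \<in> W"
proof -
  define R where "R = r + 1"
  have R: "R \<ge> 0" "r < R" using r by (simp_all add: R_def)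
  define m where "m = R\<^sup>2 - r\<^sup>2"
  have m: "m > 0"
    using R r by (simp add: m_def power_strict_mono)
  have bump_ge: "exp (- inverse m) \<le> norm (bump 1 R 0 x)" if "norm x \<le> r" for x
  proof -
    have "m \<le> R\<^sup>2 - (norm x)\<^sup>2"
      using that by (simp add: m_def power_mono)
    then show ?thesis
      using m by (simp add: bump_def flat_def le_imp_inverse_le)
  qed
  define k where "k x = f x / bump 1 R 0 x" for x
  \<comment> \<open>Bound of |f| over minimum of the bump; \<open>\<bar>K\<bar> + 1\<close> ensures
    a positive truncation level.\<close>
  define K' where "K' = (\<bar>K\<bar> + 1) / exp (- inverse m)"
  have K': "K' > 0" by (simp add: K'_def)
  have k_bound: "norm (k x) \<le> K'" for x
  proof (cases "norm x \<le> r")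
    case True
    have "norm (f x) / norm (bump 1 R 0 x) \<le> (\<bar>K\<bar> + 1) / exp (- inverse m)"
      using f(2)[of x] bump_ge[OF True] by (intro frac_le) auto
    then show ?thesis by (simp add: k_def K'_def norm_divide)
  next
    case False
    then show ?thesis using f(3)[of x] K' by (simp add: k_def)
  qed
  have k_bump: "k x * bump 1 R 0 x = f x" for x
  proof (cases "norm x \<le> r")
    case True
    then have "bump 1 R 0 x \<noteq> 0"
      using bump_ge[OF True] by (metis exp_gt_zero norm_zero not_le)
    then show ?thesis by (simp add: k_def)
  next
    case False
    then show ?thesis using f(3)[of x] by (simp add: k_def)
  qed
  have cb: "continuous_on UNIV (bump 1 R 0)"
    by (rule smooth_continuous[OF smooth_bump])
  have mb: "bump 1 R 0 \<in> borel_measurable borel"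
    by (rule borel_measurable_continuous_onI[OF cb])
  have "k \<in> borel_measurable borel"
    unfolding k_def using f(1) mb by measurable
  then obtain h where h: "\<And>n. continuous_on UNIV (h n)" "AE x in lborel. (\<lambda>n. h n x) \<longlonglongrightarrow> k x"
    using AE_limit_of_continuous by blast
  define g where "g n x = truncate K' (h n x)" for n x
  have cg: "continuous_on UNIV (g n)" for n
    unfolding g_def by (rule continuous_on_compose2[OF continuous_on_truncate[OF K'] h(1)]) simp
  have "(\<lambda>n. abs_l2 (\<lambda>x. g n x * bump 1 R 0 x)) \<longlonglongrightarrow> abs_l2 f"
  proof (rule abs_l2_dominated_convergence(3))
    show "(\<lambda>x. g n x * bump 1 R 0 x) \<in> borel_measurable borel" for n
      by (intro borel_measurable_continuous_onI continuous_intros cb cg)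
    show "f \<in> borel_measurable borel" by (rule f(1))
    show "AE x in lborel. (\<lambda>n. g n x * bump 1 R 0 x) \<longlonglongrightarrow> f x"
      using h(2)
    proof (rule eventually_mono)
      fix x assume lim: "(\<lambda>n. h n x) \<longlonglongrightarrow> k x"
      have "isCont (truncate K') (k x)"
        using continuous_on_truncate[OF K'] by (simp add: continuous_on_eq_continuous_at)
      from isCont_tendsto_compose[OF this lim] have "(\<lambda>n. g n x) \<longlonglongrightarrow> truncate K' (k x)"
        unfolding g_def .
      then have "(\<lambda>n. g n x) \<longlonglongrightarrow> k x"
        using truncate_id[OF K' k_bound] by simp
      then have "(\<lambda>n. g n x * bump 1 R 0 x) \<longlonglongrightarrow> k x * bump 1 R 0 x"
        by (intro tendsto_intros)
      then show "(\<lambda>n. g n x * bump 1 R 0 x) \<longlonglongrightarrow> f x"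
        by (simp only: k_bump)
    qed
    show "norm (g n x * bump 1 R 0 x) \<le> K' * norm (bump 1 R 0 x)" for n x
      unfolding norm_mult g_def by (intro mult_right_mono truncate_norm_le K') simp
    show "(\<lambda>x. K' * norm (bump 1 R 0 x)) \<in> borel_measurable borel"
      using mb by measurable
    show "integrable lborel (\<lambda>x. (K' * norm (bump 1 R 0 x))\<^sup>2)"
      using test_function_square_integrable[OF test_function_bump[OF R(1)], of 1 0]
      by (simp add: power_mult_distrib square_integrable_def)
  qed
  moreover have "abs_l2 (\<lambda>x. g n x * bump 1 R 0 x) \<in> W" for n
    by (rule continuous_bump_in_closure[OF W(1) _ R(1) cg]) (rule W(2)[OF _ R(1)])
  ultimately show ?thesis
    using closed_sequentially[OF W(1), of "\<lambda>n. abs_l2 (\<lambda>x. g n x * bump 1 R 0 x)"] by blast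
qed

text \<open>Cutting f off at level n, both in space and in value, reduces to the bounded case.
  Applied below to the closures of the domain of S and of the range of 1 + S.\<close>

lemma closed_contains_l2:
  assumes W: "closed W" "\<And>f R. poly3 f \<Longrightarrow> R \<ge> 0 \<Longrightarrow> abs_l2 (\<lambda>x. f x * bump 1 R 0 x) \<in> W"
  shows "u \<in> W"
proof -
  obtain f where f: "square_integrable f" "u = abs_l2 f"
    using l2_cases by blast
  have meas [measurable]: "f \<in> borel_measurable borel"
    using f(1) by (simp add: square_integrable_def)
  define g where "g n x = (if norm x \<le> real n \<and> norm (f x) \<le> real n then f x else 0)" for n x
  have g_meas: "g n \<in> borel_measurable borel" for n
    unfolding g_def by measurable
  have "abs_l2 (g n) \<in> W" for n
    by (rule bounded_measurable_in_closure[OF W g_meas, of n "real n" "real n"]) (auto simp: g_def)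
  moreover have "(\<lambda>n. abs_l2 (g n)) \<longlonglongrightarrow> abs_l2 f"
  proof (rule abs_l2_dominated_convergence(3)[OF g_meas meas])
    show "AE x in lborel. (\<lambda>n. g n x) \<longlonglongrightarrow> f x"
    proof (rule AE_I2)
      fix x
      obtain N where N: "max (norm x) (norm (f x)) \<le> real N"
        using real_arch_simple by blast
      have "g n x = f x" if "n \<ge> N" for n
        using N that by (auto simp: g_def)
      then show "(\<lambda>n. g n x) \<longlonglongrightarrow> f x"
        by (intro tendsto_eventually) (auto simp: eventually_sequentially)
    qed
    show "norm (g n x) \<le> norm (f x)" for n x
      by (simp add: g_def)
    show "integrable lborel (\<lambda>x. (norm (f x))\<^sup>2)"
      using f(1) by (simp add: square_integrable_def)
  qed simp
  ultimately show ?thesis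
    unfolding f(2) using closed_sequentially[OF W(1), of "\<lambda>n. abs_l2 (g n)"] by blast
qed

lemma symmetric_triple_ang_family: "symmetric_triple (ang_family hbar)"
proof
  have sub: "subspace (op_add Id (ang.S hbar))"
    by (intro subspace_op_add subspace_Id ang.subspace_S)
  have range: "Range (op_add Id (ang.S hbar)) = snd ` op_add Id (ang.S hbar)"
    "Domain (ang.S hbar) = fst ` ang.S hbar"
    by (auto simp: Range_snd Domain_fst)
  have W1: "subspace (Range (op_add Id (ang.S hbar)))"
    unfolding range by (intro linear_subspace_image linear_snd sub)
  have W2: "subspace (Domain (ang.S hbar))"
    unfolding range by (intro linear_subspace_image linear_fst ang.subspace_S)
  have "u \<in> closure (Domain (ang.S hbar))" for u
  proof (rule closed_contains_l2)
    fix f and R :: real assume fR: "poly3 f" "R \<ge> 0"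
    have "hspace n R \<subseteq> Domain (ang.S hbar)" for n
      using hspace_S[OF _ fR(2)] by blast
    then show "abs_l2 (\<lambda>x. f x * bump 1 R 0 x) \<in> closure (Domain (ang.S hbar))"
      using poly3_bump_induct[OF fR W2] closure_subset by blast
  qed simp
  then show "closure (Domain (ang.S hbar)) = UNIV" by blast
  have "u \<in> closure (Range (op_add Id (ang.S hbar)))" for u
  proof (rule closed_contains_l2)
    fix f and R :: real assume fR: "poly3 f" "R \<ge> 0"
    have "hspace n R \<subseteq> Range (op_add Id (ang.S hbar))" for n
      using hspace_onto[OF _ fR(2)] by blast
    then show "abs_l2 (\<lambda>x. f x * bump 1 R 0 x) \<in> closure (Range (op_add Id (ang.S hbar)))"
      using poly3_bump_induct[OF fR W1] closure_subset by blast
  qed simp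
  then show "closure (Range (op_add Id (ang.S hbar))) = UNIV" by blast
qed

section \<open>Coherent states and the synthetic spectrum\<close>

text \<open>If the class were 0, the closed zero set would have full measure and thus contain the
  origin, where the bump is positive.\<close>

lemma abs_l2_bump_nonzero:
  assumes "s > 0"
  shows "abs_l2 (bump 1 s 0) \<noteq> 0"
proof
  assume zero: "abs_l2 (bump 1 s 0) = 0"
  have sq: "square_integrable (bump 1 s 0)"
    using assms by (intro test_function_square_integrable test_function_bump) simp
  have "(\<integral>x. (norm (bump 1 s 0 x))\<^sup>2 \<partial>lborel) = 0"
    using zero norm_abs_l2[OF sq] by simp
  then have "AE x in lborel. (norm (bump 1 s 0 x))\<^sup>2 = 0"
    using sq by (subst (asm) integral_nonneg_eq_0_iff_AE) (auto simp: square_integrable_def)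
  then have "AE x in lebesgue. x \<in> {x. bump 1 s 0 x = 0}"
    by (intro AE_completion) simp
  moreover have "closed {x. bump 1 s 0 x = 0}"
    using continuous_closed_vimage[of "{0}" "bump 1 s 0"] smooth_continuous[OF smooth_bump, of 1 s 0]
    by (simp add: continuous_on_eq_continuous_at vimage_def)
  ultimately have "(0 :: real^3) \<in> {x. bump 1 s 0 x = 0}"
    by (intro mem_closed_if_AE_lebesgue)
  then show False
    using flat_1_pos[of "s\<^sup>2"] assms by (simp add: bump_def)
qed

lemma integral_bump_translate:
  "(\<integral>x. (norm (bump p s x0 x))\<^sup>2 \<partial>lborel) = (\<integral>x. (norm (bump p s 0 x))\<^sup>2 \<partial>lborel)"
  using lborel_translate(1)[of "\<lambda>x. (norm (bump p s 0 x))\<^sup>2" "- x0"] by (simp add: bump_def)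

definition coherent :: "real^3 \<Rightarrow> real \<Rightarrow> real^3 \<Rightarrow> real^3 \<Rightarrow> complex" where
  "coherent b s x0 x = phase b x * bump 1 s x0 x"

lemma test_function_coherent: "s \<ge> 0 \<Longrightarrow> test_function (coherent b s x0)"
  unfolding coherent_def[abs_def] by (intro test_function_mult smooth_phase test_function_bump)

lemma norm_coherent:
  assumes "s \<ge> 0"
  shows "norm (abs_l2 (coherent b s x0)) = norm (abs_l2 (bump 1 s 0))"
proof -
  have "(norm (abs_l2 (coherent b s x0)))\<^sup>2 = (norm (abs_l2 (bump 1 s 0)))\<^sup>2"
    using assms by (simp add: norm_abs_l2 test_function_square_integrable test_function_coherent
        test_function_bump coherent_def norm_mult integral_bump_translate[of 1 s x0])
  then show ?thesis by simp
qed

lemma abs_component_minor_le: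
  fixes x y :: "real^3"
  shows "\<bar>x $ a * y $ c - x $ c * y $ a\<bar> \<le> 2 * norm x * norm y"
proof -
  have "\<bar>x $ a * y $ c\<bar> \<le> norm x * norm y" "\<bar>x $ c * y $ a\<bar> \<le> norm x * norm y"
    unfolding abs_mult by (intro mult_mono component_le_norm_cart; simp)+
  then show ?thesis by linarith
qed

text \<open>Writing x = x0 + y, the classical value l cancels and two errors remain: the derivative
  of the bump, carrying hbar and x0 \<times> y, and the coefficient error y \<times> p. On the
  support |y| \<le> s bounds them by \<open>4 * \<bar>hbar\<bar> * s\<close> and
  \<open>2 * s * \<Lambda>\<close>, and the outer factors 2 come from (u + v)^2 \<le> 2 u^2 + 2
  v^2.\<close>

lemma coherent_estimate:
  assumes hbar: "hbar \<noteq> 0" and x0: "norm x0 = 1" and p: "norm p \<le> \<Lambda>" and s: "s > 0"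
    and l: "l = x0 $ a * p $ c - x0 $ c * p $ a"
  defines "\<phi> \<equiv> coherent ((1 / hbar) *\<^sub>R p) s x0"
  shows "(norm (abs_l2 (ang_diff hbar a c \<phi>) - l *\<^sub>R abs_l2 \<phi>))\<^sup>2 \<le>
    2 * (4 * \<bar>hbar\<bar> * s)\<^sup>2 * (norm (abs_l2 (bump (flat_deriv 1) s 0)))\<^sup>2
      + 2 * (2 * s * \<Lambda>)\<^sup>2 * (norm (abs_l2 (bump 1 s 0)))\<^sup>2"
proof -
  let ?b = "(1 / hbar) *\<^sub>R p"
  let ?B = "bump 1 s x0" and ?B' = "bump (flat_deriv 1) s x0"
  define f where "f x = ang_diff hbar a c \<phi> x - l *\<^sub>R \<phi> x" for x
  have \<phi>: "test_function \<phi>"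
    using s by (simp add: \<phi>_def test_function_coherent)
  have sq: "square_integrable \<phi>" "square_integrable (ang_diff hbar a c \<phi>)"
    by (intro test_function_square_integrable test_function_ang_diff \<phi>)+
  have sf: "square_integrable f"
    unfolding f_def by (intro square_integrable_diff square_integrable_scaleR sq)
  have pointwise: "norm (f x) \<le> (4 * \<bar>hbar\<bar> * s) * norm (?B' x) + (2 * s * \<Lambda>) * norm (?B x)" for x
  proof (cases "norm (x - x0) \<le> s")
    case True
    let ?y = "x - x0"
    have \<phi>_eq: "\<phi> = (\<lambda>x. phase ?b x * ?B x)"
      by (simp add: \<phi>_def coherent_def fun_eq_iff)
    have "ang_diff hbar a c \<phi> x = phase ?b x * ang_diff hbar a c ?B x + ang_diff hbar a c (phase ?b) x * ?B x"
      unfolding \<phi>_eq by (simp add: ang_diff_mult smooth_phase smooth_bump)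
    also have "ang_diff hbar a c (phase ?b) x = of_real (x $ a * p $ c - x $ c * p $ a) * phase ?b x"
    proof -
      have "hbar * (x $ a * ?b $ c - x $ c * ?b $ a) = x $ a * p $ c - x $ c * p $ a"
        using hbar by (simp add: field_simps)
      then show ?thesis
        by (simp only: ang_diff_phase of_real_mult[symmetric])
    qed
    also have "ang_diff hbar a c ?B x =
        2 * \<i> * of_real hbar * of_real (x0 $ a * ?y $ c - x0 $ c * ?y $ a) * ?B' x"
      by (simp add: ang_diff_bump)
    finally have "f x = phase ?b x * (2 * \<i> * of_real hbar * of_real (x0 $ a * ?y $ c - x0 $ c * ?y $ a) * ?B' x
        + of_real (?y $ a * p $ c - ?y $ c * p $ a) * ?B x)"
      by (simp add: f_def \<phi>_eq l scaleR_conv_of_real algebra_simps)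
    then have "norm (f x) \<le> norm (2 * \<i> * of_real hbar * of_real (x0 $ a * ?y $ c - x0 $ c * ?y $ a) * ?B' x)
        + norm (of_real (?y $ a * p $ c - ?y $ c * p $ a) * ?B x)"
      by (simp only: norm_mult[of "phase _ _"] norm_phase mult_1 norm_triangle_ineq)
    also have "norm (2 * \<i> * of_real hbar * of_real (x0 $ a * ?y $ c - x0 $ c * ?y $ a) * ?B' x)
        = 2 * \<bar>hbar\<bar> * \<bar>x0 $ a * ?y $ c - x0 $ c * ?y $ a\<bar> * norm (?B' x)"
      by (simp only: norm_mult norm_of_real norm_ii norm_numeral mult_1_right)
    also have "\<dots> \<le> (4 * \<bar>hbar\<bar> * s) * norm (?B' x)"
    proof -
      have "\<bar>x0 $ a * ?y $ c - x0 $ c * ?y $ a\<bar> \<le> 2 * s"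
        using abs_component_minor_le[of x0 a ?y c] x0 True by simp
      then have "2 * \<bar>hbar\<bar> * \<bar>x0 $ a * ?y $ c - x0 $ c * ?y $ a\<bar> \<le> 2 * \<bar>hbar\<bar> * (2 * s)"
        by (intro mult_left_mono) auto
      then show ?thesis
        by (intro mult_right_mono) auto
    qed
    also have "norm (of_real (?y $ a * p $ c - ?y $ c * p $ a) * ?B x) \<le> (2 * s * \<Lambda>) * norm (?B x)"
    proof -
      have "\<bar>?y $ a * p $ c - ?y $ c * p $ a\<bar> \<le> 2 * norm ?y * norm p"
        by (rule abs_component_minor_le)
      also have "\<dots> \<le> 2 * s * \<Lambda>"
        using True p s by (intro mult_mono) auto
      finally show ?thesis
        unfolding norm_mult norm_of_real by (intro mult_right_mono) auto
    qed
    finally show ?thesis by simp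
  next
    case False
    have "ang_diff hbar a c \<phi> x = phase ?b x * ang_diff hbar a c ?B x + ang_diff hbar a c (phase ?b) x * ?B x"
      unfolding \<phi>_def coherent_def[abs_def] by (simp add: ang_diff_mult smooth_phase smooth_bump)
    then show ?thesis
      using False s by (simp add: f_def \<phi>_def coherent_def bump_outside ang_diff_bump)
  qed
  have sB: "square_integrable ?B" "square_integrable ?B'"
    using s by (auto intro!: test_function_square_integrable test_function_bump)
  have int: "integrable lborel (\<lambda>x. (norm (?B x))\<^sup>2)" "integrable lborel (\<lambda>x. (norm (?B' x))\<^sup>2)"
    using sB by (auto simp: square_integrable_def)
  have "(norm (abs_l2 f))\<^sup>2 \<le> (\<integral>x. 2 * (4 * \<bar>hbar\<bar> * s)\<^sup>2 * (norm (?B' x))\<^sup>2 + 2 * (2 * s * \<Lambda>)\<^sup>2 * (norm (?B x))\<^sup>2 \<partial>lborel)"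
    unfolding norm_abs_l2[OF sf]
  proof (rule integral_mono)
    show "integrable lborel (\<lambda>x. (norm (f x))\<^sup>2)"
      using sf by (simp add: square_integrable_def)
    show "integrable lborel (\<lambda>x. 2 * (4 * \<bar>hbar\<bar> * s)\<^sup>2 * (norm (?B' x))\<^sup>2 + 2 * (2 * s * \<Lambda>)\<^sup>2 * (norm (?B x))\<^sup>2)"
      using int by (intro Bochner_Integration.integrable_add integrable_mult_right)
    fix x
    let ?u = "(4 * \<bar>hbar\<bar> * s) * norm (?B' x)" and ?v = "(2 * s * \<Lambda>) * norm (?B x)"
    have "(norm (f x))\<^sup>2 \<le> (?u + ?v)\<^sup>2"
      using pointwise by (intro power_mono) auto
    also have "\<dots> \<le> 2 * ?u\<^sup>2 + 2 * ?v\<^sup>2"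
      using zero_le_power2[of "?u - ?v"] unfolding power2_sum power2_diff by linarith
    finally show "(norm (f x))\<^sup>2 \<le> 2 * (4 * \<bar>hbar\<bar> * s)\<^sup>2 * (norm (?B' x))\<^sup>2 + 2 * (2 * s * \<Lambda>)\<^sup>2 * (norm (?B x))\<^sup>2"
      by (simp only: power_mult_distrib mult.assoc)
  qed
  also have "\<dots> = 2 * (4 * \<bar>hbar\<bar> * s)\<^sup>2 * (\<integral>x. (norm (?B' x))\<^sup>2 \<partial>lborel) + 2 * (2 * s * \<Lambda>)\<^sup>2 * (\<integral>x. (norm (?B x))\<^sup>2 \<partial>lborel)"
    using int by (subst Bochner_Integration.integral_add) auto
  also have "\<dots> = 2 * (4 * \<bar>hbar\<bar> * s)\<^sup>2 * (norm (abs_l2 (bump (flat_deriv 1) s 0)))\<^sup>2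
      + 2 * (2 * s * \<Lambda>)\<^sup>2 * (norm (abs_l2 (bump 1 s 0)))\<^sup>2"
    using s by (simp add: integral_bump_translate[of _ s x0] norm_abs_l2 test_function_square_integrable test_function_bump)
  also have "abs_l2 f = abs_l2 (ang_diff hbar a c \<phi>) - l *\<^sub>R abs_l2 \<phi>"
    using sq by (simp add: f_def[abs_def] abs_l2_diff abs_l2_scaleR square_integrable_scaleR)
  finally show ?thesis .
qed

text \<open>A classical particle with angular momentum l: take a unit vector x0 orthogonal to l and
  p = l \<times> x0. Then x0 \<times> (l \<times> x0) = l, as x0 and l are orthogonal.\<close>

lemma cross_factorization:
  fixes l :: "real^3"
  obtains x0 p where "norm x0 = 1" "norm p \<le> norm l" "cross3 x0 p = l"
proof -
  obtain y :: "real^3" where y: "y \<noteq> 0" "orthogonal l y"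
    using orthogonal_to_vector_exists[of l] by auto
  define x0 where "x0 = (1 / norm y) *\<^sub>R y"
  have n: "norm x0 = 1" using y by (simp add: x0_def)
  have o: "x0 \<bullet> l = 0" using y by (simp add: x0_def orthogonal_def inner_commute)
  have "norm (cross3 l x0) \<le> norm l"
  proof -
    have "(norm (cross3 l x0))\<^sup>2 \<le> (norm l)\<^sup>2"
      using n o by (simp add: norm_cross inner_commute)
    then show ?thesis by (rule power2_le_imp_le) simp
  qed
  moreover have "cross3 x0 (cross3 l x0) = l"
    using n o by (simp add: Lagrange norm_eq_sqrt_inner)
  ultimately show ?thesis using n that by blast
qed

lemma approximate_joint_eigenvector:
  assumes "\<epsilon> > 0" "\<Lambda> \<ge> 0"
  obtains \<delta> where "\<delta> > 0"
    "\<And>hbar (l::real^3). hbar \<noteq> 0 \<Longrightarrow> \<bar>hbar\<bar> < \<delta> \<Longrightarrow> norm l \<le> \<Lambda> \<Longrightarrow>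
      \<exists>v w1 w2 w3. norm v = 1 \<and>
        (v, w1) \<in> L_x hbar \<and> norm (w1 - (l $ 1) *\<^sub>R v) < \<epsilon> \<and>
        (v, w2) \<in> L_y hbar \<and> norm (w2 - (l $ 2) *\<^sub>R v) < \<epsilon> \<and>
        (v, w3) \<in> L_z hbar \<and> norm (w3 - (l $ 3) *\<^sub>R v) < \<epsilon>"
proof -
  \<comment> \<open>The factor 5 makes the second error at most 8/25 of
    \<open>\<epsilon>\<^sup>2\<close>, below one half; \<open>\<Lambda> + 1\<close> avoids a zero
    denominator.\<close>
  define s where "s = \<epsilon> / (5 * (\<Lambda> + 1))"
  have s: "s > 0" using assms by (simp add: s_def)
  define N0 where "N0 = norm (abs_l2 (bump 1 s 0))"
  define N1 where "N1 = norm (abs_l2 (bump (flat_deriv 1) s 0))"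
  have N0: "N0 > 0"
    using abs_l2_bump_nonzero[OF s] by (simp add: N0_def)
  \<comment> \<open>Coefficient of \<open>hbar\<^sup>2\<close> in the first error. It depends on s
    through N1, so s has to be fixed before \<delta>.\<close>
  define C where "C = 32 * s\<^sup>2 * N1\<^sup>2"
  have C: "C \<ge> 0" by (simp add: C_def)
  \<comment> \<open>Chosen so that the first error stays below the other half of
    \<open>\<epsilon>\<^sup>2 * N0\<^sup>2\<close>.\<close>
  define \<delta> where "\<delta> = sqrt (\<epsilon>\<^sup>2 * N0\<^sup>2 / (2 * (C + 1)))"
  have \<delta>: "\<delta> > 0" using assms N0 C by (simp add: \<delta>_def)
  have small: "2 * (2 * s * \<Lambda>)\<^sup>2 \<le> \<epsilon>\<^sup>2 / 2"
  proof -
    have "5 * (s * \<Lambda>) \<le> \<epsilon>"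
      using assms by (simp add: s_def field_simps)
    then have "(5 * (s * \<Lambda>))\<^sup>2 \<le> \<epsilon>\<^sup>2"
      using assms s by (intro power_mono) auto
    moreover have "2 * (2 * s * \<Lambda>)\<^sup>2 = 8 * (s * \<Lambda>)\<^sup>2" "(5 * (s * \<Lambda>))\<^sup>2 = 25 * (s * \<Lambda>)\<^sup>2"
      by (simp_all add: power_mult_distrib)
    ultimately show ?thesis
      using zero_le_power2[of "s * \<Lambda>"] by linarith
  qed
  show ?thesis
  proof (rule that[OF \<delta>])
    fix hbar and l :: "real^3"
    assume hbar: "hbar \<noteq> 0" "\<bar>hbar\<bar> < \<delta>" and l: "norm l \<le> \<Lambda>"
    obtain x0 p where x0: "norm x0 = 1" "norm p \<le> norm l" "cross3 x0 p = l"
      by (rule cross_factorization)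
    define \<phi> where "\<phi> = coherent ((1 / hbar) *\<^sub>R p) s x0"
    have \<phi>: "test_function \<phi>"
      using s by (simp add: \<phi>_def test_function_coherent)
    define v where "v = (1 / N0) *\<^sub>R abs_l2 \<phi>"
    have "hbar\<^sup>2 < \<delta>\<^sup>2"
      using hbar(2) by (metis abs_ge_zero power2_abs power_strict_mono zero_less_numeral)
    also have "\<delta>\<^sup>2 = \<epsilon>\<^sup>2 * N0\<^sup>2 / (2 * (C + 1))"
      using C by (simp add: \<delta>_def)
    finally have "(C + 1) * hbar\<^sup>2 < \<epsilon>\<^sup>2 * N0\<^sup>2 / 2"
      using C by (simp add: field_simps)
    then have Ch: "C * hbar\<^sup>2 < \<epsilon>\<^sup>2 * N0\<^sup>2 / 2"
      using zero_le_power2[of hbar] unfolding distrib_right by linarith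
    have approx: "(v, (1 / N0) *\<^sub>R abs_l2 (ang_diff hbar a c \<phi>)) \<in> ang_op hbar a c \<and>
        norm ((1 / N0) *\<^sub>R abs_l2 (ang_diff hbar a c \<phi>) - k *\<^sub>R v) < \<epsilon>"
      if k: "k = x0 $ a * p $ c - x0 $ c * p $ a" for a c k
    proof
      show "(v, (1 / N0) *\<^sub>R abs_l2 (ang_diff hbar a c \<phi>)) \<in> ang_op hbar a c"
        using subspace_mul[OF subspace_ang_op ang_opI[OF \<phi>], of "1 / N0" hbar a c] by (simp add: v_def)
      have "(norm (abs_l2 (ang_diff hbar a c \<phi>) - k *\<^sub>R abs_l2 \<phi>))\<^sup>2
          \<le> 2 * (4 * \<bar>hbar\<bar> * s)\<^sup>2 * N1\<^sup>2 + 2 * (2 * s * \<Lambda>)\<^sup>2 * N0\<^sup>2"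
        unfolding N0_def N1_def \<phi>_def
        by (rule coherent_estimate) (use hbar x0 l s k in auto)
      also have "2 * (4 * \<bar>hbar\<bar> * s)\<^sup>2 * N1\<^sup>2 = C * hbar\<^sup>2"
        by (simp add: C_def power_mult_distrib)
      also have "2 * (2 * s * \<Lambda>)\<^sup>2 * N0\<^sup>2 \<le> \<epsilon>\<^sup>2 / 2 * N0\<^sup>2"
        by (intro mult_right_mono small) simp
      also have "C * hbar\<^sup>2 + \<epsilon>\<^sup>2 / 2 * N0\<^sup>2 < (\<epsilon> * N0)\<^sup>2"
        using Ch by (simp add: power_mult_distrib)
      finally have "norm (abs_l2 (ang_diff hbar a c \<phi>) - k *\<^sub>R abs_l2 \<phi>) < \<epsilon> * N0"
        using assms(1) N0 by (auto intro: power2_less_imp_less)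
      moreover have eq: "(1 / N0) *\<^sub>R abs_l2 (ang_diff hbar a c \<phi>) - k *\<^sub>R v
          = (1 / N0) *\<^sub>R (abs_l2 (ang_diff hbar a c \<phi>) - k *\<^sub>R abs_l2 \<phi>)"
        by (simp add: v_def scaleR_diff_right)
      ultimately show "norm ((1 / N0) *\<^sub>R abs_l2 (ang_diff hbar a c \<phi>) - k *\<^sub>R v) < \<epsilon>"
        unfolding eq norm_scaleR using N0 by (simp add: field_simps)
    qed
    have "norm v = 1"
      using N0 s by (simp add: v_def \<phi>_def norm_coherent flip: N0_def)
    moreover have "l $ 1 = x0 $ 2 * p $ 3 - x0 $ 3 * p $ 2" "l $ 2 = x0 $ 3 * p $ 1 - x0 $ 1 * p $ 3"
      "l $ 3 = x0 $ 1 * p $ 2 - x0 $ 2 * p $ 1"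
      by (simp_all add: cross3_simps flip: x0(3))
    ultimately show "\<exists>v w1 w2 w3. norm v = 1 \<and>
        (v, w1) \<in> L_x hbar \<and> norm (w1 - (l $ 1) *\<^sub>R v) < \<epsilon> \<and>
        (v, w2) \<in> L_y hbar \<and> norm (w2 - (l $ 2) *\<^sub>R v) < \<epsilon> \<and>
        (v, w3) \<in> L_z hbar \<and> norm (w3 - (l $ 3) *\<^sub>R v) < \<epsilon>"
      unfolding L_x_def L_y_def L_z_def using approx by blast
  qed
qed

text \<open>The height of \<open>Phi y\<close> is 1 - 2 / (|y|^2 + 1), so the net stays at least 2 /
  (M^2 + 1) below the north pole. Radius \<eta> is half of that gap, so the closed discs keep away
  from the pole.\<close>

lemma norm_le_if_in_SSp:
  assumes "lam \<in> SSp M \<eta> h" and \<eta>: "\<eta> = 1 / (M\<^sup>2 + 1)"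
  shows "(norm lam)\<^sup>2 \<le> 2 * (M\<^sup>2 + 1)"
proof -
  obtain x where x: "Phi lam \<in> closure (disc x \<eta>)" "x \<in> Sigma_net M \<eta>"
    using assms(1) by (auto simp: SSp_def)
  then obtain z where z: "x = Phi z" "norm z \<le> M"
    by (auto simp: Sigma_net_def D_net_def)
  have "closure (disc x \<eta>) \<subseteq> cball x \<eta>"
    by (rule closure_minimal) (auto simp: disc_def dist_norm norm_minus_commute)
  then have "norm (Phi lam - Phi z) \<le> \<eta>"
    using x(1) z(1) by (auto simp: dist_norm norm_minus_commute)
  then have "\<bar>fst (Phi lam - Phi z)\<bar> \<le> \<eta>"
    using norm_fst_le[of "fst (Phi lam - Phi z)" "snd (Phi lam - Phi z)"]
    by (simp del: fst_diff snd_diff)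
  moreover have "fst (Phi y) = 1 - 2 / ((norm y)\<^sup>2 + 1)" for y
  proof -
    have "(norm y)\<^sup>2 + 1 \<noteq> 0"
      by (smt (verit) zero_le_power2)
    then show ?thesis by (simp add: Phi_def field_simps)
  qed
  ultimately have "2 / ((norm z)\<^sup>2 + 1) - 2 / ((norm lam)\<^sup>2 + 1) \<le> \<eta>"
    by simp
  moreover have "2 / (M\<^sup>2 + 1) \<le> 2 / ((norm z)\<^sup>2 + 1)"
    using z(2) by (intro divide_left_mono add_mono power_mono mult_pos_pos)
      (auto intro: add_nonneg_pos)
  ultimately have "1 / (M\<^sup>2 + 1) \<le> 2 / ((norm lam)\<^sup>2 + 1)"
    by (simp add: \<eta>)
  moreover have "0 < M\<^sup>2 + 1" "0 < (norm lam)\<^sup>2 + 1"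
    by (auto intro: add_nonneg_pos)
  ultimately show ?thesis
    by (simp add: field_simps)
qed

lemma zero_in_D_net:
  assumes "M > 1" "\<eta> > 0"
  shows "0 \<in> D_net M \<eta>"
proof -
  let ?K = "{l::nat. 0 < l \<and> (M + 1) / real l < \<eta> / (2 * sqrt 3)}"
  have e: "\<eta> / (2 * sqrt 3) > 0" using assms by simp
  obtain l where l: "(M + 1) / (\<eta> / (2 * sqrt 3)) < real l"
    using reals_Archimedean2 by blast
  moreover have "0 < (M + 1) / (\<eta> / (2 * sqrt 3))"
    using assms e by (intro divide_pos_pos) auto
  ultimately have "0 < real l" by linarith
  then have "l \<in> ?K"
    using l e by (simp add: field_simps)
  \<comment> \<open>The set is nonempty, so its infimum belongs to it and is positive. Denominator 1
    is then admissible in the grid.\<close>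
  then have "k_idx M \<eta> \<in> ?K"
    unfolding k_idx_def using Inf_nat_def1[of ?K] by blast
  then have "(1::nat) \<in> {1..k_idx M \<eta>}" by simp
  moreover have "(0::real^3) \<in> {\<zeta>. \<exists>m :: 3 \<Rightarrow> int. \<forall>j.
      \<zeta> $ j = of_int (m j) / real 1 \<and> \<bar>of_int (m j)\<bar> \<le> M * real 1}"
    using assms by (auto intro!: exI[of _ "\<lambda>_. 0"])
  ultimately have "0 \<in> grid M (k_idx M \<eta>)"
    unfolding grid_def by blast
  then show ?thesis
    using assms by (simp add: D_net_def)
qed

lemma zero_in_SSp:
  assumes "M > 1" "\<eta> > 0"
  shows "0 \<in> SSp M \<eta> (L_x hbar, L_y hbar, L_z hbar)"
proof -
  interpret symmetric_triple "ang_family hbar"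
    by (rule symmetric_triple_ang_family)
  have Phi0: "Phi 0 = (-1, 0)" by (simp add: Phi_def)
  have "(abs_l2 (bump 1 1 0), 0) \<in> ang_family hbar j" for j
  proof -
    obtain a b where ab: "ang_family hbar j = ang_op hbar a b"
      using ang_family_cases by blast
    show ?thesis
      using ang_opI[OF test_function_bump[of 1 1 0], of hbar a b]
      by (simp add: ab ang_diff_radial_bump abs_l2_zero)
  qed
  then have "1 \<le> norm (Theta_S (Phi 0) \<eta> (ang_family hbar 1, ang_family hbar 2, ang_family hbar 3))"
    unfolding Phi0 by (rule norm_Theta_S_ge_1[OF abs_l2_bump_nonzero[of 1, simplified] _ assms(2)])
  then have "1 - \<eta> \<le> norm (Theta_S (Phi 0) \<eta> (L_x hbar, L_y hbar, L_z hbar))"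
    using assms(2) by (simp add: ang_family_def)
  moreover have "Phi 0 \<in> Sigma_net M \<eta>"
    unfolding Sigma_net_def by (rule imageI[OF zero_in_D_net[OF assms]])
  moreover have "Phi 0 \<in> closure (disc (Phi 0) \<eta>)"
    using assms(2) by (intro subsetD[OF closure_subset]) (simp add: disc_def S3_def north_pole_def Phi0)
  ultimately show ?thesis
    unfolding SSp_def by blast
qed

text \<open>\<open>op_apply\<close> is a definite description, so the dense domain is needed to make
  the closed relation single valued.\<close>

lemma op_apply_ang_family:
  assumes "(v, w) \<in> ang_family hbar j"
  shows "op_apply (ang_family hbar j) v = w"
proof -
  interpret symmetric_triple "ang_family hbar"
    by (rule symmetric_triple_ang_family)
  show ?thesis
    unfolding op_apply_def using assms h_single by blast
qed

theorem theorem7p10: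
  fixes \<epsilon> M :: real
  assumes "\<epsilon> > 0" and "M > 1"
  shows "\<exists>\<eta>>0. \<exists>\<delta>>0. \<forall>hbar::real. hbar \<noteq> 0 \<and> \<bar>hbar\<bar> < \<delta> \<longrightarrow>
    SSp M \<eta> (L_x hbar, L_y hbar, L_z hbar) \<noteq> {} \<and>
    (\<forall>lam \<in> SSp M \<eta> (L_x hbar, L_y hbar, L_z hbar).
       \<exists>v :: l2. norm v = 1 \<and>
         (v \<in> Domain (L_x hbar) \<and> norm (op_apply (L_x hbar) v - (lam $ 1) *\<^sub>R v) < \<epsilon>) \<and>
         (v \<in> Domain (L_y hbar) \<and> norm (op_apply (L_y hbar) v - (lam $ 2) *\<^sub>R v) < \<epsilon>) \<and>
         (v \<in> Domain (L_z hbar) \<and> norm (op_apply (L_z hbar) v - (lam $ 3) *\<^sub>R v) < \<epsilon>))"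
proof -
  define \<eta> where "\<eta> = 1 / (M\<^sup>2 + 1)"
  have \<eta>: "\<eta> > 0" by (simp add: \<eta>_def add_nonneg_pos)
  \<comment> \<open>The radius supplied by \<open>norm_le_if_in_SSp\<close> for this \<eta>.\<close>
  define \<Lambda> where "\<Lambda> = sqrt (2 * (M\<^sup>2 + 1))"
  have "\<Lambda> \<ge> 0" by (simp add: \<Lambda>_def)
  then obtain \<delta> where \<delta>: "\<delta> > 0"
    "\<And>hbar (l::real^3). hbar \<noteq> 0 \<Longrightarrow> \<bar>hbar\<bar> < \<delta> \<Longrightarrow> norm l \<le> \<Lambda> \<Longrightarrow>
      \<exists>v w1 w2 w3. norm v = 1 \<and>
        (v, w1) \<in> L_x hbar \<and> norm (w1 - (l $ 1) *\<^sub>R v) < \<epsilon> \<and>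
        (v, w2) \<in> L_y hbar \<and> norm (w2 - (l $ 2) *\<^sub>R v) < \<epsilon> \<and>
        (v, w3) \<in> L_z hbar \<and> norm (w3 - (l $ 3) *\<^sub>R v) < \<epsilon>"
    using approximate_joint_eigenvector[OF assms(1)] by metis
  have apply_eq: "(v, w) \<in> L_x hbar \<Longrightarrow> op_apply (L_x hbar) v = w"
    "(v, w) \<in> L_y hbar \<Longrightarrow> op_apply (L_y hbar) v = w"
    "(v, w) \<in> L_z hbar \<Longrightarrow> op_apply (L_z hbar) v = w" for v w hbar
    using op_apply_ang_family[of v w hbar 1] op_apply_ang_family[of v w hbar 2]
      op_apply_ang_family[of v w hbar 3] by (simp_all add: ang_family_def)
  have "\<forall>hbar::real. hbar \<noteq> 0 \<and> \<bar>hbar\<bar> < \<delta> \<longrightarrow>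
    SSp M \<eta> (L_x hbar, L_y hbar, L_z hbar) \<noteq> {} \<and>
    (\<forall>lam \<in> SSp M \<eta> (L_x hbar, L_y hbar, L_z hbar).
       \<exists>v :: l2. norm v = 1 \<and>
         (v \<in> Domain (L_x hbar) \<and> norm (op_apply (L_x hbar) v - (lam $ 1) *\<^sub>R v) < \<epsilon>) \<and>
         (v \<in> Domain (L_y hbar) \<and> norm (op_apply (L_y hbar) v - (lam $ 2) *\<^sub>R v) < \<epsilon>) \<and>
         (v \<in> Domain (L_z hbar) \<and> norm (op_apply (L_z hbar) v - (lam $ 3) *\<^sub>R v) < \<epsilon>))"
  proof (intro allI impI conjI ballI)
    fix hbar :: real assume hbar: "hbar \<noteq> 0 \<and> \<bar>hbar\<bar> < \<delta>"
    show "SSp M \<eta> (L_x hbar, L_y hbar, L_z hbar) \<noteq> {}"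
      using zero_in_SSp[OF assms(2) \<eta>] by blast
    fix lam assume "lam \<in> SSp M \<eta> (L_x hbar, L_y hbar, L_z hbar)"
    then have "norm lam \<le> \<Lambda>"
      unfolding \<Lambda>_def using norm_le_if_in_SSp[OF _ \<eta>_def] by (intro real_le_rsqrt)
    with \<delta>(2) hbar obtain v w1 w2 w3 where v: "norm v = 1"
      "(v, w1) \<in> L_x hbar" "norm (w1 - (lam $ 1) *\<^sub>R v) < \<epsilon>"
      "(v, w2) \<in> L_y hbar" "norm (w2 - (lam $ 2) *\<^sub>R v) < \<epsilon>"
      "(v, w3) \<in> L_z hbar" "norm (w3 - (lam $ 3) *\<^sub>R v) < \<epsilon>"
      by blast
    show "\<exists>v :: l2. norm v = 1 \<and>
         (v \<in> Domain (L_x hbar) \<and> norm (op_apply (L_x hbar) v - (lam $ 1) *\<^sub>R v) < \<epsilon>) \<and>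
         (v \<in> Domain (L_y hbar) \<and> norm (op_apply (L_y hbar) v - (lam $ 2) *\<^sub>R v) < \<epsilon>) \<and>
         (v \<in> Domain (L_z hbar) \<and> norm (op_apply (L_z hbar) v - (lam $ 3) *\<^sub>R v) < \<epsilon>)"
      using v by (intro exI[of _ v]) (auto simp: apply_eq)
  qed
  then show ?thesis
    using \<eta> \<delta>(1) by blast
qed

end
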